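(* For each $p\in\mathbb Z_{\ge1}$ with $c(p)=(\ell,m)$, let $p_+=\min\{k>p:\mathfrak j_k=\mathfrak j_p\}$ and let $\mathrm M_{\tilde w}(p_+,p)=\mathrm M(\tilde w_{\le p_+}\Lambda_{\mathfrak j_p},\tilde w_{\le p}\Lambda_{\mathfrak j_p})$ be the corresponding determinantial (cuspidal) module. Then $$\mathrm M_{\tilde w}(p_+,p)\simeq\begin{cases}L[\mathfrak j_p-\ell+m+1,\ \mathfrak j_p+m]&\text{if }\ell+m\equiv0\bmod2,\\ L^{\mathrm{rev}}[\mathfrak j_p-\ell+m-1,\ \mathfrak j_p-\ell]&\text{if }\ell+m\equiv1\bmod2.\end{cases}$$
   Context: **Type $A_\infty$ data.** $J=\mathbb Z$, $P_J=\bigoplus_{i\in J}\mathbb Z\Lambda_i$ with $(\Lambda_i,\Lambda_j)=-|i-j|/2$; $\epsilon_a=\Lambda_a-\Lambda_{a-1}$ (so $(\epsilon_a,\epsilon_b)=\delta_{a,b}$); $\alpha_j=\epsilon_j-\epsilon_{j+1}$; $Q_J^+=\bigoplus_j\mathbb Z_{\ge0}\alpha_j$; $W_J$ is the Weyl group generated by $s_j(\lambda)=\lambda-(\alpha_j,\lambda)\alpha_j$. **Quiver Hecke algebra.** For $\beta\in Q_J^+$, $R(\beta)$ is the graded KLR algebra over a field $\mathbf k$ of characteristic $0$ with generators $e(\nu),x_k,\tau_k$ and parameters $Q_{i,i\pm1}(u,v)=\pm(u-v)$, $Q_{i,i}=0$, $Q_{i,j}=1$ if $|i-j|>1$. $R\text{-gmod}=\bigoplus_\beta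 R(\beta)\text{-gmod}$: finite-dimensional graded modules, with convolution product $\circ$ and grading shift $(qM)_k=M_{k-1}$. A simple module is self-dual if isomorphic to its $\mathbf k$-dual (action twisted by the anti-involution fixing the generators). $L(i)$ is the 1-dimensional $R(\alpha_i)$-module. For $a\le b$, $L[a,b]$ is the 1-dimensional $R(\epsilon_a-\epsilon_{b+1})$-module in degree $0$ with $e(a,a+1,\dots,b)$ acting by $1$ and all $x_k,\tau_k$ by $0$. For $a\ge b$, $L^{\mathrm{rev}}[a,b]$ is the 1-dimensional $R(\epsilon_b-\epsilon_{a+1})$-module in degree $0$ with $e(a,a-1,\dots,b)$ acting by $1$ and all $x_k,\tau_k$ by $0$. **Determinantial modules.** $A_q(\mathfrak n)=\bigoplus_\beta\mathrm{Hom}_{\mathbb Q(q)}(U_q^+(\mathfrak g)_{\beta},\mathbb Q(q))$ ($\mathfrak g$ of type $A_\infty$) with product $(\psi\theta)(x)=\theta(x_{(1)})\psi(x_{(2)})$, $\Delta_{\mathfrak n}(x)=x_{(1)}\otimes x_{(2)}$, where $\Delta_{\mathfrak n}(e_i)=e_i\otimes1+1\otimes e_i$ is an algebra map for the product $(x_1\otimes x_2)(y_1\otimes y_2)=q^{-(\mathrm{wt}x_2,\mathrm{wt}y_1)}x_1y_1\otimes x_2y_2$. There is an injective $\mathbb Z[q^{\pm1}]$-algebra map $\mathrm{ch}:K(R\text{-gmod})\to A_q(\mathfrak n)$ with $[L(i)]\mapsto(e_i\mapsto1)$. For $\Lambda$ dominant and $\mu,\zeta\in W_J\Lambda$, $D(\mu,\zeta)(x)=(xu_\mu,u_\zeta)_\Lambda$,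 with $u_\mu,u_\zeta$ extremal weight vectors of the irreducible highest weight module $V(\Lambda)$ and $(\ ,\ )_\Lambda$ the symmetric form with $(u_\Lambda,u_\Lambda)_\Lambda=1$ for which $e_i,f_i$ are adjoint. $\mathrm M(\mu,\zeta)$ is the self-dual simple module with $\mathrm{ch}(\mathrm M(\mu,\zeta))=D(\mu,\zeta)$ (when this is non-zero). **The sequence $\tilde w$.** For $t\in\mathbb Z_{\ge0}$ let $w^{(t)}=s_{-t}s_{-t+1}\cdots s_{t}\,s_{t+1}\,s_t\cdots s_{-t+1}s_{-t}$ and $\tilde w=w^{(0)}*w^{(1)}*w^{(2)}*\cdots=s_{\mathfrak j_1}s_{\mathfrak j_2}\cdots$ (concatenation); $\tilde w_{\le p}=s_{\mathfrak j_1}\cdots s_{\mathfrak j_p}$. Put $a(t)=t(2t+1)$ for $t\in\frac12\mathbb Z$; $c:\mathbb Z_{\ge1}\to\mathbb Z_{\ge1}^2$ is the bijection with $c^{-1}(\ell,m)=a(\frac{\ell+m-2}2)+\ell$ if $\ell+m$ is even, $a(\frac{\ell+m-2}2)+m$ if $\ell+m$ is odd. *)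

theory Defs
  imports
    "HOL-Library.Poly_Mapping"
    "HOL-Library.Function_Algebras"
    "HOL-Computational_Algebra.Fraction_Field"
    "HOL-Computational_Algebra.Polynomial"
    "HOL-Computational_Algebra.Group_Closure"
    "HOL-Combinatorics.Multiset_Permutations"
    "HOL-Combinatorics.Transposition"
begin

abbreviation "lookup \<equiv> Poly_Mapping.lookup"
abbreviation "keys \<equiv> Poly_Mapping.keys"

section \<open>Type \<open>A\<^sub>\<infinity>\<close> data\<close>

text \<open>An element of the weight lattice is the finitely supported family of its coefficients
  in the basis of the fundamental weights.\<close>

type_synonym weight = "int \<Rightarrow>\<^sub>0 int"

definition Lam :: "int \<Rightarrow> weight" where
  "Lam i = Poly_Mapping.single i 1"

definition wform :: "weight \<Rightarrow> weight \<Rightarrow> rat" where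
  "wform \<mu> \<zeta> = (\<Sum>i\<in>keys \<mu>. \<Sum>j\<in>keys \<zeta>.
     of_int (lookup \<mu> i) * of_int (lookup \<zeta> j) * (- of_int \<bar>i - j\<bar> / 2))"

definition eps :: "int \<Rightarrow> weight" where
  "eps a = Lam a - Lam (a - 1)"

definition alpha :: "int \<Rightarrow> weight" where
  "alpha j = eps j - eps (j + 1)"

text \<open>The form is half-integral on the weight lattice. The integer version below is only used
  when one argument lies in the root lattice, and there nothing is rounded
  (see \<open>pairing_exact\<close>).\<close>

definition pairing :: "weight \<Rightarrow> weight \<Rightarrow> int" where
  "pairing \<mu> \<zeta> = \<lfloor>wform \<mu> \<zeta>\<rfloor>"

lemma wform_superset:
  assumes "finite A" "finite A'" "keys \<mu> \<subseteq> A" "keys \<zeta> \<subseteq> A'"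
  shows "wform \<mu> \<zeta> = (\<Sum>i\<in>A. \<Sum>j\<in>A'.
     of_int (lookup \<mu> i) * of_int (lookup \<zeta> j) * (- of_int \<bar>i - j\<bar> / 2))"
proof -
  have "(\<Sum>j\<in>keys \<zeta>. of_int (lookup \<mu> i) * of_int (lookup \<zeta> j) * (- of_int \<bar>i - j\<bar> / 2))
      = (\<Sum>j\<in>A'. of_int (lookup \<mu> i) * of_int (lookup \<zeta> j) * (- of_int \<bar>i - j\<bar> / 2) :: rat)"
    for i
    by (rule sum.mono_neutral_left) (use assms in \<open>auto simp: in_keys_iff\<close>)
  then have "wform \<mu> \<zeta> = (\<Sum>i\<in>keys \<mu>. \<Sum>j\<in>A'.
     of_int (lookup \<mu> i) * of_int (lookup \<zeta> j) * (- of_int \<bar>i - j\<bar> / 2))"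
    by (simp only: wform_def)
  also have "\<dots> = (\<Sum>i\<in>A. \<Sum>j\<in>A'.
     of_int (lookup \<mu> i) * of_int (lookup \<zeta> j) * (- of_int \<bar>i - j\<bar> / 2))"
    by (rule sum.mono_neutral_left) (use assms in \<open>auto simp: in_keys_iff\<close>)
  finally show ?thesis .
qed

lemma wform_alpha: "wform (alpha j) \<mu> = of_int (lookup \<mu> j)"
proof -
  let ?a = "alpha j"
  have a: "lookup ?a i = (if i = j then 2 else if i = j - 1 \<or> i = j + 1 then - 1 else 0)" for i
    unfolding alpha_def eps_def Lam_def Poly_Mapping.lookup_minus Poly_Mapping.lookup_single
    by (auto simp: when_def)
  have k: "keys ?a \<subseteq> {j - 1, j, j + 1}"
    by (auto simp: in_keys_iff a split: if_splits)
  let ?A = "insert j (keys \<mu>)"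
  have "wform ?a \<mu> = (\<Sum>i\<in>{j - 1, j, j + 1}. \<Sum>l\<in>?A.
     of_int (lookup ?a i) * of_int (lookup \<mu> l) * (- of_int \<bar>i - l\<bar> / 2))"
    by (rule wform_superset) (use k in auto)
  also have "\<dots> = (\<Sum>l\<in>?A. \<Sum>i\<in>{j - 1, j, j + 1}.
     of_int (lookup ?a i) * of_int (lookup \<mu> l) * (- of_int \<bar>i - l\<bar> / 2))"
    by (rule sum.swap)
  also have "\<dots> = (\<Sum>l\<in>?A. if l = j then of_int (lookup \<mu> l) else 0)"
  proof (rule sum.cong)
    fix l :: int
    have "\<bar>j - 1 - l\<bar> + \<bar>j + 1 - l\<bar> - 2 * \<bar>j - l\<bar> = (if l = j then 2 else 0)"
      by arith
    then have *: "of_int \<bar>j - 1 - l\<bar> + of_int \<bar>j + 1 - l\<bar> - 2 * of_int \<bar>j - l\<bar>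
        = (if l = j then 2 else 0 :: rat)"
      by (metis (mono_tags, opaque_lifting) of_int_0 of_int_add of_int_diff of_int_mult of_int_numeral)
    have "(\<Sum>i\<in>{j - 1, j, j + 1}.
        of_int (lookup ?a i) * of_int (lookup \<mu> l) * (- of_int \<bar>i - l\<bar> / 2))
      = of_int (lookup \<mu> l) / 2
        * (of_int \<bar>j - 1 - l\<bar> + of_int \<bar>j + 1 - l\<bar> - 2 * of_int \<bar>j - l\<bar> :: rat)"
      by (simp add: a field_simps del: of_int_abs)
    also have "\<dots> = (if l = j then of_int (lookup \<mu> l) else 0)"
      unfolding * by simp
    finally show "(\<Sum>i\<in>{j - 1, j, j + 1}.
        of_int (lookup ?a i) * of_int (lookup \<mu> l) * (- of_int \<bar>i - l\<bar> / 2))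
      = (if l = j then of_int (lookup \<mu> l) else 0 :: rat)" .
  qed simp
  also have "\<dots> = of_int (lookup \<mu> j)"
    by (simp add: sum.delta)
  finally show ?thesis .
qed

lemma pairing_exact: "of_int (pairing (alpha j) \<mu>) = wform (alpha j) \<mu>"
  by (simp add: pairing_def wform_alpha)

definition srefl :: "int \<Rightarrow> weight \<Rightarrow> weight" where
  "srefl j \<mu> = \<mu> - Poly_Mapping.map (\<lambda>c. pairing (alpha j) \<mu> * c) (alpha j)"

inductive_set weyl_orbit :: "weight \<Rightarrow> weight set" for \<Lambda> where
  base: "\<Lambda> \<in> weyl_orbit \<Lambda>"
| step: "\<mu> \<in> weyl_orbit \<Lambda> \<Longrightarrow> srefl j \<mu> \<in> weyl_orbit \<Lambda>"

definition dominant :: "weight \<Rightarrow> bool" where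
  "dominant \<Lambda> \<longleftrightarrow> (\<forall>j. wform (alpha j) \<Lambda> \<ge> 0)"

text \<open>The simple roots are linearly independent, so the positive root lattice is the free
  commutative monoid on the index set: an element is the multiset of its simple roots.\<close>

type_synonym qplus = "int multiset"

definition qwt :: "qplus \<Rightarrow> weight" where
  "qwt \<beta> = (\<Sum>i\<in>#\<beta>. alpha i)"


section \<open>Free algebras, ideals, actions\<close>

datatype 'g fword = FW (letters: "'g list")

instantiation fword :: (type) monoid_add
begin
definition zero_fword :: "'a fword" where "0 = FW []"
definition plus_fword :: "'a fword \<Rightarrow> 'a fword \<Rightarrow> 'a fword" where
  "v + w = FW (letters v @ letters w)"
instance by standard (auto simp: zero_fword_def plus_fword_def)
end

text \<open>The monoid algebra of the free monoid; its multiplication is the instance for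
  \<open>\<Rightarrow>\<^sub>0\<close>, i.e. concatenation of words.\<close>

type_synonym ('g, 'c) free_alg = "'g fword \<Rightarrow>\<^sub>0 'c"

definition word :: "'g list \<Rightarrow> ('g, 'c::{zero,one}) free_alg" where
  "word w = Poly_Mapping.single (FW w) 1"

definition const :: "'c \<Rightarrow> ('g, 'c::zero) free_alg" where
  "const c = Poly_Mapping.single 0 c"

definition ideal_gen :: "'r::ring_1 set \<Rightarrow> 'r set" where
  "ideal_gen S = group_closure {a * s * b | a s b. s \<in> S}"

text \<open>The action of the free algebra determined by operators for the generators. An algebra
  given by generators and relations is the quotient of the free algebra by the ideal generated
  by the relations; its modules are the modules of the free algebra killed by this ideal, and
  linear functionals on it are functionals on the free algebra vanishing on this ideal.
  Quotients are always handled in this way below.\<close>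

definition free_act ::
  "('c \<Rightarrow> 'v \<Rightarrow> 'v) \<Rightarrow> ('g \<Rightarrow> 'v \<Rightarrow> 'v) \<Rightarrow> ('g, 'c::zero) free_alg \<Rightarrow> 'v \<Rightarrow> 'v::ab_group_add" where
  "free_act scale op x v = (\<Sum>w\<in>keys x. scale (lookup x w) (foldr op (letters w) v))"

definition lin_on ::
  "('c \<Rightarrow> 'v \<Rightarrow> 'v) \<Rightarrow> ('c \<Rightarrow> 'w \<Rightarrow> 'w) \<Rightarrow> 'v set \<Rightarrow> ('v::ab_group_add \<Rightarrow> 'w::ab_group_add) \<Rightarrow> bool" where
  "lin_on s t U f \<longleftrightarrow>
     (\<forall>v\<in>U. \<forall>w\<in>U. f (v + w) = f v + f w) \<and> (\<forall>c. \<forall>v\<in>U. f (s c v) = t c (f v))"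

definition direct_sum_decomp :: "'v::ab_group_add set \<Rightarrow> ('i \<Rightarrow> 'v set) \<Rightarrow> bool" where
  "direct_sum_decomp U G \<longleftrightarrow> (\<forall>i. G i \<subseteq> U) \<and>
     (\<forall>v\<in>U. \<exists>!f. (\<forall>i. f i \<in> G i) \<and> finite {i. f i \<noteq> 0} \<and> v = (\<Sum>i | f i \<noteq> 0. f i))"


section \<open>Quiver Hecke algebras\<close>

datatype klr_gen = GenE "int list" | GenX nat | GenT nat

definition Qpoly :: "int \<Rightarrow> int \<Rightarrow> 'r::ring_1 \<Rightarrow> 'r \<Rightarrow> 'r" where
  "Qpoly i j u v =
     (if j = i + 1 then u - v
      else if j = i - 1 then - (u - v)
      else if j = i then 0 else 1)"

text \<open>The divided difference \<open>(Q\<^sub>i\<^sub>j(u,v) - Q\<^sub>i\<^sub>j(w,v)) / (u - w)\<close> in the braid relation; it is a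
  constant because all \<open>Q\<^sub>i\<^sub>j\<close> have degree at most one in \<open>u\<close>.\<close>

definition Qdiff :: "int \<Rightarrow> int \<Rightarrow> 'r::ring_1" where
  "Qdiff i j = (if j = i + 1 then 1 else if j = i - 1 then - 1 else 0)"

lemma Qdiff: "Qpoly i j u v - Qpoly i j w v = Qdiff i j * (u - w)"
  by (auto simp: Qpoly_def Qdiff_def)

definition swap_at :: "nat \<Rightarrow> int list \<Rightarrow> int list" where
  "swap_at k \<nu> = \<nu>[k - 1 := \<nu> ! k, k := \<nu> ! (k - 1)]"

text \<open>Relations on \<open>e(\<nu>)\<close>, \<open>x\<^sub>k\<close>, \<open>\<tau>\<^sub>k\<close>. One alphabet serves for all \<open>\<beta>\<close>; the second,
  fourth and fifth sets kill the letters that are not generators of \<open>R(\<beta>)\<close>. Positions are counted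
  from 1, so the \<open>k\<close>-th letter of \<open>\<nu>\<close> is \<open>\<nu> ! (k - 1)\<close>.\<close>

definition klr_relations :: "qplus \<Rightarrow> (klr_gen, 'k::field_char_0) free_alg set" where
  "klr_relations \<beta> =
    (let n = size \<beta>; I = permutations_of_multiset \<beta>;
         e = (\<lambda>\<nu>. word [GenE \<nu>]); x = (\<lambda>k. word [GenX k]); \<tau> = (\<lambda>k. word [GenT k]) in
     {e \<nu> * e \<nu>' - (if \<nu> = \<nu>' then e \<nu> else 0) | \<nu> \<nu>'. \<nu> \<in> I \<and> \<nu>' \<in> I}
   \<union> {e \<nu> | \<nu>. \<nu> \<notin> I}
   \<union> {(\<Sum>\<nu>\<in>I. e \<nu>) - 1}
   \<union> {x k | k. k \<notin> {1..n}}
   \<union> {\<tau> k | k. k \<notin> {1..<n}}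
   \<union> {x k * x l - x l * x k | k l. k \<in> {1..n} \<and> l \<in> {1..n}}
   \<union> {x k * e \<nu> - e \<nu> * x k | k \<nu>. k \<in> {1..n} \<and> \<nu> \<in> I}
   \<union> {\<tau> k * e \<nu> - e (swap_at k \<nu>) * \<tau> k | k \<nu>. k \<in> {1..<n} \<and> \<nu> \<in> I}
   \<union> {\<tau> k * \<tau> l - \<tau> l * \<tau> k | k l. k \<in> {1..<n} \<and> l \<in> {1..<n} \<and> \<bar>int k - int l\<bar> > 1}
   \<union> {\<tau> k * \<tau> k * e \<nu> - Qpoly (\<nu> ! (k - 1)) (\<nu> ! k) (x k) (x (k + 1)) * e \<nu>
        | k \<nu>. k \<in> {1..<n} \<and> \<nu> \<in> I}
   \<union> {(\<tau> k * x l - x (transpose k (k + 1) l) * \<tau> k) * e \<nu>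
        - (if \<nu> ! (k - 1) \<noteq> \<nu> ! k then 0
           else if l = k then - e \<nu> else if l = k + 1 then e \<nu> else 0)
        | k l \<nu>. k \<in> {1..<n} \<and> l \<in> {1..n} \<and> \<nu> \<in> I}
   \<union> {(\<tau> (k + 1) * \<tau> k * \<tau> (k + 1) - \<tau> k * \<tau> (k + 1) * \<tau> k) * e \<nu>
        - (if \<nu> ! (k - 1) = \<nu> ! (k + 1) then Qdiff (\<nu> ! (k - 1)) (\<nu> ! k) * e \<nu> else 0)
        | k \<nu>. 1 \<le> k \<and> k + 1 < n \<and> \<nu> \<in> I})"

definition klr_ideal :: "qplus \<Rightarrow> (klr_gen, 'k::field_char_0) free_alg set" where
  "klr_ideal \<beta> = ideal_gen (klr_relations \<beta>)"


section \<open>Finite-dimensional graded modules\<close>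

record ('k, 'v) gmod =
  mcar :: "'v set"
  mscale :: "'k \<Rightarrow> 'v \<Rightarrow> 'v"
  mgen :: "klr_gen \<Rightarrow> 'v \<Rightarrow> 'v"
  mdeg :: "int \<Rightarrow> 'v set"

abbreviation mE :: "('k, 'v) gmod \<Rightarrow> int list \<Rightarrow> 'v \<Rightarrow> 'v" where "mE M \<nu> \<equiv> mgen M (GenE \<nu>)"
abbreviation mX :: "('k, 'v) gmod \<Rightarrow> nat \<Rightarrow> 'v \<Rightarrow> 'v" where "mX M k \<equiv> mgen M (GenX k)"
abbreviation mT :: "('k, 'v) gmod \<Rightarrow> nat \<Rightarrow> 'v \<Rightarrow> 'v" where "mT M k \<equiv> mgen M (GenT k)"

text \<open>The degrees of the generators are \<open>deg e(\<nu>) = 0\<close>, \<open>deg x\<^sub>k e(\<nu>) = (\<alpha>\<^sub>i,\<alpha>\<^sub>i)\<close> with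
  \<open>i = \<nu>\<^sub>k\<close>, and \<open>deg \<tau>\<^sub>k e(\<nu>) = -(\<alpha>\<^sub>i,\<alpha>\<^sub>j)\<close> with \<open>i = \<nu>\<^sub>k\<close>, \<open>j = \<nu>\<^sub>k\<^sub>+\<^sub>1\<close>.\<close>

definition is_gmod :: "qplus \<Rightarrow> ('k::field_char_0, 'v::ab_group_add) gmod \<Rightarrow> bool" where
  "is_gmod \<beta> M \<longleftrightarrow>
     vector_space (mscale M)
   \<and> (\<exists>S. finite S \<and> mcar M = module.span (mscale M) S)
   \<and> (\<forall>g. mgen M g ` mcar M \<subseteq> mcar M \<and> lin_on (mscale M) (mscale M) (mcar M) (mgen M g))
   \<and> (\<forall>r\<in>klr_ideal \<beta>. \<forall>v\<in>mcar M. free_act (mscale M) (mgen M) r v = 0)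
   \<and> (\<forall>d. module.subspace (mscale M) (mdeg M d))
   \<and> direct_sum_decomp (mcar M) (mdeg M)
   \<and> (\<forall>d. \<forall>v\<in>mdeg M d. \<forall>\<nu>\<in>permutations_of_multiset \<beta>.
        mE M \<nu> v \<in> mdeg M d
      \<and> (\<forall>k\<in>{1..size \<beta>}. mX M k (mE M \<nu> v)
            \<in> mdeg M (d + pairing (alpha (\<nu> ! (k - 1))) (alpha (\<nu> ! (k - 1)))))
      \<and> (\<forall>k\<in>{1..<size \<beta>}. mT M k (mE M \<nu> v)
            \<in> mdeg M (d - pairing (alpha (\<nu> ! (k - 1))) (alpha (\<nu> ! k)))))"

definition gmod_hom :: "('k, 'v::ab_group_add) gmod \<Rightarrow> ('k, 'w::ab_group_add) gmod \<Rightarrow> ('v \<Rightarrow> 'w) \<Rightarrow> bool" where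
  "gmod_hom M N f \<longleftrightarrow>
     f ` mcar M \<subseteq> mcar N \<and> lin_on (mscale M) (mscale N) (mcar M) f
   \<and> (\<forall>g. \<forall>v\<in>mcar M. f (mgen M g v) = mgen N g (f v))
   \<and> (\<forall>d. f ` mdeg M d \<subseteq> mdeg N d)"

definition gmod_iso :: "('k, 'v::ab_group_add) gmod \<Rightarrow> ('k, 'w::ab_group_add) gmod \<Rightarrow> bool"
    (infix \<open>\<cong>\<^sub>g\<close> 50) where
  "M \<cong>\<^sub>g N \<longleftrightarrow> (\<exists>f. gmod_hom M N f \<and> bij_betw f (mcar M) (mcar N))"

definition gsubmodule :: "('k::field_char_0, 'v::ab_group_add) gmod \<Rightarrow> 'v set \<Rightarrow> bool" where
  "gsubmodule M S \<longleftrightarrow> S \<subseteq> mcar M \<and> module.subspace (mscale M) S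
     \<and> (\<forall>g. mgen M g ` S \<subseteq> S) \<and> direct_sum_decomp S (\<lambda>d. S \<inter> mdeg M d)"

definition gsimple :: "('k::field_char_0, 'v::ab_group_add) gmod \<Rightarrow> bool" where
  "gsimple M \<longleftrightarrow> mcar M \<noteq> {0} \<and> (\<forall>S. gsubmodule M S \<longrightarrow> S = {0} \<or> S = mcar M)"

text \<open>Functionals are extended by 0 outside the carrier. As the anti-involution fixes the
  generators, a generator acts on the dual by its transpose.\<close>

definition dual_gmod :: "('k::field_char_0, 'v::ab_group_add) gmod \<Rightarrow> ('k, 'v \<Rightarrow> 'k) gmod" where
  "dual_gmod M =
    (let D = {f. lin_on (mscale M) (*) (mcar M) f \<and> (\<forall>v. v \<notin> mcar M \<longrightarrow> f v = 0)} in
     \<lparr> mcar = D,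
       mscale = (\<lambda>c f v. c * f v),
       mgen = (\<lambda>g f v. if v \<in> mcar M then f (mgen M g v) else 0),
       mdeg = (\<lambda>d. {f \<in> D. \<forall>d'. d' \<noteq> - d \<longrightarrow> (\<forall>v\<in>mdeg M d'. f v = 0)}) \<rparr>)"

definition self_dual :: "('k::field_char_0, 'v::ab_group_add) gmod \<Rightarrow> bool" where
  "self_dual M \<longleftrightarrow> M \<cong>\<^sub>g dual_gmod M"

definition qshift :: "('k, 'v) gmod \<Rightarrow> ('k, 'v) gmod" where
  "qshift M = M\<lparr> mdeg := (\<lambda>d. mdeg M (d - 1)) \<rparr>"

definition one_dim :: "int list \<Rightarrow> ('k::field_char_0, 'k) gmod" where
  "one_dim \<nu> = \<lparr> mcar = UNIV, mscale = (*),
     mgen = (\<lambda>g v. if g = GenE \<nu> then v else 0),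
     mdeg = (\<lambda>d. if d = 0 then UNIV else {0}) \<rparr>"

definition L1 :: "int \<Rightarrow> ('k::field_char_0, 'k) gmod" where
  "L1 i = one_dim [i]"

definition Lseg :: "int \<Rightarrow> int \<Rightarrow> ('k::field_char_0, 'k) gmod" where
  "Lseg a b = one_dim [a..b]"

definition Lrev :: "int \<Rightarrow> int \<Rightarrow> ('k::field_char_0, 'k) gmod" where
  "Lrev a b = one_dim (rev [b..a])"

text \<open>Bilinear maps \<open>M \<times> N \<rightarrow> X\<close> of degree 0 that correspond to \<open>R(\<beta>+\<gamma>)\<close>-linear maps
  \<open>R(\<beta>+\<gamma>) e(\<beta>,\<gamma>) \<otimes> (M \<otimes> N) \<rightarrow> X\<close>, the outer tensor product being over
  \<open>R(\<beta>) \<otimes> R(\<gamma>)\<close>. The convolution product is this tensor product, characterised below by its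
  universal property.\<close>

definition conv_map ::
  "qplus \<Rightarrow> qplus \<Rightarrow> ('k::field_char_0, 'v::ab_group_add) gmod \<Rightarrow> ('k, 'v) gmod \<Rightarrow> ('k, 'v) gmod
     \<Rightarrow> ('v \<Rightarrow> 'v \<Rightarrow> 'v) \<Rightarrow> bool" where
  "conv_map \<beta> \<gamma> M N X \<phi> \<longleftrightarrow>
     (\<forall>m\<in>mcar M. \<forall>n\<in>mcar N. \<phi> m n \<in> mcar X)
   \<and> (\<forall>m\<in>mcar M. lin_on (mscale N) (mscale X) (mcar N) (\<phi> m))
   \<and> (\<forall>n\<in>mcar N. lin_on (mscale M) (mscale X) (mcar M) (\<lambda>m. \<phi> m n))
   \<and> (\<forall>c d. \<forall>m\<in>mdeg M c. \<forall>n\<in>mdeg N d. \<phi> m n \<in> mdeg X (c + d))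
   \<and> (\<forall>m\<in>mcar M. \<forall>n\<in>mcar N.
        (\<forall>\<nu>\<in>permutations_of_multiset \<beta>. \<forall>\<mu>\<in>permutations_of_multiset \<gamma>.
           \<phi> (mE M \<nu> m) (mE N \<mu> n) = mE X (\<nu> @ \<mu>) (\<phi> m n))
      \<and> (\<forall>k\<in>{1..size \<beta>}. \<phi> (mX M k m) n = mX X k (\<phi> m n))
      \<and> (\<forall>k\<in>{1..size \<gamma>}. \<phi> m (mX N k n) = mX X (size \<beta> + k) (\<phi> m n))
      \<and> (\<forall>k\<in>{1..<size \<beta>}. \<phi> (mT M k m) n = mT X k (\<phi> m n))
      \<and> (\<forall>k\<in>{1..<size \<gamma>}. \<phi> m (mT N k n) = mT X (size \<beta> + k) (\<phi> m n)))"

definition is_convolution ::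
  "qplus \<Rightarrow> qplus \<Rightarrow> ('k::field_char_0, 'v::ab_group_add) gmod \<Rightarrow> ('k, 'v) gmod \<Rightarrow> ('k, 'v) gmod
     \<Rightarrow> bool" where
  "is_convolution \<beta> \<gamma> M N P \<longleftrightarrow> is_gmod (\<beta> + \<gamma>) P \<and>
     (\<exists>\<phi>. conv_map \<beta> \<gamma> M N P \<phi> \<and>
       (\<forall>X \<psi>. is_gmod (\<beta> + \<gamma>) X \<and> conv_map \<beta> \<gamma> M N X \<psi> \<longrightarrow>
         (\<exists>h. gmod_hom P X h \<and> (\<forall>m\<in>mcar M. \<forall>n\<in>mcar N. h (\<phi> m n) = \<psi> m n)
            \<and> (\<forall>h'. gmod_hom P X h' \<and> (\<forall>m\<in>mcar M. \<forall>n\<in>mcar N. h' (\<phi> m n) = \<psi> m n)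
                 \<longrightarrow> (\<forall>v\<in>mcar P. h' v = h v)))))"


section \<open>The Grothendieck group\<close>

text \<open>Every finite-dimensional module has a copy whose underlying space lies in the following
  space of countable dimension, so these modules suffice to form the Grothendieck group
  \<open>K(R-gmod)\<close>. It is the quotient of the free abelian group \<open>groth_free\<close> on the modules by the
  subgroup \<open>groth_relations\<close> coming from short exact sequences.\<close>

type_synonym 'k rmod = "('k, nat \<Rightarrow>\<^sub>0 'k) gmod"

definition is_ses :: "('k, 'v::ab_group_add) gmod \<Rightarrow> ('k, 'v) gmod \<Rightarrow> ('k, 'v) gmod \<Rightarrow> bool" where
  "is_ses M' M M'' \<longleftrightarrow> (\<exists>f g. gmod_hom M' M f \<and> gmod_hom M M'' g
     \<and> inj_on f (mcar M') \<and> g ` mcar M = mcar M''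
     \<and> f ` mcar M' = {v \<in> mcar M. g v = 0})"

definition gcls :: "'k rmod \<Rightarrow> ('k::field_char_0 rmod \<Rightarrow>\<^sub>0 int)" where
  "gcls M = Poly_Mapping.single M 1"

definition groth_free :: "('k::field_char_0 rmod \<Rightarrow>\<^sub>0 int) set" where
  "groth_free = group_closure {gcls M | M. \<exists>\<beta>. is_gmod \<beta> M}"

definition groth_relations :: "('k::field_char_0 rmod \<Rightarrow>\<^sub>0 int) set" where
  "groth_relations = group_closure {gcls M - gcls M' - gcls M'' | M' M M'' \<beta>.
     is_gmod \<beta> M' \<and> is_gmod \<beta> M \<and> is_gmod \<beta> M'' \<and> is_ses M' M M''}"


section \<open>The quantum unipotent coordinate ring\<close>

type_synonym qfield = "rat poly fract"

definition qq :: qfield where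
  "qq = Fraction_Field.Fract [:0, 1:] 1"

definition qint :: "int \<Rightarrow> qfield" where
  "qint n = (qq powi n - qq powi (- n)) / (qq - inverse qq)"

definition qfact :: "nat \<Rightarrow> qfield" where
  "qfact n = (\<Prod>k\<in>{1..n}. qint (int k))"

text \<open>\<open>U\<^sub>q\<^sup>+\<close> is presented by generators \<open>e\<^sub>i\<close> and the quantum Serre relations.\<close>

type_synonym uq_free = "(int, qfield) free_alg"

definition serre_relations :: "uq_free set" where
  "serre_relations =
     {word [i, j] - word [j, i] | i j. \<bar>i - j\<bar> > 1}
   \<union> {word [i, i, j] - const (qint 2) * word [i, j, i] + word [j, i, i] | i j. \<bar>i - j\<bar> = 1}"

definition serre_ideal :: "uq_free set" where
  "serre_ideal = ideal_gen serre_relations"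

definition Aqn :: "(uq_free \<Rightarrow> qfield) set" where
  "Aqn = {\<psi>. (\<forall>x y. \<psi> (x + y) = \<psi> x + \<psi> y) \<and> (\<forall>c x. \<psi> (const c * x) = c * \<psi> x)
     \<and> (\<forall>x\<in>serre_ideal. \<psi> x = 0)
     \<and> finite {mset w | w. \<psi> (word w) \<noteq> 0}}"

type_synonym uq_tensor = "int fword \<times> int fword \<Rightarrow>\<^sub>0 qfield"

definition twisted_mult :: "uq_tensor \<Rightarrow> uq_tensor \<Rightarrow> uq_tensor" where
  "twisted_mult A B = (\<Sum>(x1, x2)\<in>keys A. \<Sum>(y1, y2)\<in>keys B.
     Poly_Mapping.single (x1 + y1, x2 + y2)
       (qq powi (- pairing (qwt (mset (letters x2))) (qwt (mset (letters y1))))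
        * lookup A (x1, x2) * lookup B (y1, y2)))"

primrec coprod_word :: "int list \<Rightarrow> uq_tensor" where
  "coprod_word [] = Poly_Mapping.single (0, 0) 1"
| "coprod_word (i # w) = twisted_mult
     (Poly_Mapping.single (FW [i], 0) 1 + Poly_Mapping.single (0, FW [i]) 1) (coprod_word w)"

definition Aqn_mult :: "(uq_free \<Rightarrow> qfield) \<Rightarrow> (uq_free \<Rightarrow> qfield) \<Rightarrow> uq_free \<Rightarrow> qfield" where
  "Aqn_mult \<psi> \<theta> x = (\<Sum>w\<in>keys x. lookup x w *
     (\<Sum>(u, v)\<in>keys (coprod_word (letters w)).
        lookup (coprod_word (letters w)) (u, v) * \<theta> (word (letters u)) * \<psi> (word (letters v))))"

definition Aqn_one :: "uq_free \<Rightarrow> qfield" where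
  "Aqn_one x = lookup x 0"

definition e_dual :: "int \<Rightarrow> uq_free \<Rightarrow> qfield" where
  "e_dual i x = lookup x (FW [i])"

text \<open>An injective algebra homomorphism \<open>K(R-gmod) \<rightarrow> A\<^sub>q(\<nn>)\<close> over the Laurent polynomials in
  \<open>q\<close>, given on the free abelian group on modules: it is additive with kernel exactly
  \<open>groth_relations\<close>.\<close>

definition is_ch :: "(('k::field_char_0 rmod \<Rightarrow>\<^sub>0 int) \<Rightarrow> uq_free \<Rightarrow> qfield) \<Rightarrow> bool" where
  "is_ch ch \<longleftrightarrow>
     (\<forall>z\<in>groth_free. ch z \<in> Aqn)
   \<and> (\<forall>y\<in>groth_free. \<forall>z\<in>groth_free. ch (y + z) = ch y + ch z)
   \<and> (\<forall>z\<in>groth_free. ch z = 0 \<longleftrightarrow> z \<in> groth_relations)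
   \<and> (\<forall>\<beta> M. is_gmod \<beta> M \<longrightarrow> ch (gcls (qshift M)) = (\<lambda>x. qq * ch (gcls M) x))
   \<and> (\<forall>\<beta> \<gamma> M N P. is_gmod \<beta> M \<and> is_gmod \<gamma> N \<and> is_convolution \<beta> \<gamma> M N P \<longrightarrow>
        ch (gcls P) = Aqn_mult (ch (gcls M)) (ch (gcls N)))
   \<and> (\<forall>M. is_gmod {#} M \<and> M \<cong>\<^sub>g (one_dim [] :: ('k, 'k) gmod) \<longrightarrow> ch (gcls M) = Aqn_one)
   \<and> (\<forall>i M. is_gmod {#i#} M \<and> M \<cong>\<^sub>g (L1 i :: ('k, 'k) gmod) \<longrightarrow> ch (gcls M) = e_dual i)"


section \<open>Highest weight modules and determinantial modules\<close>

text \<open>A weight module over \<open>U\<^sub>q(\<gg>)\<close>: the torus is recorded by the weight space decomposition,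
  \<open>q\<^sup>h\<close> acting on the space of weight \<open>\<mu>\<close> by \<open>q\<close> to the power \<open>\<langle>h,\<mu>\<rangle>\<close>.\<close>

record 'u uqmod =
  uscale :: "qfield \<Rightarrow> 'u \<Rightarrow> 'u"
  uE :: "int \<Rightarrow> 'u \<Rightarrow> 'u"
  uF :: "int \<Rightarrow> 'u \<Rightarrow> 'u"
  uwt :: "weight \<Rightarrow> 'u set"

definition is_uqmod :: "'u::ab_group_add uqmod \<Rightarrow> bool" where
  "is_uqmod V \<longleftrightarrow>
     vector_space (uscale V)
   \<and> (\<forall>i. lin_on (uscale V) (uscale V) UNIV (uE V i) \<and> lin_on (uscale V) (uscale V) UNIV (uF V i))
   \<and> (\<forall>\<mu>. module.subspace (uscale V) (uwt V \<mu>)) \<and> direct_sum_decomp UNIV (uwt V)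
   \<and> (\<forall>i \<mu>. \<forall>v\<in>uwt V \<mu>. uE V i v \<in> uwt V (\<mu> + alpha i) \<and> uF V i v \<in> uwt V (\<mu> - alpha i))
   \<and> (\<forall>i j \<mu>. \<forall>v\<in>uwt V \<mu>. uE V i (uF V j v) - uF V j (uE V i v)
        = (if i = j then uscale V (qint (pairing (alpha i) \<mu>)) v else 0))
   \<and> (\<forall>r\<in>serre_ideal. \<forall>v.
        free_act (uscale V) (uE V) r v = 0 \<and> free_act (uscale V) (uF V) r v = 0)"

definition irreducible_uqmod :: "'u::ab_group_add uqmod \<Rightarrow> bool" where
  "irreducible_uqmod V \<longleftrightarrow> (\<exists>v::'u. v \<noteq> 0) \<and>
     (\<forall>S. module.subspace (uscale V) S \<and> (\<forall>i. uE V i ` S \<subseteq> S \<and> uF V i ` S \<subseteq> S)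
        \<and> direct_sum_decomp S (\<lambda>\<mu>. S \<inter> uwt V \<mu>) \<longrightarrow> S = {0} \<or> S = UNIV)"

text \<open>\<open>V\<close> is the irreducible module \<open>V(\<Lambda>)\<close> with highest weight vector \<open>u \<Lambda>\<close>; the vectors
  \<open>u \<mu>\<close> for \<open>\<mu>\<close> in the Weyl orbit are the extremal weight vectors, normalised by divided powers;
  \<open>B\<close> is the contravariant form. All of this is unique up to isomorphism and the choice
  of \<open>u \<Lambda>\<close>, which does not affect the functionals \<open>det_fun\<close> below.\<close>

definition is_hw_model ::
  "weight \<Rightarrow> 'u::ab_group_add uqmod \<Rightarrow> (weight \<Rightarrow> 'u) \<Rightarrow> ('u \<Rightarrow> 'u \<Rightarrow> qfield) \<Rightarrow> bool" where
  "is_hw_model \<Lambda> V u B \<longleftrightarrow>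
     dominant \<Lambda> \<and> is_uqmod V \<and> irreducible_uqmod V
   \<and> u \<Lambda> \<in> uwt V \<Lambda> \<and> u \<Lambda> \<noteq> 0 \<and> (\<forall>i. uE V i (u \<Lambda>) = 0)
   \<and> (\<forall>\<mu>\<in>weyl_orbit \<Lambda>. \<forall>i. let n = pairing (alpha i) \<mu> in
        (n \<ge> 0 \<longrightarrow> uE V i (u \<mu>) = 0 \<and>
           u (srefl i \<mu>) = uscale V (inverse (qfact (nat n))) ((uF V i ^^ nat n) (u \<mu>)))
      \<and> (n \<le> 0 \<longrightarrow> uF V i (u \<mu>) = 0 \<and>
           u (srefl i \<mu>) = uscale V (inverse (qfact (nat (- n)))) ((uE V i ^^ nat (- n)) (u \<mu>))))
   \<and> (\<forall>v. lin_on (uscale V) (*) UNIV (B v)) \<and> (\<forall>v w. B v w = B w v)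
   \<and> (\<forall>i v w. B (uE V i v) w = B v (uF V i w))
   \<and> B (u \<Lambda>) (u \<Lambda>) = 1"

definition det_fun ::
  "'u::ab_group_add uqmod \<Rightarrow> (weight \<Rightarrow> 'u) \<Rightarrow> ('u \<Rightarrow> 'u \<Rightarrow> qfield) \<Rightarrow> weight \<Rightarrow> weight
     \<Rightarrow> uq_free \<Rightarrow> qfield" where
  "det_fun V u B \<mu> \<zeta> x = B (free_act (uscale V) (uE V) x (u \<mu>)) (u \<zeta>)"

definition is_det_module ::
  "(('k::field_char_0 rmod \<Rightarrow>\<^sub>0 int) \<Rightarrow> uq_free \<Rightarrow> qfield) \<Rightarrow>
   'u::ab_group_add uqmod \<Rightarrow> (weight \<Rightarrow> 'u) \<Rightarrow> ('u \<Rightarrow> 'u \<Rightarrow> qfield) \<Rightarrow>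
   weight \<Rightarrow> weight \<Rightarrow> 'k rmod \<Rightarrow> bool" where
  "is_det_module ch V u B \<mu> \<zeta> M \<longleftrightarrow>
     (\<exists>\<beta>. is_gmod \<beta> M) \<and> gsimple M \<and> self_dual M \<and> ch (gcls M) = det_fun V u B \<mu> \<zeta>"


section \<open>The sequence \<open>w~\<close>\<close>

definition wblock :: "nat \<Rightarrow> int list" where
  "wblock t = [- int t..int t] @ [int t + 1] @ rev [- int t..int t]"

text \<open>The index of the \<open>p\<close>-th reflection, for \<open>p \<ge> 1\<close>; the first \<open>p\<close> blocks have more than \<open>p\<close>
  letters.\<close>

definition jseq :: "nat \<Rightarrow> int" where
  "jseq p = concat (map wblock [0..<p]) ! (p - 1)"

definition wtilde_act :: "nat \<Rightarrow> weight \<Rightarrow> weight" where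
  "wtilde_act p \<Lambda> = foldr srefl (map jseq [1..<Suc p]) \<Lambda>"

definition pplus :: "nat \<Rightarrow> nat" where
  "pplus p = (LEAST k. k > p \<and> jseq k = jseq p)"

definition afun :: "rat \<Rightarrow> rat" where
  "afun t = t * (2 * t + 1)"

definition cinv :: "nat \<times> nat \<Rightarrow> nat" where
  "cinv = (\<lambda>(l, m). nat \<lfloor>afun ((of_nat l + of_nat m - 2) / 2)\<rfloor> + (if even (l + m) then l else m))"

definition cfun :: "nat \<Rightarrow> nat \<times> nat" where
  "cfun = inv_into ({1..} \<times> {1..}) cinv"

text \<open>\<open>M\<close> is the module attached to \<open>(p\<^sub>+, p)\<close>, where \<open>V\<close>, \<open>u\<close>, \<open>B\<close> is a model of
  \<open>V(\<Lambda>\<^sub>j)\<close> with \<open>j = jseq p\<close>.\<close>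

definition is_cuspidal_module ::
  "(('k::field_char_0 rmod \<Rightarrow>\<^sub>0 int) \<Rightarrow> uq_free \<Rightarrow> qfield) \<Rightarrow>
   'u::ab_group_add uqmod \<Rightarrow> (weight \<Rightarrow> 'u) \<Rightarrow> ('u \<Rightarrow> 'u \<Rightarrow> qfield) \<Rightarrow> nat \<Rightarrow> 'k rmod \<Rightarrow> bool" where
  "is_cuspidal_module ch V u B p M \<longleftrightarrow>
     is_det_module ch V u B (wtilde_act (pplus p) (Lam (jseq p))) (wtilde_act p (Lam (jseq p))) M"

end

theory Submission
  imports Defs
begin

text \<open>The prefix of the word that ends with the block \<open>t\<close> acts as a reflection of an interval, so the two extremal
  weights of \<open>V(\<Lambda>\<^sub>j)\<close> are explicit Maya diagrams, and they differ by a sum \<open>\<nu>\<close> of consecutive simple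
  roots that can be applied in only one order. Hence the generalised minor is the functional dual to a
  single word. On the other side, for a word \<open>\<nu> = c W\<close> of consecutive letters there are exact sequences
  \<open>0 \<rightarrow> q K \<rightarrow> L(c) \<circ> L(W) \<rightarrow> L(\<nu>) \<rightarrow> 0\<close> and \<open>0 \<rightarrow> q L(\<nu>) \<rightarrow> L(W) \<circ> L(c) \<rightarrow> K \<rightarrow> 0\<close>, so that
  \<open>(1 - q\<^sup>2) [L(\<nu>)] = [L(c)][L(W)] - q [L(W)][L(c)]\<close>, and by induction the character of \<open>L(\<nu>)\<close> is the dual
  of the word \<open>\<nu>\<close> read backwards. Finally, a self-dual module with the class of \<open>L(\<nu>)\<close> has the same
  dimension and weight spaces as \<open>L(\<nu>)\<close>, which forces it to be isomorphic to \<open>L(\<nu>)\<close>.\<close>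

section \<open>Weights and the sequence of reflections\<close>

text \<open>The map \<open>ch\<close> is known only through its algebraic properties, so its value
  on L(\<nu>) cannot be read off from weight spaces; identities in the Grothendieck group have to be
  produced that force it. Convolution products enter these identities through a universal property,
  so they must be exhibited as concrete modules. This is feasible because the letters of \<nu> are
  pairwise distinct: the shuffles of c into W are then different words, every idempotent cuts out at
  most a line, and each generator sends a basis vector to a basis vector or to 0. Two reversals
  meet. A word of operators e_i applies its last letter first, and the product of A_q(n) evaluates
  its second factor on the first tensor leg; hence both the minor and the character are dual to
  \<nu> read backwards. The kernel of \<open>ch\<close> consists of the relations from short exact
  sequences, so every function additive on such sequences is determined by the character. Total
  dimension and dimension of the e(\<nu>) part are two such functions, and self-duality fixes the
  grading shift.\<close>

lemma lookup_eps: "lookup (eps a) i = of_bool (i = a) - of_bool (i = a - 1)"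
  by (simp add: eps_def Lam_def lookup_minus lookup_single when_def)

lemma lookup_alpha: "lookup (alpha j) i = 2 * of_bool (i = j) - of_bool (\<bar>i - j\<bar> = 1)"
  by (auto simp: alpha_def lookup_minus lookup_eps)

lemma pairing_alpha: "pairing (alpha i) \<mu> = lookup \<mu> i"
  by (simp add: pairing_def wform_alpha)

lemma pairing_zero_left: "pairing 0 \<mu> = 0"
  by (simp add: pairing_def wform_def)

lemma qwt_empty [simp]: "qwt {#} = 0"
  and qwt_add_mset [simp]: "qwt (add_mset i \<beta>) = alpha i + qwt \<beta>"
  by (simp_all add: qwt_def)

lemma lookup_qwt_count:
  "lookup (qwt \<beta>) i = 2 * int (count \<beta> i) - int (count \<beta> (i - 1)) - int (count \<beta> (i + 1))"
  by (induction \<beta>) (auto simp: lookup_add lookup_alpha)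

text \<open>The difference c of the two multiplicity functions has zero second difference on the
  integers and finite support; just above the largest support point the recursion forces the value
  at that point to vanish.\<close>

lemma qwt_inj:
  assumes "qwt \<beta> = qwt \<gamma>"
  shows "\<beta> = \<gamma>"
proof (rule multiset_eqI, rule ccontr)
  fix i
  define c where "c k = int (count \<beta> k) - int (count \<gamma> k)" for k
  have rec: "2 * c k = c (k - 1) + c (k + 1)" for k
    using arg_cong [OF assms, of "\<lambda>w. lookup w k"] unfolding lookup_qwt_count c_def
    by (simp add: algebra_simps)
  let ?S = "{k. c k \<noteq> 0}"
  assume "count \<beta> i \<noteq> count \<gamma> i"
  then have ne: "i \<in> ?S" by (simp add: c_def)
  have "?S \<subseteq> set_mset \<beta> \<union> set_mset \<gamma>"
    by (auto simp: c_def) (metis count_eq_zero_iff)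
  then have fin: "finite ?S" by (rule finite_subset) simp
  have "Max ?S + 1 \<notin> ?S" "Max ?S + 1 + 1 \<notin> ?S"
    using Max_ge [OF fin] by fastforce+
  then have "c (Max ?S) = 0" using rec [of "Max ?S + 1"] by simp
  moreover have "Max ?S \<in> ?S" using fin ne by (intro Max_in) auto
  ultimately show False by simp
qed

lemma lookup_srefl: "lookup (srefl j \<mu>) i = lookup \<mu> i - lookup \<mu> j * lookup (alpha j) i"
  by (simp add: srefl_def lookup_minus pairing_alpha Poly_Mapping.map.rep_eq when_def)

text \<open>A weight of the minuscule module \<open>V(\<Lambda>\<^sub>j)\<close> is the formal sum of \<open>\<epsilon>\<^sub>a\<close> over a set of integers
  containing almost all negative and almost no positive numbers; reflections permute
  these sets.\<close>

definition maya :: "int set \<Rightarrow> weight \<Rightarrow> bool" where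
  "maya S \<mu> \<longleftrightarrow> (\<forall>i. lookup \<mu> i = of_bool (i \<in> S) - of_bool (i + 1 \<in> S))"

lemma maya_Lam: "maya {..j} (Lam j)"
  by (auto simp: maya_def Lam_def lookup_single when_def)

text \<open>s_i exchanges \<epsilon>_i and \<epsilon>_(i+1), and the coefficient of \<mu> at i tells
  which of i and i + 1 lies in S. Only the coefficients at i - 1, i and i + 1 can change, whence the
  case split.\<close>

lemma maya_srefl:
  assumes "maya S \<mu>"
  shows "maya (transpose i (i + 1) ` S) (srefl i \<mu>)"
proof -
  have mem: "k \<in> transpose i (i + 1) ` S \<longleftrightarrow> transpose i (i + 1) k \<in> S" for k
    by (auto intro: image_eqI [of _ _ "transpose i (i + 1) k"])
  have l: "lookup \<mu> k = of_bool (k \<in> S) - of_bool (k + 1 \<in> S)" for k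
    using assms unfolding maya_def by blast
  show ?thesis
    unfolding maya_def lookup_srefl lookup_alpha mem l
  proof
    fix k
    have "k = i - 1 \<or> k = i \<or> k = i + 1 \<or> k < i - 1 \<or> k > i + 1" by linarith
    then show "of_bool (k \<in> S) - of_bool (k + 1 \<in> S)
        - (of_bool (i \<in> S) - of_bool (i + 1 \<in> S)) * (2 * of_bool (k = i) - of_bool (\<bar>k - i\<bar> = 1)) =
      (of_bool (transpose i (i + 1) k \<in> S) - of_bool (transpose i (i + 1) (k + 1) \<in> S) :: int)"
      by (elim disjE) (auto simp: transpose_def)
  qed
qed

lemma maya_orbit:
  assumes "\<mu> \<in> weyl_orbit (Lam j)"
  shows "\<exists>S. maya S \<mu>"
  using assms by induction (blast intro: maya_Lam maya_srefl)+

section \<open>Words in simple reflections as permutations of the integers\<close>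

definition refls :: "int list \<Rightarrow> int \<Rightarrow> int" where
  "refls w = foldr (\<lambda>i. transpose i (i + 1)) w"

lemma refls_simps [simp]:
  "refls [] x = x" "refls (i # w) x = transpose i (i + 1) (refls w x)"
  "refls (v @ w) x = refls v (refls w x)"
  by (simp_all add: refls_def)

lemma maya_refls: "maya S \<mu> \<Longrightarrow> maya (refls w ` S) (foldr srefl w \<mu>)"
proof (induction w)
  case (Cons i w)
  then have "maya (transpose i (i + 1) ` refls w ` S) (foldr srefl (i # w) \<mu>)"
    by (simp add: maya_srefl)
  then show ?case by (simp add: image_image)
qed (simp add: refls_def)

lemma foldr_srefl_orbit: "foldr srefl w \<Lambda> \<in> weyl_orbit \<Lambda>"
  by (induction w) (auto intro: weyl_orbit.intros)

text \<open>T arises from S by trading b + 1 for a, so the weights differ by \<epsilon>_a -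
  \<epsilon>_(b+1), which telescopes to \<alpha>_a + ... + \<alpha>_b.\<close>

lemma maya_add_root:
  assumes "maya S \<mu>" "maya T \<zeta>" "a \<le> b"
    and "\<And>i. of_bool (i \<in> T) - of_bool (i \<in> S) = (of_bool (i = a) - of_bool (i = b + 1) :: int)"
  shows "\<zeta> = \<mu> + qwt (mset [a..b])"
proof (rule poly_mapping_eqI)
  have cnt: "count (mset [a..b]) i = of_bool (a \<le> i \<and> i \<le> b)" for i
    using distinct_upto [of a b] by (simp add: distinct_count_atmost_1)
  fix k
  have l1: "lookup \<mu> k = of_bool (k \<in> S) - of_bool (k + 1 \<in> S)"
    and l2: "lookup \<zeta> k = of_bool (k \<in> T) - of_bool (k + 1 \<in> T)"
    using assms(1,2) unfolding maya_def by blast+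
  have "lookup \<zeta> k - lookup \<mu> k
      = (of_bool (k = a) - of_bool (k = b + 1)) - (of_bool (k + 1 = a) - of_bool (k + 1 = b + 1))"
    unfolding assms(4) [symmetric] l1 l2 by simp
  also have "\<dots> = lookup (qwt (mset [a..b])) k"
    using \<open>a \<le> b\<close> unfolding lookup_qwt_count cnt by (auto simp: of_bool_def)
  finally show "lookup \<zeta> k = lookup (\<mu> + qwt (mset [a..b])) k"
    by (simp add: lookup_add)
qed

lemma refls_upto: "refls [a..b] x = (if a \<le> x \<and> x \<le> b then x + 1 else if x = b + 1 \<and> a \<le> b then a else x)"
proof (induction "nat (b + 1 - a)" arbitrary: a)
  case (Suc n)
  then have "refls [a..b] x = transpose a (a + 1) (refls [a + 1..b] x)" "a \<le> b"
    by (simp_all add: upto_rec1)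
  moreover have "n = nat (b + 1 - (a + 1))" using Suc(2) by simp
  note Suc(1) [OF this]
  ultimately show ?case by (auto simp: transpose_def)
qed auto

lemma refls_rev_upto:
  "refls (rev [a..b]) x = (if a < x \<and> x \<le> b + 1 then x - 1 else if x = a \<and> a \<le> b then b + 1 else x)"
proof (induction "nat (b + 1 - a)" arbitrary: a x)
  case (Suc n)
  then have ab: "a \<le> b" by simp
  have "refls (rev [a..b]) x = refls (rev [a + 1..b]) (transpose a (a + 1) x)"
    using ab by (simp add: upto_rec1)
  also have "\<dots> = (if a + 1 < transpose a (a + 1) x \<and> transpose a (a + 1) x \<le> b + 1
      then transpose a (a + 1) x - 1
      else if transpose a (a + 1) x = a + 1 \<and> a + 1 \<le> b then b + 1 else transpose a (a + 1) x)"
    using Suc(2) by (intro Suc(1)) simp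
  also have "\<dots> = (if a < x \<and> x \<le> b + 1 then x - 1 else if x = a \<and> a \<le> b then b + 1 else x)"
    using ab by (auto simp: transpose_def)
  finally show ?case .
qed auto

text \<open>The block is a palindrome, hence the conjugate of its middle letter, the transposition
  of t + 1 and t + 2, by the cycle of [- t..t]. This cycle sends t + 1 to - t and fixes t +
  2.\<close>

lemma refls_wblock: "refls (wblock t) = transpose (- int t) (int t + 2)"
  by (rule ext) (auto simp: wblock_def refls_upto refls_rev_upto transpose_def)

definition blocks :: "nat \<Rightarrow> int list" where
  "blocks t = concat (map wblock [0..<t])"

lemma blocks_Suc: "blocks (Suc t) = blocks t @ wblock t"
  by (simp add: blocks_def)

text \<open>The blocks act by transpositions of - s and s + 2, disjoint pairs symmetric about 1;
  together they reverse the interval from 1 - t to 1 + t.\<close>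

lemma refls_blocks: "refls (blocks t) x = (if 1 - int t \<le> x \<and> x \<le> 1 + int t then 2 - x else x)"
  by (induction t arbitrary: x) (auto simp: blocks_def refls_wblock transpose_def)

lemma length_wblock: "length (wblock t) = 4 * t + 3"
  by (simp add: wblock_def)

text \<open>This number is a(t), so that the formula for \<open>cinv\<close> with l + m even counts
  from the start of a block.\<close>

lemma length_blocks: "length (blocks t) = t * (2 * t + 1)"
  by (induction t) (auto simp: blocks_Suc length_wblock blocks_def)

lemma nth_wblock:
  assumes "r < 4 * t + 3"
  shows "wblock t ! r = (if r < 2 * t + 1 then int r - int t else 3 * int t + 2 - int r)"
  using assms by (auto simp: wblock_def nth_append rev_nth nth_Cons' of_nat_diff)

lemma jseq_block:
  assumes "r < 4 * t + 3"
  shows "jseq (t * (2 * t + 1) + Suc r) = wblock t ! r"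
proof -
  let ?p = "t * (2 * t + 1) + Suc r"
  \<comment> \<open>\<open>jseq\<close> concatenates only as many blocks as its argument, so block t
    has to be shown to be among them.\<close>
  have "Suc t \<le> ?p" by simp
  then have "[0..<?p] = [0..<Suc t] @ [Suc t..<?p]"
    by (metis le_add_diff_inverse plus_nat.add_0 upt_add_eq_append zero_le)
  then have "concat (map wblock [0..<?p]) = blocks t @ wblock t @ concat (map wblock [Suc t..<?p])"
    by (simp add: blocks_def)
  then show ?thesis
    using assms by (simp add: jseq_def nth_append length_blocks length_wblock)
qed

lemma jseq_position:
  assumes "r < 4 * t + 3"
  shows "jseq (t * (2 * t + 1) + Suc r)
    = (if r < 2 * t + 1 then int r - int t else 3 * int t + 2 - int r)"
  using assms by (simp only: jseq_block nth_wblock)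

lemma map_jseq_prefix:
  assumes "r \<le> 4 * t + 3"
  shows "map jseq [1..<Suc (t * (2 * t + 1) + r)] = blocks t @ take r (wblock t)"
proof -
  have part: "map jseq [1..<Suc (t * (2 * t + 1) + r)] = blocks t @ take r (wblock t)"
    if "map jseq [1..<Suc (t * (2 * t + 1))] = blocks t" "r \<le> 4 * t + 3" for t r
    using that(2)
  proof (induction r)
    case (Suc r)
    then have "jseq (t * (2 * t + 1) + Suc r) = wblock t ! r" by (intro jseq_block) simp
    with Suc show ?case
      by (simp add: take_Suc_conv_app_nth length_wblock)
  qed (use that(1) in simp)
  have full: "map jseq [1..<Suc (t * (2 * t + 1))] = blocks t" for t
  proof (induction t)
    case (Suc t)
    have "Suc t * (2 * Suc t + 1) = t * (2 * t + 1) + (4 * t + 3)" by (simp add: algebra_simps)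
    then show ?case
      using part [OF Suc, of "4 * t + 3"] by (simp only: blocks_Suc) (simp add: length_wblock)
  qed (simp add: blocks_def)
  show ?thesis by (rule part [OF full assms])
qed

lemma wtilde_act_block:
  assumes "r \<le> 4 * t + 3"
  shows "wtilde_act (t * (2 * t + 1) + r) \<Lambda> = foldr srefl (blocks t @ take r (wblock t)) \<Lambda>"
  unfolding wtilde_act_def map_jseq_prefix [OF assms] ..

lemma take_wblock:
  "r \<le> 2 * t + 1 \<Longrightarrow> take r (wblock t) = [- int t..int r - int t - 1]"
  "2 * t + 2 \<le> r \<Longrightarrow> r \<le> 4 * t + 3 \<Longrightarrow>
    take r (wblock t) = [- int t..int t + 1] @ rev [3 * int t + 3 - int r..int t]"
proof -
  assume "r \<le> 2 * t + 1"
  then show "take r (wblock t) = [- int t..int r - int t - 1]"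
    by (intro nth_equalityI) (auto simp: length_wblock nth_wblock)
next
  assume "2 * t + 2 \<le> r" "r \<le> 4 * t + 3"
  then show "take r (wblock t) = [- int t..int t + 1] @ rev [3 * int t + 3 - int r..int t]"
    by (intro nth_equalityI) (auto simp: length_wblock nth_wblock nth_append rev_nth of_nat_diff)
qed

text \<open>The cycle of [- t..j] shifts - t..j up by one and opens a gap at - t; the reversal about
  1 then turns 1 - t..j + 1 into 1 - j..t + 1.\<close>

lemma maya_ascending:
  assumes "r \<le> 2 * t" "j = int r - int t"
  shows "maya ({..- int t - 1} \<union> {1 - j..int t + 1}) (wtilde_act (t * (2 * t + 1) + Suc r) (Lam j))"
proof -
  have "{..- int t - 1} \<union> {1 - j..int t + 1} = refls (blocks t @ take (Suc r) (wblock t)) ` {..j}"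
  proof -
    have "y \<in> refls (blocks t @ take (Suc r) (wblock t)) ` {..j}"
      if y: "y \<in> {..- int t - 1} \<union> {1 - j..int t + 1}" for y
    proof -
      consider "y \<le> - int t - 1" | "1 - j \<le> y" "y \<le> int t + 1" using y by force
      then show ?thesis
      proof cases
        case 1
        then show ?thesis using assms
          by (intro image_eqI [of _ _ y]) (auto simp: take_wblock refls_blocks refls_upto)
      next
        case 2
        \<comment> \<open>Going back from y, the reversal about 1 gives 2 - y and the inverse cycle
          lowers it to 1 - y.\<close>
        then show ?thesis using assms
          by (intro image_eqI [of _ _ "1 - y"]) (auto simp: take_wblock refls_blocks refls_upto)
      qed
    qed
    moreover have "refls (blocks t @ take (Suc r) (wblock t)) x \<in> {..- int t - 1} \<union> {1 - j..int t + 1}"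
      if "x \<le> j" for x
      using assms that by (simp add: take_wblock refls_blocks refls_upto)
    ultimately show ?thesis by blast
  qed
  moreover have "Suc r \<le> 4 * t + 3"
    using assms by simp
  ultimately show ?thesis
    using maya_refls [OF maya_Lam, of "blocks t @ take (Suc r) (wblock t)" j]
    by (simp only: wtilde_act_block)
qed

text \<open>At the second visit of j, the descending run acts first and throws j up to t + 1,
  closing the gap below. The ascending run then sends t + 1 to t + 2, outside the interval that the
  earlier blocks reverse.\<close>

lemma maya_descending:
  assumes "2 * t + 1 \<le> r" "r < 4 * t + 3" "j = 3 * int t + 2 - int r"
  shows "maya ({..- int t - 1} \<union> {2 - j..int t + 2}) (wtilde_act (t * (2 * t + 1) + Suc r) (Lam j))"
proof -
  have "{..- int t - 1} \<union> {2 - j..int t + 2} = refls (blocks t @ take (Suc r) (wblock t)) ` {..j}"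
  proof -
    have "y \<in> refls (blocks t @ take (Suc r) (wblock t)) ` {..j}"
      if y: "y \<in> {..- int t - 1} \<union> {2 - j..int t + 2}" for y
    proof -
      consider "y \<le> - int t - 1" | "2 - j \<le> y" "y \<le> int t + 1" | "y = int t + 2" using y by force
      then show ?thesis
      proof cases
        case 1
        then show ?thesis using assms
          by (intro image_eqI [of _ _ y]) (auto simp: take_wblock refls_blocks refls_upto refls_rev_upto)
      next
        case 2
        then show ?thesis using assms
          by (intro image_eqI [of _ _ "1 - y"]) (auto simp: take_wblock refls_blocks refls_upto refls_rev_upto)
      next
        case 3
        then show ?thesis using assms
          by (intro image_eqI [of _ _ "j"]) (auto simp: take_wblock refls_blocks refls_upto refls_rev_upto)
      qed
    qed
    moreover have "refls (blocks t @ take (Suc r) (wblock t)) x \<in> {..- int t - 1} \<union> {2 - j..int t + 2}"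
      if "x \<le> j" for x
      using assms that by (auto simp: take_wblock refls_blocks refls_upto refls_rev_upto)
    ultimately show ?thesis by blast
  qed
  moreover have "Suc r \<le> 4 * t + 3"
    using assms by simp
  ultimately show ?thesis
    using maya_refls [OF maya_Lam, of "blocks t @ take (Suc r) (wblock t)" j]
    by (simp only: wtilde_act_block)
qed

section \<open>The bijection c and the next occurrence of a letter\<close>

lemma cinv_even: "l + m = 2 * t + 2 \<Longrightarrow> cinv (l, m) = t * (2 * t + 1) + l"
proof -
  assume *: "l + m = 2 * t + 2"
  then have "of_nat l + of_nat m = (2 * of_nat t + 2 :: rat)"
    by (metis of_nat_add of_nat_mult of_nat_numeral)
  then have "afun ((of_nat l + of_nat m - 2) / 2) = of_int (int (t * (2 * t + 1)))"
    by (simp add: afun_def algebra_simps)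
  moreover have "even (l + m)" using * by simp
  ultimately show ?thesis by (simp only: cinv_def prod.case floor_of_int nat_int if_True)
qed

text \<open>a(t + 1/2) = a(t) + (2 t + 1) is the position just before the peak of block t. Thus the
  antidiagonal l + m = 2 t + 2 runs through the ascending letters by l, and l + m = 2 t + 3 through
  the rest of the block by m.\<close>

lemma cinv_odd: "l + m = 2 * t + 3 \<Longrightarrow> cinv (l, m) = t * (2 * t + 1) + (2 * t + 1) + m"
proof -
  assume *: "l + m = 2 * t + 3"
  then have "of_nat l + of_nat m = (2 * of_nat t + 3 :: rat)"
    by (metis of_nat_add of_nat_mult of_nat_numeral)
  then have "afun ((of_nat l + of_nat m - 2) / 2) = of_int (int (t * (2 * t + 1) + (2 * t + 1)))"
    by (simp add: afun_def field_simps)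
  moreover have "odd (l + m)" using * by simp
  ultimately show ?thesis by (simp only: cinv_def prod.case floor_of_int nat_int if_False)
qed

lemma block_position: "\<exists>t r. r < 4 * t + 3 \<and> Suc q = t * (2 * t + 1) + Suc r"
proof (induction q)
  case 0
  then show ?case by (intro exI [of _ 0]) simp
next
  case (Suc q)
  then obtain t r where r: "r < 4 * t + 3" "Suc q = t * (2 * t + 1) + Suc r" by blast
  show ?case
  proof (cases "Suc r < 4 * t + 3")
    case True
    with r show ?thesis by (intro exI [of _ t] exI [of _ "Suc r"]) simp
  next
    case False
    with r have "r = 4 * t + 2" by simp
    with r show ?thesis by (intro exI [of _ "Suc t"] exI [of _ 0]) simp
  qed
qed

text \<open>Every position is a value of \<open>cinv\<close>, so c(p) is a genuine preimage of p;
  reading \<open>cinv\<close> backwards expresses l and m through the offset r in the block.\<close>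

lemma cfun_block:
  assumes "cfun p = (l, m)" "p \<ge> 1"
  obtains (ascending) t r where "even (l + m)" "p = t * (2 * t + 1) + Suc r" "r \<le> 2 * t"
      "l = Suc r" "m = 2 * t + 1 - r"
  | (descending) t r where "odd (l + m)" "p = t * (2 * t + 1) + Suc r" "2 * t + 1 \<le> r" "r < 4 * t + 3"
      "m = r - 2 * t" "l = 4 * t + 3 - r"
proof -
  obtain t r where r: "r < 4 * t + 3" "p = t * (2 * t + 1) + Suc r"
    using block_position [of "p - 1"] assms(2) by auto
  have "p \<in> cinv ` ({1..} \<times> {1..})"
  proof (cases "r \<le> 2 * t")
    case True
    then have "cinv (Suc r, 2 * t + 1 - r) = p" by (simp only: r(2)) (rule cinv_even, simp)
    with True show ?thesis by (intro image_eqI [of _ _ "(Suc r, 2 * t + 1 - r)"]) auto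
  next
    case False
    then have "cinv (4 * t + 3 - r, r - 2 * t) = t * (2 * t + 1) + (2 * t + 1) + (r - 2 * t)"
      using r by (intro cinv_odd) simp
    with False r show ?thesis by (intro image_eqI [of _ _ "(4 * t + 3 - r, r - 2 * t)"]) auto
  qed
  then have "cinv (cfun p) = p" "cfun p \<in> {1..} \<times> {1..}"
    unfolding cfun_def by (rule f_inv_into_f, rule inv_into_into)
  then have lm: "cinv (l, m) = p" "1 \<le> l" "1 \<le> m"
    using assms(1) by simp_all
  show thesis
  proof (cases "even (l + m)")
    case True
    then obtain s where s: "l + m = 2 * s" by (elim evenE)
    with lm obtain t where t: "s = Suc t" by (cases s) auto
    have "p = t * (2 * t + 1) + l" using cinv_even [of l m t] s t lm(1) by simp
    with ascending [of t "l - 1"] True lm(2,3) s t show thesis by simp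
  next
    case False
    then obtain s where s: "l + m = 2 * s + 1" by (elim oddE)
    with lm obtain t where t: "s = Suc t" by (cases s) auto
    have "p = t * (2 * t + 1) + (2 * t + 1) + m" using cinv_odd [of l m t] s t lm(1) by simp
    with descending [of t "2 * t + m"] False lm(2,3) s t show thesis by simp
  qed
qed

text \<open>The block is a palindrome around offset 2 t + 1, so the next equal letter sits at the
  mirror offset 4 t + 2 - r; in between all letters are larger.\<close>

lemma pplus_ascending:
  assumes "r \<le> 2 * t"
  shows "pplus (t * (2 * t + 1) + Suc r) = t * (2 * t + 1) + Suc (4 * t + 2 - r)"
  unfolding pplus_def
proof (rule Least_equality)
  have "jseq (t * (2 * t + 1) + Suc (4 * t + 2 - r)) = int r - int t"
    using assms by (subst jseq_position) (auto simp: of_nat_diff)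
  moreover have p: "jseq (t * (2 * t + 1) + Suc r) = int r - int t"
    using assms by (subst jseq_position) auto
  ultimately show "t * (2 * t + 1) + Suc r < t * (2 * t + 1) + Suc (4 * t + 2 - r) \<and>
      jseq (t * (2 * t + 1) + Suc (4 * t + 2 - r)) = jseq (t * (2 * t + 1) + Suc r)"
    using assms by simp
  fix k
  assume k: "t * (2 * t + 1) + Suc r < k \<and> jseq k = jseq (t * (2 * t + 1) + Suc r)"
  show "t * (2 * t + 1) + Suc (4 * t + 2 - r) \<le> k"
  proof (rule ccontr)
    assume c: "\<not> ?thesis"
    from k obtain d where "k = Suc (t * (2 * t + 1) + Suc r + d)"
      using less_imp_Suc_add by blast
    then obtain r' where "k = t * (2 * t + 1) + Suc r'" "r < r'"
      by (intro that [of "r + Suc d"]) simp_all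
    moreover from this c have "r' < 4 * t + 2 - r" by linarith
    ultimately have "k = t * (2 * t + 1) + Suc r'" "r < r'" "r' < 4 * t + 2 - r" by blast+
    with k show False using assms by (simp only: jseq_position p) (simp split: if_splits)
  qed
qed

text \<open>From the peak on the letters of a block strictly decrease, so j returns only in the next
  block, whose ascending half starts with - (t + 1). This puts it at offset j + t + 1 = 4 t + 3 -
  r.\<close>

lemma pplus_descending:
  assumes "2 * t + 1 \<le> r" "r < 4 * t + 3"
  shows "pplus (t * (2 * t + 1) + Suc r) = Suc t * (2 * Suc t + 1) + Suc (4 * t + 3 - r)"
  unfolding pplus_def
proof (rule Least_equality)
  have next_block: "Suc t * (2 * Suc t + 1) = t * (2 * t + 1) + (4 * t + 3)" by simp
  have "jseq (Suc t * (2 * Suc t + 1) + Suc (4 * t + 3 - r)) = 3 * int t + 2 - int r"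
    using assms by (subst jseq_position) (auto simp: of_nat_diff)
  moreover have p: "jseq (t * (2 * t + 1) + Suc r) = 3 * int t + 2 - int r"
    using assms by (subst jseq_position) auto
  ultimately show "t * (2 * t + 1) + Suc r < Suc t * (2 * Suc t + 1) + Suc (4 * t + 3 - r) \<and>
      jseq (Suc t * (2 * Suc t + 1) + Suc (4 * t + 3 - r)) = jseq (t * (2 * t + 1) + Suc r)"
    using assms by (simp only: next_block) simp
  fix k
  assume k: "t * (2 * t + 1) + Suc r < k \<and> jseq k = jseq (t * (2 * t + 1) + Suc r)"
  show "Suc t * (2 * Suc t + 1) + Suc (4 * t + 3 - r) \<le> k"
  proof (rule ccontr)
    assume c: "\<not> ?thesis"
    show False
    proof (cases "k \<le> Suc t * (2 * Suc t + 1)")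
      case True
      from k obtain d where "k = Suc (t * (2 * t + 1) + Suc r + d)"
        using less_imp_Suc_add by blast
      then obtain r' where "k = t * (2 * t + 1) + Suc r'" "r < r'"
        by (intro that [of "r + Suc d"]) simp_all
      moreover from this True have "r' < 4 * t + 3" unfolding next_block by linarith
      ultimately have "k = t * (2 * t + 1) + Suc r'" "r < r'" "r' < 4 * t + 3" by blast+
      with k show False using assms by (simp only: jseq_position p) (simp split: if_splits)
    next
      case False
      then have "Suc t * (2 * Suc t + 1) < k" by linarith
      then obtain r' where "k = Suc (Suc t * (2 * Suc t + 1) + r')"
        using less_imp_Suc_add by blast
      then have "k = Suc t * (2 * Suc t + 1) + Suc r'" by linarith
      moreover from this c have "r' < 4 * t + 3 - r" by linarith
      moreover from this have "r' < 4 * Suc t + 3" by simp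
      ultimately show False using k assms by (simp only: jseq_position p) (simp split: if_splits)
    qed
  qed
qed

section \<open>Actions of free algebras\<close>

lemma pm_sum_single: "(\<Sum>k\<in>keys p. Poly_Mapping.single k (lookup p k)) = p"
  by (rule poly_mapping_eqI)
     (auto simp: lookup_sum lookup_single when_def in_keys_iff sum.delta)

text \<open>The operators of a module record are constrained only on its carrier, so closure and
  linearity are asked on the subspace \<open>U\<close>, while the scalars act on the whole
  type.\<close>

locale free_action = vector_space scale
  for scale :: "'c::field \<Rightarrow> 'v::ab_group_add \<Rightarrow> 'v" +
  fixes op :: "'g \<Rightarrow> 'v \<Rightarrow> 'v" and U :: "'v set"
  assumes subspace_U: "subspace U"
    and op_closed: "v \<in> U \<Longrightarrow> op g v \<in> U"
    and op_lin: "lin_on scale scale U (op g)"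
begin

abbreviation act :: "('g, 'c) free_alg \<Rightarrow> 'v \<Rightarrow> 'v" where "act \<equiv> free_act scale op"

lemma op_add: "v \<in> U \<Longrightarrow> w \<in> U \<Longrightarrow> op g (v + w) = op g v + op g w"
  and op_scale: "v \<in> U \<Longrightarrow> op g (scale c v) = scale c (op g v)"
  using op_lin by (auto simp: lin_on_def)

lemma op_zero: "op g 0 = 0"
  using op_scale [of 0 g 0] subspace_0 [OF subspace_U] by simp

lemma op_sum: "(\<And>i. i \<in> I \<Longrightarrow> f i \<in> U) \<Longrightarrow> op g (\<Sum>i\<in>I. f i) = (\<Sum>i\<in>I. op g (f i))"
  by (induction I rule: infinite_finite_induct)
     (auto simp: op_zero op_add subspace_sum [OF subspace_U])

lemma foldr_closed: "v \<in> U \<Longrightarrow> foldr op w v \<in> U"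
  by (induction w) (auto simp: op_closed)

lemma foldr_add: "v \<in> U \<Longrightarrow> w \<in> U \<Longrightarrow> foldr op x (v + w) = foldr op x v + foldr op x w"
  by (induction x) (auto simp: op_add foldr_closed)

lemma foldr_scale: "v \<in> U \<Longrightarrow> foldr op x (scale c v) = scale c (foldr op x v)"
  by (induction x) (auto simp: op_scale foldr_closed)

lemma foldr_zero: "foldr op x 0 = 0"
  by (induction x) (auto simp: op_zero)

lemma act_superset:
  assumes "finite A" "keys x \<subseteq> A"
  shows "act x v = (\<Sum>w\<in>A. scale (lookup x w) (foldr op (letters w) v))"
  unfolding free_act_def
  by (rule sum.mono_neutral_left) (use assms in \<open>auto simp: in_keys_iff\<close>)

lemma act_add: "act (x + y) v = act x v + act y v"
proof -
  let ?A = "keys x \<union> keys y"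
  have "act (x + y) v = (\<Sum>w\<in>?A. scale (lookup (x + y) w) (foldr op (letters w) v))"
    using Poly_Mapping.keys_add [of x y] by (intro act_superset) auto
  also have "\<dots> = act x v + act y v"
    by (simp add: lookup_add scale_left_distrib sum.distrib act_superset [of ?A])
  finally show ?thesis .
qed

lemma act_zero [simp]: "act 0 v = 0"
  by (simp add: free_act_def)

lemma act_uminus: "act (- x) v = - act x v"
  using act_add [of x "- x" v] by (simp add: eq_neg_iff_add_eq_0 add.commute)

lemma act_diff: "act (x - y) v = act x v - act y v"
  using act_add [of x "- y" v] by (simp add: act_uminus)

lemma act_sum: "act (\<Sum>i\<in>I. x i) v = (\<Sum>i\<in>I. act (x i) v)"
  by (induction I rule: infinite_finite_induct) (auto simp: act_add)

lemma act_single: "act (Poly_Mapping.single w c) v = scale c (foldr op (letters w) v)"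
  by (simp add: free_act_def)

lemma act_word: "act (word w) v = foldr op w v"
  by (simp add: word_def act_single)

lemma act_one: "act 1 v = v"
proof -
  have "letters (0 :: 'g fword) = []" by (simp add: zero_fword_def)
  then show ?thesis using act_single [of 0 1 v] by simp
qed

lemma act_closed: "v \<in> U \<Longrightarrow> act x v \<in> U"
  unfolding free_act_def
  by (intro subspace_sum [OF subspace_U] subspace_scale [OF subspace_U] foldr_closed)

lemma act_plus: "v \<in> U \<Longrightarrow> w \<in> U \<Longrightarrow> act x (v + w) = act x v + act x w"
  by (simp add: free_act_def foldr_add scale_right_distrib sum.distrib)

lemma act_scale: "v \<in> U \<Longrightarrow> act x (scale c v) = scale c (act x v)"
  by (simp add: free_act_def foldr_scale scale_sum_right mult.commute)

lemma act_at_zero [simp]: "act x 0 = 0"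
  by (simp add: free_act_def foldr_zero)

lemma act_vsum: "(\<And>i. i \<in> I \<Longrightarrow> f i \<in> U) \<Longrightarrow> act x (\<Sum>i\<in>I. f i) = (\<Sum>i\<in>I. act x (f i))"
  by (induction I rule: infinite_finite_induct)
     (auto simp: act_plus subspace_sum [OF subspace_U])

lemma act_mult:
  assumes "v \<in> U"
  shows "act (x * y) v = act x (act y v)"
proof -
  have "x * y = (\<Sum>a\<in>keys x. Poly_Mapping.single a (lookup x a))
      * (\<Sum>b\<in>keys y. Poly_Mapping.single b (lookup y b))"
    by (simp only: pm_sum_single)
  also have "\<dots> = (\<Sum>a\<in>keys x. \<Sum>b\<in>keys y. Poly_Mapping.single (a + b) (lookup x a * lookup y b))"
    by (simp add: sum_product mult_single)
  finally have "act (x * y) v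
      = (\<Sum>a\<in>keys x. \<Sum>b\<in>keys y. scale (lookup x a * lookup y b) (foldr op (letters (a + b)) v))"
    by (simp add: act_sum act_single)
  also have "\<dots> = (\<Sum>a\<in>keys x. scale (lookup x a)
      (\<Sum>b\<in>keys y. foldr op (letters a) (scale (lookup y b) (foldr op (letters b) v))))"
    using assms by (simp add: plus_fword_def scale_sum_right foldr_scale foldr_closed)
  also have "\<dots> = act x (act y v)"
  proof -
    have "foldr op w (\<Sum>b\<in>keys y. scale (lookup y b) (foldr op (letters b) v))
        = (\<Sum>b\<in>keys y. foldr op w (scale (lookup y b) (foldr op (letters b) v)))" for w
      using act_vsum [of "keys y" "\<lambda>b. scale (lookup y b) (foldr op (letters b) v)" "word w"] assms
      by (simp add: act_word foldr_closed subspace_scale [OF subspace_U])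
    then show ?thesis by (simp add: free_act_def [of scale op y] free_act_def [of scale op x])
  qed
  finally show ?thesis .
qed

text \<open>In a product a s b the factor b keeps v inside \<open>U\<close>, so it is enough that
  each s kills all of \<open>U\<close>.\<close>

lemma ideal_gen_kills:
  assumes "\<And>s v. s \<in> S \<Longrightarrow> v \<in> U \<Longrightarrow> act s v = 0" and "r \<in> ideal_gen S" "v \<in> U"
  shows "act r v = 0"
  using assms(2) unfolding ideal_gen_def
proof induction
  case (base s)
  then consider "s = 0" | a t b where "s = a * t * b" "t \<in> S" by blast
  then show ?case
    by cases (simp_all add: act_mult act_closed assms(1,3))
qed (simp add: act_diff)

end

lemma generators_in_ideal_gen: "s \<in> S \<Longrightarrow> s \<in> ideal_gen S"
proof -
  assume "s \<in> S"
  then have "1 * s * 1 \<in> {a * s * b | a s b. s \<in> S}" by blast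
  then show ?thesis unfolding ideal_gen_def by (intro group_closure.base) simp
qed

section \<open>The quiver Hecke relations for pairwise distinct simple roots\<close>

text \<open>When the simple roots in \<open>\<beta>\<close> are pairwise distinct, the correction terms of the last two
  families of relations vanish.\<close>

definition klr_ops :: "qplus \<Rightarrow> (klr_gen \<Rightarrow> 'v \<Rightarrow> 'v::ab_group_add) \<Rightarrow> 'v \<Rightarrow> bool" where
  "klr_ops \<beta> op v \<longleftrightarrow>
    (let n = size \<beta>; I = permutations_of_multiset \<beta>;
         e = (\<lambda>\<nu>. op (GenE \<nu>)); x = (\<lambda>k. op (GenX k)); \<tau> = (\<lambda>k. op (GenT k)) in
     (\<forall>\<nu>\<in>I. \<forall>\<nu>'\<in>I. e \<nu> (e \<nu>' v) = (if \<nu> = \<nu>' then e \<nu> v else 0))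
   \<and> (\<forall>\<nu>. \<nu> \<notin> I \<longrightarrow> e \<nu> v = 0)
   \<and> (\<Sum>\<nu>\<in>I. e \<nu> v) = v
   \<and> (\<forall>k. k \<notin> {1..n} \<longrightarrow> x k v = 0)
   \<and> (\<forall>k. k \<notin> {1..<n} \<longrightarrow> \<tau> k v = 0)
   \<and> (\<forall>k\<in>{1..n}. \<forall>l\<in>{1..n}. x k (x l v) = x l (x k v))
   \<and> (\<forall>k\<in>{1..n}. \<forall>\<nu>\<in>I. x k (e \<nu> v) = e \<nu> (x k v))
   \<and> (\<forall>k\<in>{1..<n}. \<forall>\<nu>\<in>I. \<tau> k (e \<nu> v) = e (swap_at k \<nu>) (\<tau> k v))
   \<and> (\<forall>k\<in>{1..<n}. \<forall>l\<in>{1..<n}. \<bar>int k - int l\<bar> > 1 \<longrightarrow> \<tau> k (\<tau> l v) = \<tau> l (\<tau> k v))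
   \<and> (\<forall>k\<in>{1..<n}. \<forall>\<nu>\<in>I. \<tau> k (\<tau> k (e \<nu> v)) =
        (if \<nu> ! k = \<nu> ! (k - 1) + 1 then x k (e \<nu> v) - x (k + 1) (e \<nu> v)
         else if \<nu> ! k = \<nu> ! (k - 1) - 1 then x (k + 1) (e \<nu> v) - x k (e \<nu> v)
         else e \<nu> v))
   \<and> (\<forall>k\<in>{1..<n}. \<forall>l\<in>{1..n}. \<forall>\<nu>\<in>I. \<tau> k (x l (e \<nu> v)) = x (transpose k (k + 1) l) (\<tau> k (e \<nu> v)))
   \<and> (\<forall>k \<nu>. 1 \<le> k \<and> k + 1 < n \<and> \<nu> \<in> I \<longrightarrow>
        \<tau> (k + 1) (\<tau> k (\<tau> (k + 1) (e \<nu> v))) = \<tau> k (\<tau> (k + 1) (\<tau> k (e \<nu> v)))))"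

lemma perm_distinct:
  assumes "\<nu> \<in> permutations_of_multiset \<beta>" "\<And>i. count \<beta> i \<le> 1"
  shows "distinct \<nu>" "length \<nu> = size \<beta>"
proof -
  have "mset \<nu> = \<beta>" using assms(1) by (simp add: permutations_of_multiset_def)
  then show "length \<nu> = size \<beta>" by auto
  show "distinct \<nu>"
    unfolding distinct_count_atmost_1 \<open>mset \<nu> = \<beta>\<close>
  proof
    fix a
    have "count \<beta> a = 0 \<longleftrightarrow> a \<notin> set \<nu>"
      using \<open>mset \<nu> = \<beta>\<close> by (auto simp: count_eq_zero_iff)
    then show "count \<beta> a = (if a \<in> set \<nu> then 1 else 0)"
      using assms(2) [of a] by (auto simp: le_Suc_eq)
  qed
qed

lemma ball_collect1: "(\<forall>r\<in>{f k | k. P k}. Q r) \<longleftrightarrow> (\<forall>k. P k \<longrightarrow> Q (f k))"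
  and ball_collect2: "(\<forall>r\<in>{g k l | k l. P' k l}. Q r) \<longleftrightarrow> (\<forall>k l. P' k l \<longrightarrow> Q (g k l))"
  and ball_collect3: "(\<forall>r\<in>{h k l m | k l m. P'' k l m}. Q r) \<longleftrightarrow> (\<forall>k l m. P'' k l m \<longrightarrow> Q (h k l m))"
  by blast+

lemma ball2_cong:
  "(\<And>k l. k \<in> S \<Longrightarrow> l \<in> I \<Longrightarrow> P k l \<longleftrightarrow> Q k l) \<Longrightarrow>
    (\<forall>k\<in>S. \<forall>l\<in>I. Q k l) \<longleftrightarrow> (\<forall>k l. k \<in> S \<and> l \<in> I \<longrightarrow> P k l)"
  by blast

lemma ball3_cong:
  "(\<And>k l m. k \<in> S \<Longrightarrow> l \<in> T \<Longrightarrow> m \<in> I \<Longrightarrow> P k l m \<longleftrightarrow> Q k l m) \<Longrightarrow>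
    (\<forall>k\<in>S. \<forall>l\<in>T. \<forall>m\<in>I. Q k l m) \<longleftrightarrow> (\<forall>k l m. k \<in> S \<and> l \<in> T \<and> m \<in> I \<longrightarrow> P k l m)"
  by blast

text \<open>Turns relations in the free algebra into identities between operators at a single
  vector. In this form they are verified for the constructed modules and used in arbitrary
  ones.\<close>

lemma klr_ops_kills:
  fixes scale :: "'k::field_char_0 \<Rightarrow> 'v::ab_group_add \<Rightarrow> 'v"
  assumes "free_action scale op U" "v \<in> U" "\<And>i. count \<beta> i \<le> 1"
  shows "klr_ops \<beta> op v \<longleftrightarrow> (\<forall>r\<in>klr_relations \<beta>. free_act scale op r v = 0)"
proof -
  interpret free_action scale op U by fact
  note perm = perm_distinct [OF _ assms(3)]
  \<comment> \<open>Neighbouring letters differ, so Q with equal indices does not occur and moving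
    \<tau> past x leaves no e(\<nu>) term.\<close>
  have neq: "\<nu> ! (k - 1) \<noteq> \<nu> ! k" if "\<nu> \<in> permutations_of_multiset \<beta>" "k \<in> {1..<size \<beta>}" for \<nu> k
    using perm [OF that(1)] that(2) nth_eq_iff_index_eq [of \<nu> "k - 1" k] by (auto simp: less_imp_diff_less)
  \<comment> \<open>Letters two places apart differ, so the divided difference in the braid relation
    does not appear.\<close>
  have neq': "\<nu> ! (k - 1) \<noteq> \<nu> ! Suc k" if "\<nu> \<in> permutations_of_multiset \<beta>" "1 \<le> k" "k + 1 < size \<beta>" for \<nu> k
    using perm [OF that(1)] that(2,3) nth_eq_iff_index_eq [of \<nu> "k - 1" "Suc k"] by auto
  note neq_Suc = neq [unfolded One_nat_def]
  note act_simps = act_add act_diff act_mult act_word act_sum act_one foldr_closed op_closed assms(2)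
  note act_simps' = act_simps op_zero act_uminus
  have quadratic: "act (word [GenT k] * word [GenT k] * word [GenE \<nu>]
        - (if \<nu> ! k = \<nu> ! (k - 1) + 1 then word [GenX k] - word [GenX (k + 1)]
           else if \<nu> ! k = \<nu> ! (k - 1) - 1 then - (word [GenX k] - word [GenX (k + 1)])
           else if \<nu> ! k = \<nu> ! (k - 1) then 0 else 1) * word [GenE \<nu>]) v = 0 \<longleftrightarrow>
      op (GenT k) (op (GenT k) (op (GenE \<nu>) v)) =
        (if \<nu> ! k = \<nu> ! (k - 1) + 1 then op (GenX k) (op (GenE \<nu>) v) - op (GenX (k + 1)) (op (GenE \<nu>) v)
         else if \<nu> ! k = \<nu> ! (k - 1) - 1 then op (GenX (k + 1)) (op (GenE \<nu>) v) - op (GenX k) (op (GenE \<nu>) v)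
         else op (GenE \<nu>) v)"
    if "k \<in> {1..<size \<beta>}" "\<nu> \<in> permutations_of_multiset \<beta>" for k \<nu>
    using neq [OF that(2,1)]
    by (cases "\<nu> ! k = \<nu> ! (k - 1) + 1"; cases "\<nu> ! k = \<nu> ! (k - 1) - 1")
       (simp_all add: act_simps' del: One_nat_def)
  have exchange: "act ((word [GenT k] * word [GenX l] - word [GenX (transpose k (k + 1) l)] * word [GenT k])
        * word [GenE \<nu>] - (if \<nu> ! (k - 1) \<noteq> \<nu> ! k then 0
           else if l = k then - word [GenE \<nu>] else if l = k + 1 then word [GenE \<nu>] else 0)) v = 0 \<longleftrightarrow>
      op (GenT k) (op (GenX l) (op (GenE \<nu>) v))
        = op (GenX (transpose k (k + 1) l)) (op (GenT k) (op (GenE \<nu>) v))"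
    if "k \<in> {1..<size \<beta>}" "l \<in> {1..size \<beta>}" "\<nu> \<in> permutations_of_multiset \<beta>" for k l \<nu>
    unfolding if_P [OF neq [OF that(3,1)]] by (simp add: act_simps')
  have braid: "op (GenT (k + 1)) (op (GenT k) (op (GenT (k + 1)) (op (GenE \<nu>) v)))
        = op (GenT k) (op (GenT (k + 1)) (op (GenT k) (op (GenE \<nu>) v))) \<longleftrightarrow>
      act ((word [GenT (k + 1)] * word [GenT k] * word [GenT (k + 1)]
        - word [GenT k] * word [GenT (k + 1)] * word [GenT k]) * word [GenE \<nu>]
        - (if \<nu> ! (k - 1) = \<nu> ! (k + 1)
           then (if \<nu> ! k = \<nu> ! (k - 1) + 1 then 1 else if \<nu> ! k = \<nu> ! (k - 1) - 1 then - 1 else 0)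
             * word [GenE \<nu>] else 0)) v = 0"
    if "1 \<le> k \<and> k + 1 < size \<beta> \<and> \<nu> \<in> permutations_of_multiset \<beta>" for k \<nu>
  proof -
    have "\<nu> ! (k - 1) \<noteq> \<nu> ! (k + 1)" using neq' [of \<nu> k] that by simp
    then show ?thesis unfolding if_not_P [OF \<open>\<nu> ! (k - 1) \<noteq> \<nu> ! (k + 1)\<close>] by (simp add: act_simps')
  qed
  show ?thesis
    unfolding klr_ops_def klr_relations_def Let_def ball_Un ball_collect1 ball_collect2 ball_collect3
      Qpoly_def Qdiff_def conj_assoc
    apply (intro arg_cong2 [where f = "(\<and>)"])
    subgoal by (auto simp: act_simps')
    subgoal by (auto simp: act_simps')
    subgoal by (auto simp: act_simps')
    subgoal by (auto simp: act_simps')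
    subgoal by (auto simp: act_simps')
    subgoal by (auto simp: act_simps')
    subgoal by (auto simp: act_simps')
    subgoal by (auto simp: act_simps')
    subgoal by (auto simp: act_simps')
    subgoal by (rule ball2_cong) (rule quadratic)
    subgoal by (rule ball3_cong) (rule exchange)
    subgoal by (intro iff_allI imp_cong refl) (rule braid)
    done
qed

section \<open>Modules with a basis permuted by the generators\<close>

lemma gmod_vector_space: "is_gmod \<beta> M \<Longrightarrow> vector_space (mscale M)"
  and gmod_gen_closed: "is_gmod \<beta> M \<Longrightarrow> v \<in> mcar M \<Longrightarrow> mgen M g v \<in> mcar M"
  and gmod_deg_subspace: "is_gmod \<beta> M \<Longrightarrow> module.subspace (mscale M) (mdeg M d)"
  and gmod_decomp: "is_gmod \<beta> M \<Longrightarrow> direct_sum_decomp (mcar M) (mdeg M)"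
  and gmod_span: "is_gmod \<beta> M \<Longrightarrow> \<exists>S. finite S \<and> mcar M = module.span (mscale M) S"
  and gmod_relation: "is_gmod \<beta> M \<Longrightarrow> r \<in> klr_relations \<beta> \<Longrightarrow> v \<in> mcar M \<Longrightarrow>
    free_act (mscale M) (mgen M) r v = 0"
  by (simp_all add: is_gmod_def image_subset_iff klr_ideal_def generators_in_ideal_gen)

lemma gmod_free_action:
  assumes "is_gmod \<beta> M"
  shows "free_action (mscale M) (mgen M) (mcar M)"
proof -
  interpret vector_space "mscale M" by (rule gmod_vector_space [OF assms])
  show ?thesis
    using assms by unfold_locales (auto simp: is_gmod_def)
qed

lemma gmod_klr_ops:
  assumes "is_gmod \<beta> M" "\<And>i. count \<beta> i \<le> 1" "v \<in> mcar M"
  shows "klr_ops \<beta> (mgen M) v"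
  unfolding klr_ops_kills [OF gmod_free_action [OF assms(1)] assms(3,2)]
  by (intro ballI gmod_relation [OF assms(1) _ assms(3)])

text \<open>Taken straight from the relations, since \<beta> is arbitrary here and
  \<open>klr_ops\<close> describes them for distinct simple roots only.\<close>

lemma gmod_e_outside:
  fixes M :: "('k::field_char_0, 'v::ab_group_add) gmod"
  assumes "is_gmod \<beta> M" "v \<in> mcar M" "mset \<nu> \<noteq> \<beta>"
  shows "mE M \<nu> v = 0"
proof -
  interpret free_action "mscale M" "mgen M" "mcar M" by (rule gmod_free_action [OF assms(1)])
  let ?e = "\<lambda>\<nu>. word [GenE \<nu>] :: (klr_gen, 'k) free_alg"
  have "?e \<nu> \<in> {?e \<nu> | \<nu>. \<nu> \<notin> permutations_of_multiset \<beta>}"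
    using assms(3) by (intro CollectI exI [of _ \<nu>]) (simp add: permutations_of_multiset_def)
  then have "?e \<nu> \<in> klr_relations \<beta>"
    unfolding klr_relations_def Let_def by (simp only: Un_iff simp_thms)
  from gmod_relation [OF assms(1) this assms(2)] show ?thesis by (simp add: act_word)
qed

lemma gmod_e_idem:
  fixes M :: "('k::field_char_0, 'v::ab_group_add) gmod"
  assumes "is_gmod \<beta> M" "v \<in> mcar M"
  shows "mE M \<nu> (mE M \<nu> v) = mE M \<nu> v"
proof (cases "mset \<nu> = \<beta>")
  case True
  interpret free_action "mscale M" "mgen M" "mcar M" by (rule gmod_free_action [OF assms(1)])
  let ?e = "\<lambda>\<nu>. word [GenE \<nu>] :: (klr_gen, 'k) free_alg"
  have "?e \<nu> * ?e \<nu> - (if \<nu> = \<nu> then ?e \<nu> else 0) \<in> {?e \<nu> * ?e \<nu>' - (if \<nu> = \<nu>' then ?e \<nu> else 0) | \<nu> \<nu>'.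
      \<nu> \<in> permutations_of_multiset \<beta> \<and> \<nu>' \<in> permutations_of_multiset \<beta>}"
    using True by (intro CollectI exI [of _ \<nu>]) (simp add: permutations_of_multiset_def)
  then have "?e \<nu> * ?e \<nu> - (if \<nu> = \<nu> then ?e \<nu> else 0) \<in> klr_relations \<beta>"
    unfolding klr_relations_def Let_def by (simp only: Un_iff simp_thms)
  from gmod_relation [OF assms(1) this assms(2)] show ?thesis
    using assms(2) by (simp add: act_word act_diff act_mult)
next
  case False
  show ?thesis
    by (rule trans [OF gmod_e_outside [OF assms(1) gmod_gen_closed [OF assms(1,2)] False]
          gmod_e_outside [OF assms(1,2) False, symmetric]])
qed

lemma homogeneous_unique:
  assumes "direct_sum_decomp U G" "v \<in> G c" "v \<in> G d" "c \<noteq> d" "\<And>i. 0 \<in> G i"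
  shows "v = 0"
proof (rule ccontr)
  assume v: "v \<noteq> 0"
  have "v \<in> U" using assms(1,2) by (auto simp: direct_sum_decomp_def)
  define P where "P f \<longleftrightarrow> (\<forall>i. f i \<in> G i) \<and> finite {i. f i \<noteq> 0} \<and> v = (\<Sum>i | f i \<noteq> 0. f i)" for f
  have ex1: "\<exists>!f. P f"
    using assms(1) \<open>v \<in> U\<close> by (simp add: direct_sum_decomp_def P_def)
  have "{i. (if i = b then v else 0) \<noteq> 0} = {b}" for b using v by auto
  then have "P (\<lambda>i. if i = b then v else 0)" if "v \<in> G b" for b
    using that assms(5) by (simp add: P_def)
  with ex1 assms(2,3) have "(\<lambda>i. if i = c then v else 0) = (\<lambda>i. if i = d then v else 0)"
    by blast
  from fun_cong [OF this, of c] show False using v assms(4) by simp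
qed

section \<open>Linear extension from a basis\<close>

definition pm_scale :: "'k::field \<Rightarrow> (nat \<Rightarrow>\<^sub>0 'k) \<Rightarrow> (nat \<Rightarrow>\<^sub>0 'k)" where
  "pm_scale c = Poly_Mapping.map ((*) c)"

lemma lookup_pm_scale [simp]: "lookup (pm_scale c f) k = c * lookup f k"
  by (simp add: pm_scale_def Poly_Mapping.map.rep_eq when_def)

lemma keys_pm_scale: "keys (pm_scale c f) \<subseteq> keys f"
  by (auto simp: in_keys_iff)

lemma pm_scale_single [simp]: "pm_scale c (Poly_Mapping.single k d) = Poly_Mapping.single k (c * d)"
  by (rule poly_mapping_eqI) (simp add: lookup_single when_def)

interpretation pm: vector_space "pm_scale :: 'k::field \<Rightarrow> _"
  by unfold_locales (auto intro!: poly_mapping_eqI simp: lookup_add algebra_simps)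

definition lext :: "('k::field \<Rightarrow> 'v \<Rightarrow> 'v) \<Rightarrow> (nat \<Rightarrow> 'v) \<Rightarrow> (nat \<Rightarrow>\<^sub>0 'k) \<Rightarrow> 'v::ab_group_add" where
  "lext s y f = (\<Sum>k\<in>keys f. s (lookup f k) (y k))"

context vector_space
begin

lemma lext_superset:
  assumes "finite A" "keys f \<subseteq> A"
  shows "lext scale y f = (\<Sum>k\<in>A. scale (lookup f k) (y k))"
  unfolding lext_def by (rule sum.mono_neutral_left) (use assms in \<open>auto simp: in_keys_iff\<close>)

lemma lext_add: "lext scale y (f + g) = lext scale y f + lext scale y g"
proof -
  let ?A = "keys f \<union> keys g"
  have "lext scale y (f + g) = (\<Sum>k\<in>?A. scale (lookup (f + g) k) (y k))"
    using Poly_Mapping.keys_add [of f g] by (intro lext_superset) auto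
  also have "\<dots> = lext scale y f + lext scale y g"
    by (simp add: lookup_add scale_left_distrib sum.distrib lext_superset [of ?A])
  finally show ?thesis .
qed

lemma lext_scale: "lext scale y (pm_scale c f) = scale c (lext scale y f)"
  using lext_superset [OF finite_keys keys_pm_scale, of y c f]
  by (simp add: lext_def scale_sum_right)

lemma lext_lin: "lin_on pm_scale scale U (lext scale y)"
  by (simp add: lin_on_def lext_add lext_scale)

lemma lext_single [simp]: "lext scale y (Poly_Mapping.single k c) = scale c (y k)"
  by (simp add: lext_def)

lemma lext_zero [simp]: "lext scale y 0 = 0"
  by (simp add: lext_def)

lemma lext_in_subspace: "subspace U \<Longrightarrow> (\<And>k. k \<in> keys f \<Longrightarrow> y k \<in> U) \<Longrightarrow> lext scale y f \<in> U"
  unfolding lext_def by (intro subspace_sum subspace_scale)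

end

definition basis_opt :: "nat option \<Rightarrow> (nat \<Rightarrow>\<^sub>0 'k::field)" where
  "basis_opt o' = (case o' of None \<Rightarrow> 0 | Some k \<Rightarrow> Poly_Mapping.single k 1)"

lemma basis_opt_simps [simp]: "basis_opt None = 0" "basis_opt (Some k) = Poly_Mapping.single k 1"
  by (simp_all add: basis_opt_def)

text \<open>The generators act by partial maps on basis indices, so that relations become statements
  about composing partial maps. The vectors lie in the space used by \<open>rmod\<close>, so these
  modules have classes in the Grothendieck group.\<close>

definition bmod :: "(klr_gen \<Rightarrow> nat \<Rightarrow> nat option) \<Rightarrow> nat set \<Rightarrow> (nat \<Rightarrow> int) \<Rightarrow> 'k::field_char_0 rmod" where
  "bmod ot A \<delta> = \<lparr> mcar = {f. keys f \<subseteq> A}, mscale = pm_scale,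
     mgen = (\<lambda>g. lext pm_scale (\<lambda>k. basis_opt (ot g k))),
     mdeg = (\<lambda>d. {f. keys f \<subseteq> {k \<in> A. \<delta> k = d}}) \<rparr>"

lemma bmod_simps [simp]:
  "mcar (bmod ot A \<delta>) = {f. keys f \<subseteq> A}" "mscale (bmod ot A \<delta>) = pm_scale"
  "mgen (bmod ot A \<delta>) g = lext pm_scale (\<lambda>k. basis_opt (ot g k))"
  "mdeg (bmod ot A \<delta>) d = {f. keys f \<subseteq> {k \<in> A. \<delta> k = d}}"
  by (simp_all add: bmod_def)

lemma subspace_keys: "pm.subspace {f. keys f \<subseteq> A}"
  unfolding pm.subspace_def
  by (auto dest!: subsetD [OF Poly_Mapping.keys_add] subsetD [OF keys_pm_scale])

lemma span_keys: "pm.span ((\<lambda>k. Poly_Mapping.single k (1 :: 'k::field)) ` A) = {f. keys f \<subseteq> A}"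
proof
  show "pm.span ((\<lambda>k. Poly_Mapping.single k (1 :: 'k)) ` A) \<subseteq> {f. keys f \<subseteq> A}"
    by (rule pm.span_minimal) (auto simp: subspace_keys)
  show "{f. keys f \<subseteq> A} \<subseteq> pm.span ((\<lambda>k. Poly_Mapping.single k (1 :: 'k)) ` A)"
  proof clarify
    fix f :: "nat \<Rightarrow>\<^sub>0 'k" assume "keys f \<subseteq> A"
    then have "(\<Sum>k\<in>keys f. pm_scale (lookup f k) (Poly_Mapping.single k 1))
        \<in> pm.span ((\<lambda>k. Poly_Mapping.single k (1 :: 'k)) ` A)"
      by (intro pm.span_sum pm.span_scale pm.span_base) auto
    then show "f \<in> pm.span ((\<lambda>k. Poly_Mapping.single k (1 :: 'k)) ` A)" by (simp add: pm_sum_single)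
  qed
qed

lemma keys_decomp: "direct_sum_decomp {f :: nat \<Rightarrow>\<^sub>0 'k::field. keys f \<subseteq> A} (\<lambda>d. {f. keys f \<subseteq> {k \<in> A. \<delta> k = d}})"
  unfolding direct_sum_decomp_def
proof (intro conjI allI ballI)
  fix v :: "nat \<Rightarrow>\<^sub>0 'k" assume v: "v \<in> {f. keys f \<subseteq> A}"
  define p where "p d = (\<Sum>k | k \<in> keys v \<and> \<delta> k = d. Poly_Mapping.single k (lookup v k))" for d
  have lp: "lookup (p d) k = (if \<delta> k = d then lookup v k else 0)" for d k
    by (auto simp: p_def lookup_sum lookup_single when_def in_keys_iff sum.delta)
  have fin: "finite {d. p d \<noteq> 0}"
  proof (rule finite_subset)
    show "{d. p d \<noteq> 0} \<subseteq> \<delta> ` keys v"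
      by (force simp: poly_mapping_eq_iff fun_eq_iff lp in_keys_iff split: if_splits)
  qed simp
  show "\<exists>!f. (\<forall>i. f i \<in> {f. keys f \<subseteq> {k \<in> A. \<delta> k = i}}) \<and> finite {i. f i \<noteq> 0} \<and> v = (\<Sum>i | f i \<noteq> 0. f i)"
  proof (rule ex1I [of _ p], intro conjI allI)
    show "p i \<in> {f. keys f \<subseteq> {k \<in> A. \<delta> k = i}}" for i
      using v by (auto simp: in_keys_iff lp split: if_splits)
    show "v = (\<Sum>i | p i \<noteq> 0. p i)"
    proof (rule poly_mapping_eqI)
      fix k
      have "lookup v k = 0" if "p (\<delta> k) = 0"
        using lp [of "\<delta> k" k] that by simp
      then show "lookup v k = lookup (\<Sum>i | p i \<noteq> 0. p i) k"
        using fin by (auto simp: lookup_sum lp sum.delta)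
    qed
    fix f assume f: "(\<forall>i. f i \<in> {f. keys f \<subseteq> {k \<in> A. \<delta> k = i}}) \<and> finite {i. f i \<noteq> 0} \<and> v = (\<Sum>i | f i \<noteq> 0. f i)"
    show "f = p"
    proof (rule ext, rule poly_mapping_eqI)
      fix d k
      have other: "lookup (f i) k = 0" if "i \<noteq> \<delta> k" for i
      proof -
        have "keys (f i) \<subseteq> {k \<in> A. \<delta> k = i}" using f by blast
        with that have "k \<notin> keys (f i)" by blast
        then show ?thesis by (simp add: in_keys_iff)
      qed
      have "lookup v k = lookup (\<Sum>i | f i \<noteq> 0. f i) k" using f by blast
      also have "\<dots> = (\<Sum>i | f i \<noteq> 0. lookup (f i) k)"
        by (simp add: lookup_sum)
      also have "\<dots> = (\<Sum>i | f i \<noteq> 0. if i = \<delta> k then lookup (f (\<delta> k)) k else 0)"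
        by (rule sum.cong) (auto simp: other)
      also have "\<dots> = lookup (f (\<delta> k)) k"
        using conjunct1 [OF conjunct2 [OF f]] by (auto simp: sum.delta)
      finally show "lookup (f d) k = lookup (p d) k"
        using other by (auto simp: lp)
    qed
  qed (rule fin)
qed auto

lemma bmod_free_action:
  assumes "\<And>g k k'. k \<in> A \<Longrightarrow> ot g k = Some k' \<Longrightarrow> k' \<in> A"
  shows "free_action pm_scale (mgen (bmod ot A \<delta>)) {f. keys f \<subseteq> A}"
proof
  show "pm.subspace {f. keys f \<subseteq> A}" by (rule subspace_keys)
  show "mgen (bmod ot A \<delta>) g v \<in> {f. keys f \<subseteq> A}" if v: "v \<in> {f. keys f \<subseteq> A}" for g v
    unfolding bmod_simps
  proof (rule pm.lext_in_subspace [OF subspace_keys])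
    fix k assume "k \<in> keys v"
    with v have "k \<in> A" by auto
    from assms [OF this, of g] show "basis_opt (ot g k) \<in> {f. keys f \<subseteq> A}"
      by (cases "ot g k") auto
  qed
qed (simp add: pm.lext_lin)

lemma bmod_is_gmod:
  assumes "finite A" and closed: "\<And>g k k'. k \<in> A \<Longrightarrow> ot g k = Some k' \<Longrightarrow> k' \<in> A"
    and distinct: "\<And>i. count \<beta> i \<le> 1"
    and ops: "\<And>k. k \<in> A \<Longrightarrow> klr_ops \<beta> (mgen (bmod ot A \<delta> :: 'k::field_char_0 rmod)) (Poly_Mapping.single k 1)"
    and x: "\<And>j k. k \<in> A \<Longrightarrow> ot (GenX j) k = None"
    and e: "\<And>\<nu> k. k \<in> A \<Longrightarrow> ot (GenE \<nu>) k \<in> {None, Some k}"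
    and t: "\<And>\<nu> j k k'. k \<in> A \<Longrightarrow> j \<in> {1..<size \<beta>} \<Longrightarrow> ot (GenE \<nu>) k = Some k \<Longrightarrow> ot (GenT j) k = Some k' \<Longrightarrow>
      \<delta> k' = \<delta> k - pairing (alpha (\<nu> ! (j - 1))) (alpha (\<nu> ! j))"
  shows "is_gmod \<beta> (bmod ot A \<delta> :: 'k rmod)"
  unfolding is_gmod_def
proof (intro conjI allI ballI)
  let ?M = "bmod ot A \<delta> :: 'k rmod"
  interpret free_action pm_scale "mgen ?M" "{f. keys f \<subseteq> A}"
    by (rule bmod_free_action [OF closed])
  show "vector_space (mscale ?M)" by (simp add: pm.vector_space_axioms)
  show "\<exists>S. finite S \<and> mcar ?M = module.span (mscale ?M) S"
    using span_keys [of A] \<open>finite A\<close> by (metis bmod_simps(1,2) finite_imageI)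
  show "mgen ?M g ` mcar ?M \<subseteq> mcar ?M" for g
    using op_closed [of _ g] unfolding bmod_simps(1) by blast
  show "lin_on (mscale ?M) (mscale ?M) (mcar ?M) (mgen ?M g)" for g
    using op_lin by simp
  show "module.subspace (mscale ?M) (mdeg ?M d)" for d
    by (simp add: subspace_keys)
  show "direct_sum_decomp (mcar ?M) (mdeg ?M)"
    using keys_decomp [of A \<delta>] by (simp add: bmod_def)
  show "free_act (mscale ?M) (mgen ?M) r v = 0" if r: "r \<in> klr_ideal \<beta>" and v: "v \<in> mcar ?M" for r v
  proof -
    \<comment> \<open>\<open>klr_ops\<close> speaks of one vector at a time, but the action of a
      relation is linear in the vector, so basis vectors suffice.\<close>
    have basis: "act s (Poly_Mapping.single k 1) = 0" if "s \<in> klr_relations \<beta>" "k \<in> A" for s k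
      using klr_ops_kills [OF free_action_axioms _ distinct, of "Poly_Mapping.single k 1"] ops [OF that(2)] that
      by auto
    have "act s w = 0" if "s \<in> klr_relations \<beta>" "w \<in> {f. keys f \<subseteq> A}" for s w
    proof -
      have "act s w = act s (\<Sum>k\<in>keys w. pm_scale (lookup w k) (Poly_Mapping.single k 1))"
        by (simp add: pm_sum_single)
      also have "\<dots> = (\<Sum>k\<in>keys w. act s (pm_scale (lookup w k) (Poly_Mapping.single k 1)))"
        using that(2) by (intro act_vsum) auto
      also have "\<dots> = 0"
        using that by (intro sum.neutral ballI) (subst act_scale, auto simp del: pm_scale_single simp: basis)
      finally show ?thesis .
    qed
    then show ?thesis
      using ideal_gen_kills [of "klr_relations \<beta>" r v] r v by (simp add: klr_ideal_def)
  qed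
  fix d v \<nu> assume v: "v \<in> mdeg ?M d" and \<nu>: "\<nu> \<in> permutations_of_multiset \<beta>"
  have ev: "mE ?M \<nu> v \<in> {f. keys f \<subseteq> {k \<in> A. \<delta> k = d \<and> ot (GenE \<nu>) k = Some k}}"
    unfolding bmod_simps
  proof (rule pm.lext_in_subspace [OF subspace_keys])
    fix k assume "k \<in> keys v"
    with v have "k \<in> A" "\<delta> k = d" by auto
    with e [of k \<nu>] show "basis_opt (ot (GenE \<nu>) k) \<in> {f. keys f \<subseteq> {k \<in> A. \<delta> k = d \<and> ot (GenE \<nu>) k = Some k}}"
      by auto
  qed
  then show "mE ?M \<nu> v \<in> mdeg ?M d" by auto
  show "mX ?M j (mE ?M \<nu> v) \<in> mdeg ?M (d + pairing (alpha (\<nu> ! (j - 1))) (alpha (\<nu> ! (j - 1))))" for j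
  proof -
    have "lext pm_scale (\<lambda>k. basis_opt (ot (GenX j) k)) (mE ?M \<nu> v) \<in> {f. keys f \<subseteq> {}}"
      by (rule pm.lext_in_subspace [OF subspace_keys]) (use ev x in auto)
    then show ?thesis by simp
  qed
  show "mT ?M j (mE ?M \<nu> v) \<in> mdeg ?M (d - pairing (alpha (\<nu> ! (j - 1))) (alpha (\<nu> ! j)))"
    if j: "j \<in> {1..<size \<beta>}" for j
    unfolding bmod_simps(3,4)
  proof (rule pm.lext_in_subspace [OF subspace_keys])
    fix k assume "k \<in> keys (lext pm_scale (\<lambda>k. basis_opt (ot (GenE \<nu>) k)) v)"
    with ev have k: "k \<in> A" "\<delta> k = d" "ot (GenE \<nu>) k = Some k" by auto
    show "basis_opt (ot (GenT j) k)
        \<in> {f. keys f \<subseteq> {k \<in> A. \<delta> k = d - pairing (alpha (\<nu> ! (j - 1))) (alpha (\<nu> ! j))}}"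
    proof (cases "ot (GenT j) k")
      case (Some k')
      with closed [OF k(1) Some] t [OF k(1) j k(3) Some] k(2) show ?thesis by simp
    qed simp
  qed
qed

text \<open>Vectors that obey the rule of the partial maps are all that a homomorphism requires.
  Both the exact sequences and the maps out of convolution products are obtained in this
  way.\<close>

lemma bmod_hom:
  fixes X :: "('k::field_char_0, 'v::ab_group_add) gmod"
  assumes X: "is_gmod \<beta> X"
    and y: "\<And>k. k \<in> A \<Longrightarrow> y k \<in> mdeg X (\<delta> k)"
    and gen: "\<And>g k. k \<in> A \<Longrightarrow> mgen X g (y k) = (case ot g k of None \<Rightarrow> 0 | Some k' \<Rightarrow> y k')"
  shows "gmod_hom (bmod ot A \<delta>) X (lext (mscale X) y)"
  unfolding gmod_hom_def
proof (intro conjI allI ballI)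
  let ?M = "bmod ot A \<delta> :: 'k rmod"
  interpret free_action "mscale X" "mgen X" "mcar X" by (rule gmod_free_action [OF X])
  have sub: "mdeg X d \<subseteq> mcar X" for d
    using gmod_decomp [OF X] by (auto simp: direct_sum_decomp_def)
  show "lext (mscale X) y ` mcar ?M \<subseteq> mcar X"
    using sub y by (auto intro!: lext_in_subspace [OF subspace_U])
  show "lin_on (mscale ?M) (mscale X) (mcar ?M) (lext (mscale X) y)"
    by (simp add: lext_lin)
  show "lext (mscale X) y ` mdeg ?M d \<subseteq> mdeg X d" for d
    using y by (auto intro!: lext_in_subspace [OF gmod_deg_subspace [OF X]])
  fix g v assume v: "v \<in> mcar ?M"
  have "lext (mscale X) y (mgen ?M g v)
      = (\<Sum>k\<in>keys v. mscale X (lookup v k) (lext (mscale X) y (basis_opt (ot g k))))"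
  proof -
    have "lext (mscale X) y (\<Sum>k\<in>K. pm_scale (lookup v k) (basis_opt (ot g k)))
      = (\<Sum>k\<in>K. mscale X (lookup v k) (lext (mscale X) y (basis_opt (ot g k))))" for K
      by (induction K rule: infinite_finite_induct) (auto simp: lext_add lext_scale)
    then show ?thesis by (simp add: lext_def [of pm_scale])
  qed
  also have "\<dots> = (\<Sum>k\<in>keys v. mgen X g (mscale X (lookup v k) (y k)))"
  proof (rule sum.cong)
    fix k assume "k \<in> keys v"
    with v have k: "k \<in> A" by auto
    with y sub have "y k \<in> mcar X" by blast
    with gen [OF k, of g] show "mscale X (lookup v k) (lext (mscale X) y (basis_opt (ot g k)))
        = mgen X g (mscale X (lookup v k) (y k))"
      by (auto simp: op_scale split: option.splits)
  qed simp
  also have "\<dots> = mgen X g (lext (mscale X) y v)"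
    unfolding lext_def using v y sub
    by (intro op_sum [symmetric] subspace_scale [OF subspace_U]) auto
  finally show "lext (mscale X) y (mgen ?M g v) = mgen X g (lext (mscale X) y v)" .
qed

section \<open>Chain modules\<close>

text \<open>Equating the distance of letters with the distance of positions describes runs that rise
  by one throughout or fall by one throughout, so ascending and descending segments are treated at
  once.\<close>

definition path :: "int list \<Rightarrow> bool" where
  "path \<nu> \<longleftrightarrow> (\<forall>i<length \<nu>. \<forall>j<length \<nu>. \<bar>\<nu> ! i - \<nu> ! j\<bar> = \<bar>int i - int j\<bar>)"

lemma pathD: "path \<nu> \<Longrightarrow> i < length \<nu> \<Longrightarrow> j < length \<nu> \<Longrightarrow> \<bar>\<nu> ! i - \<nu> ! j\<bar> = \<bar>int i - int j\<bar>"
  by (simp add: path_def)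

lemma path_distinct: "path \<nu> \<Longrightarrow> distinct \<nu>"
  unfolding distinct_conv_nth
proof (intro allI impI)
  fix i j assume "path \<nu>" "i < length \<nu>" "j < length \<nu>" "i \<noteq> j"
  with pathD [of \<nu> i j] show "\<nu> ! i \<noteq> \<nu> ! j" by auto
qed

lemma path_upto: "path [a..b]" "path (rev [a..b])"
  by (auto simp: path_def rev_nth of_nat_diff)

lemma path_tl: "path \<nu> \<Longrightarrow> path (tl \<nu>)"
  by (auto simp: path_def nth_tl)

lemma count_distinct_le: "distinct \<nu> \<Longrightarrow> count (mset \<nu>) i \<le> 1"
  by (simp add: distinct_count_atmost_1)

text \<open>The shuffles of the first letter c with the remaining word W, indexed by the position of
  c counted from 0.\<close>

definition insert_word :: "int list \<Rightarrow> nat \<Rightarrow> int list" where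
  "insert_word \<nu> k = take k (tl \<nu>) @ hd \<nu> # drop k (tl \<nu>)"

lemma length_insert_word: "k < length \<nu> \<Longrightarrow> length (insert_word \<nu> k) = length \<nu>"
  by (auto simp: insert_word_def)

lemma nth_insert_word:
  assumes "k < length \<nu>" "i < length \<nu>"
  shows "insert_word \<nu> k ! i = (if i < k then \<nu> ! Suc i else if i = k then \<nu> ! 0 else \<nu> ! i)"
proof -
  obtain c W where \<nu>: "\<nu> = c # W" using assms by (cases \<nu>) auto
  show ?thesis
    using assms by (auto simp: insert_word_def \<nu> nth_append min_def nth_Cons')
qed

lemma mset_insert_word:
  assumes "k < length \<nu>"
  shows "mset (insert_word \<nu> k) = mset \<nu>"
proof -
  obtain c W where \<nu>: "\<nu> = c # W" using assms by (cases \<nu>) auto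
  have "mset (take k W @ drop k W) = mset W" by simp
  then show ?thesis by (simp add: insert_word_def \<nu> del: append_take_drop_id)
qed

lemma insert_word_0: "\<nu> \<noteq> [] \<Longrightarrow> insert_word \<nu> 0 = \<nu>"
  by (simp add: insert_word_def)

lemma swap_at_swap_at: "k \<in> {1..<length \<nu>} \<Longrightarrow> swap_at k (swap_at k \<nu>) = \<nu>"
  by (rule nth_equalityI) (auto simp: swap_at_def nth_list_update)

lemma swap_at_insert_word:
  assumes "Suc k < length \<nu>"
  shows "swap_at (Suc k) (insert_word \<nu> k) = insert_word \<nu> (Suc k)"
    and "swap_at (Suc k) (insert_word \<nu> (Suc k)) = insert_word \<nu> k"
proof -
  show *: "swap_at (Suc k) (insert_word \<nu> k) = insert_word \<nu> (Suc k)"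
    using assms
    by (intro nth_equalityI) (auto simp: swap_at_def length_insert_word nth_list_update nth_insert_word)
  show "swap_at (Suc k) (insert_word \<nu> (Suc k)) = insert_word \<nu> k"
    using swap_at_swap_at [of "Suc k" "insert_word \<nu> k"] assms by (simp add: * length_insert_word)
qed

text \<open>The basis vector \<open>k\<close> belongs to the word in which the first letter of \<open>\<nu>\<close> has moved to position \<open>k\<close>.
  Moving it past a letter that it is not adjacent to is invertible; the flags tell whether it may pass
  its neighbour to the right and to the left.\<close>

fun chain_op :: "int list \<Rightarrow> bool \<Rightarrow> bool \<Rightarrow> klr_gen \<Rightarrow> nat \<Rightarrow> nat option" where
  "chain_op \<nu> U D (GenE \<mu>) k = (if \<mu> = insert_word \<nu> k then Some k else None)"
| "chain_op \<nu> U D (GenX j) k = None"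
| "chain_op \<nu> U D (GenT j) k =
    (if j = Suc k \<and> j < length \<nu> \<and> (k = 0 \<longrightarrow> U) then Some (Suc k)
     else if j = k \<and> 0 < k \<and> k < length \<nu> \<and> (k = 1 \<longrightarrow> D) then Some (k - 1)
     else None)"

lemma chain_swap:
  assumes "chain_op \<nu> U D (GenT j) k = Some k'"
  shows "swap_at j (insert_word \<nu> k) = insert_word \<nu> k'" "j \<in> {1..<length \<nu>}" "k' < length \<nu>"
  using assms swap_at_insert_word [of k \<nu>] swap_at_insert_word [of "k - 1" \<nu>]
  by (auto split: if_splits)

lemma chain_T_cases:
  "chain_op \<nu> U D (GenT j) k = Some k' \<Longrightarrow> (j = Suc k \<and> k' = j) \<or> (j = k \<and> Suc k' = k)"
  by (auto split: if_splits)

lemma chain_T_None: "j \<noteq> Suc k \<Longrightarrow> j \<noteq> k \<Longrightarrow> chain_op \<nu> U D (GenT j) k = None"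
  by simp

text \<open>\<tau>_j acts only between the vectors j - 1 and j, so operators at distance more than
  one never act in succession; both sides of the commutation relation vanish.\<close>

lemma chain_far:
  assumes "\<bar>int j - int l\<bar> > 1"
  shows "Option.bind (chain_op \<nu> U D (GenT l) k) (chain_op \<nu> U D (GenT j)) = None"
proof (cases "chain_op \<nu> U D (GenT l) k")
  case (Some k')
  have "chain_op \<nu> U D (GenT j) k' = None"
    using chain_T_cases [OF Some] assms by (intro chain_T_None) auto
  with Some show ?thesis by (simp only: Option.bind.simps)
qed (simp only: Option.bind.simps)

text \<open>After two \<tau> of neighbouring indices the letter c has moved two places in one
  direction, out of reach of the first one. Both sides of the braid relation are zero.\<close>

lemma chain_braid:
  "Option.bind (Option.bind (chain_op \<nu> U D (GenT (Suc j)) k) (chain_op \<nu> U D (GenT j))) (chain_op \<nu> U D (GenT (Suc j))) = None"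
  "Option.bind (Option.bind (chain_op \<nu> U D (GenT j) k) (chain_op \<nu> U D (GenT (Suc j)))) (chain_op \<nu> U D (GenT j)) = None"
proof -
  have "False" if "chain_op \<nu> U D (GenT i) k = Some k1" "chain_op \<nu> U D (GenT l) k1 = Some k2"
    "chain_op \<nu> U D (GenT i) k2 = Some k3" "\<bar>int i - int l\<bar> = 1" for i l k1 k2 k3
    using chain_T_cases [OF that(1)] chain_T_cases [OF that(2)] chain_T_cases [OF that(3)] that(4) by auto
  then have *: "Option.bind (Option.bind (chain_op \<nu> U D (GenT i) k) (chain_op \<nu> U D (GenT l))) (chain_op \<nu> U D (GenT i)) = None"
    if "\<bar>int i - int l\<bar> = 1" for i l
    using that by (metis Option.bind.simps not_None_eq)
  show "Option.bind (Option.bind (chain_op \<nu> U D (GenT (Suc j)) k) (chain_op \<nu> U D (GenT j))) (chain_op \<nu> U D (GenT (Suc j))) = None"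
    "Option.bind (Option.bind (chain_op \<nu> U D (GenT j) k) (chain_op \<nu> U D (GenT (Suc j)))) (chain_op \<nu> U D (GenT j)) = None"
    by (intro *; simp)+
qed

text \<open>On the edge between the vectors 0 and 1 the letter c meets its neighbour. As
  \<open>U\<close> and \<open>D\<close> do not both hold, this edge can be crossed in at most one
  direction, and the square vanishes there; all other edges can be crossed both ways.\<close>

lemma chain_square:
  assumes "k < length \<nu>" "\<not> (U \<and> D)"
  shows "Option.bind (chain_op \<nu> U D (GenT j) k) (chain_op \<nu> U D (GenT j))
    = (if (j = Suc k \<and> 1 \<le> k \<and> j < length \<nu>) \<or> (j = k \<and> 2 \<le> k) then Some k else None)"
  using assms by auto

text \<open>c differs by k from the letter on its left and by k + 1 from the one on its right, while
  neighbouring letters other than c are consecutive in \<nu>. With \<open>chain_square\<close> this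
  matches the quadratic relation, all x acting by 0.\<close>

lemma adjacent_insert_word:
  assumes "path \<nu>" "k < length \<nu>" "j \<in> {1..<length \<nu>}"
  shows "\<bar>insert_word \<nu> k ! j - insert_word \<nu> k ! (j - 1)\<bar> = 1 \<longleftrightarrow>
    \<not> ((j = Suc k \<and> 1 \<le> k) \<or> (j = k \<and> 2 \<le> k))"
proof -
  have p: "\<bar>\<nu> ! a - \<nu> ! b\<bar> = \<bar>int a - int b\<bar>" if "a < length \<nu>" "b < length \<nu>" for a b
    using pathD [OF assms(1) that] .
  have pos: "0 < length \<nu>" using assms(2) by linarith
  consider "j < k" | "j = k" | "j = Suc k" | "Suc k < j" by linarith
  then show ?thesis
  proof cases
    case 1
    then show ?thesis using assms p [of "Suc j" j] by (simp add: nth_insert_word)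
  next
    case 2
    then show ?thesis using assms p [OF pos assms(2)] by (auto simp: nth_insert_word)
  next
    case 3
    then show ?thesis using assms p [OF _ pos, of "Suc k"] by (auto simp: nth_insert_word)
  next
    case 4
    then show ?thesis using assms p [of j "j - 1"] by (auto simp: nth_insert_word of_nat_diff)
  qed
qed


lemma basis_bind:
  "lext pm_scale (\<lambda>k. basis_opt (ot k)) (basis_opt o') = (basis_opt (Option.bind o' ot) :: nat \<Rightarrow>\<^sub>0 'k::field)"
  by (cases o') simp_all

lemma basis_bind_single:
  "lext pm_scale (\<lambda>k. basis_opt (ot k)) (Poly_Mapping.single k (1 :: 'k::field)) = basis_opt (ot k)"
  by simp

lemma chain_klr_ops:
  fixes \<delta> :: "nat \<Rightarrow> int"
  assumes "path \<nu>" "k < length \<nu>" "\<not> (U \<and> D)"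
  shows "klr_ops (mset \<nu>) (mgen (bmod (chain_op \<nu> U D) A \<delta> :: 'k::field_char_0 rmod)) (Poly_Mapping.single k 1)"
proof -
  let ?T = "\<lambda>j. chain_op \<nu> U D (GenT j)" and ?I = "permutations_of_multiset (mset \<nu>)"
  have inI: "insert_word \<nu> k \<in> ?I"
    using assms(2) by (simp add: permutations_of_multiset_def mset_insert_word)
  have len: "length \<mu> = length \<nu>" if "\<mu> \<in> ?I" for \<mu>
    using that by (auto simp: permutations_of_multiset_def dest: mset_eq_length)
  have sum_e: "(\<Sum>\<mu>\<in>?I. basis_opt (chain_op \<nu> U D (GenE \<mu>) k)) = Poly_Mapping.single k (1::'k)"
  proof -
    have "(\<Sum>\<mu>\<in>?I. basis_opt (chain_op \<nu> U D (GenE \<mu>) k))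
        = (\<Sum>\<mu>\<in>?I. if \<mu> = insert_word \<nu> k then Poly_Mapping.single k (1::'k) else 0)"
      by (rule sum.cong) auto
    then show ?thesis using inI by (simp add: sum.delta)
  qed
  have te: "Option.bind (chain_op \<nu> U D (GenE \<mu>) k) (?T j) = Option.bind (?T j k) (chain_op \<nu> U D (GenE (swap_at j \<mu>)))"
    if "j \<in> {1..<length \<nu>}" "\<mu> \<in> ?I" for j \<mu>
  proof (cases "?T j k")
    case (Some k')
    have "swap_at j \<mu> = insert_word \<nu> k' \<longleftrightarrow> \<mu> = insert_word \<nu> k"
      using chain_swap(1) [OF Some] swap_at_swap_at [of j \<mu>] swap_at_swap_at [of j "insert_word \<nu> k"] that
        len [OF that(2)] length_insert_word [OF assms(2)] by metis
    with Some show ?thesis by (simp del: chain_op.simps(3))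
  qed (simp del: chain_op.simps(3))
  have comm: "Option.bind (?T l k) (?T j) = Option.bind (?T j k) (?T l)" if "\<bar>int j - int l\<bar> > 1" for j l
    using chain_far [of l j] chain_far [of j l] that by simp
  have braid: "Option.bind (Option.bind (Option.bind (chain_op \<nu> U D (GenE \<mu>) k) (?T (j + 1))) (?T j)) (?T (j + 1))
      = Option.bind (Option.bind (Option.bind (chain_op \<nu> U D (GenE \<mu>) k) (?T j)) (?T (j + 1))) (?T j)" for j \<mu>
    using chain_braid [of \<nu> U D j k] by (cases "chain_op \<nu> U D (GenE \<mu>) k = None") (auto split: if_splits simp del: chain_op.simps(3) Option.bind_assoc)
  have quad: "basis_opt (Option.bind (Option.bind (chain_op \<nu> U D (GenE \<mu>) k) (?T j)) (?T j)) =
        (if \<mu> ! j = \<mu> ! (j - 1) + 1 then 0 else if \<mu> ! j = \<mu> ! (j - 1) - 1 then 0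
         else basis_opt (chain_op \<nu> U D (GenE \<mu>) k) :: nat \<Rightarrow>\<^sub>0 'k)"
    if "j \<in> {1..<length \<nu>}" for j \<mu>
  proof (cases "\<mu> = insert_word \<nu> k")
    case True
    have "\<mu> ! j = \<mu> ! (j - 1) + 1 \<or> \<mu> ! j = \<mu> ! (j - 1) - 1 \<longleftrightarrow> \<bar>\<mu> ! j - \<mu> ! (j - 1)\<bar> = 1"
      by arith
    then show ?thesis
      using adjacent_insert_word [OF assms(1,2) that] chain_square [OF assms(2,3), of j] that
      by (auto simp: True simp del: chain_op.simps(3))
  qed auto
  have x: "chain_op \<nu> U D (GenX j) = (\<lambda>_. None)" for j
    by (rule ext) simp
  show ?thesis
    unfolding klr_ops_def Let_def bmod_simps basis_bind_single basis_bind size_mset sum_e x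
    apply (intro conjI)
    subgoal by auto
    subgoal using inI by auto
    subgoal by (rule refl)
    subgoal by simp
    subgoal using assms(2) by auto
    subgoal by simp
    subgoal by simp
    subgoal by (intro ballI) (simp only: te)
    subgoal by (intro ballI impI) (simp only: comm)
    subgoal using quad by (simp add: basis_opt_def del: chain_op.simps)
    subgoal by simp
    subgoal by (intro allI impI) (simp only: braid)
    done
qed

text \<open>\<tau> has degree 1 when it exchanges letters that differ by one, and degree 0 for
  letters further apart. So the grading jumps only on the edge between 0 and 1, upwards in the
  direction in which it may be crossed.\<close>

lemma chain_is_gmod:
  assumes "path \<nu>" "A \<subseteq> {..<length \<nu>}" "\<not> (U \<and> D)"
    and closed: "\<And>j k k'. k \<in> A \<Longrightarrow> chain_op \<nu> U D (GenT j) k = Some k' \<Longrightarrow> k' \<in> A"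
    and \<delta>: "\<And>k. Suc k \<in> A \<Longrightarrow> 0 < k \<Longrightarrow> k \<in> A \<Longrightarrow> \<delta> (Suc k) = \<delta> k"
    and up: "U \<Longrightarrow> 0 \<in> A \<Longrightarrow> 1 \<in> A \<Longrightarrow> \<delta> 1 = \<delta> 0 + 1"
    and down: "D \<Longrightarrow> 0 \<in> A \<Longrightarrow> 1 \<in> A \<Longrightarrow> \<delta> 0 = \<delta> 1 + 1"
  shows "is_gmod (mset \<nu>) (bmod (chain_op \<nu> U D) A \<delta> :: 'k::field_char_0 rmod)"
proof (rule bmod_is_gmod)
  show "finite A" using assms(2) by (rule finite_subset) simp
  show "k' \<in> A" if "k \<in> A" "chain_op \<nu> U D g k = Some k'" for g k k'
    using closed [OF that(1)] that by (cases g) (auto split: if_splits)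
  show "count (mset \<nu>) i \<le> 1" for i
    by (intro count_distinct_le path_distinct assms(1))
  show "klr_ops (mset \<nu>) (mgen (bmod (chain_op \<nu> U D) A \<delta> :: 'k rmod)) (Poly_Mapping.single k 1)" if "k \<in> A" for k
    using assms(2) that by (intro chain_klr_ops assms(1,3)) auto
  fix \<mu> j k k'
  assume k: "k \<in> A" and j: "j \<in> {1..<size (mset \<nu>)}" and e: "chain_op \<nu> U D (GenE \<mu>) k = Some k"
    and t: "chain_op \<nu> U D (GenT j) k = Some k'"
  have len: "k < length \<nu>" using k assms(2) by auto
  have \<mu>: "\<mu> = insert_word \<nu> k" using e by (simp split: if_splits)
  have "distinct \<mu>"
    using path_distinct [OF assms(1)] mset_insert_word [OF len] by (metis \<mu> mset_eq_imp_distinct_iff)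
  then have neq: "\<mu> ! (j - 1) \<noteq> \<mu> ! j"
    using j by (auto simp: \<mu> length_insert_word [OF len] nth_eq_iff_index_eq)
  have k': "k' \<in> A" by (rule closed [OF k t])
  have adj: "\<bar>\<mu> ! (j - 1) - \<mu> ! j\<bar> = 1 \<longleftrightarrow> \<not> ((j = Suc k \<and> 1 \<le> k) \<or> (j = k \<and> 2 \<le> k))"
    using adjacent_insert_word [OF assms(1) len, of j] j by (simp add: \<mu> abs_minus_commute)
  have "(j = Suc k \<and> k' = j \<and> (k = 0 \<longrightarrow> U)) \<or> (j = k \<and> Suc k' = k \<and> (k = 1 \<longrightarrow> D))"
    using t by (auto split: if_splits)
  then show "\<delta> k' = \<delta> k - pairing (alpha (\<mu> ! (j - 1))) (alpha (\<mu> ! j))"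
    unfolding pairing_alpha lookup_alpha adj
  proof (elim disjE conjE)
    assume "j = Suc k" "k' = j" "k = 0 \<longrightarrow> U"
    then show "\<delta> k' = \<delta> k - (2 * of_bool (\<mu> ! (j - 1) = \<mu> ! j) - of_bool (\<not> (j = Suc k \<and> 1 \<le> k \<or> j = k \<and> 2 \<le> k)))"
      using \<delta> [of k] up k k' neq by (cases "k = 0") auto
  next
    assume "j = k" "Suc k' = k" "k = 1 \<longrightarrow> D"
    then show "\<delta> k' = \<delta> k - (2 * of_bool (\<mu> ! (j - 1) = \<mu> ! j) - of_bool (\<not> (j = Suc k \<and> 1 \<le> k \<or> j = k \<and> 2 \<le> k)))"
      using \<delta> [of k'] down k k' neq by (cases "k' = 0") auto
  qed
qed auto

lemma klr_opsD:
  assumes "klr_ops \<beta> op v"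
  shows klr_e_other: "\<nu> \<in> permutations_of_multiset \<beta> \<Longrightarrow> \<nu>' \<in> permutations_of_multiset \<beta> \<Longrightarrow> \<nu> \<noteq> \<nu>' \<Longrightarrow>
      op (GenE \<nu>) (op (GenE \<nu>') v) = 0"
    and klr_e_out: "\<nu> \<notin> permutations_of_multiset \<beta> \<Longrightarrow> op (GenE \<nu>) v = 0"
    and klr_x_out: "k \<notin> {1..size \<beta>} \<Longrightarrow> op (GenX k) v = 0"
    and klr_t_out: "k \<notin> {1..<size \<beta>} \<Longrightarrow> op (GenT k) v = 0"
    and klr_t_e: "k \<in> {1..<size \<beta>} \<Longrightarrow> \<nu> \<in> permutations_of_multiset \<beta> \<Longrightarrow>
      op (GenT k) (op (GenE \<nu>) v) = op (GenE (swap_at k \<nu>)) (op (GenT k) v)"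
    and klr_t_far: "k \<in> {1..<size \<beta>} \<Longrightarrow> l \<in> {1..<size \<beta>} \<Longrightarrow> \<bar>int k - int l\<bar> > 1 \<Longrightarrow>
      op (GenT k) (op (GenT l) v) = op (GenT l) (op (GenT k) v)"
    and klr_t_square: "k \<in> {1..<size \<beta>} \<Longrightarrow> \<nu> \<in> permutations_of_multiset \<beta> \<Longrightarrow>
      op (GenT k) (op (GenT k) (op (GenE \<nu>) v)) =
        (if \<nu> ! k = \<nu> ! (k - 1) + 1 then op (GenX k) (op (GenE \<nu>) v) - op (GenX (k + 1)) (op (GenE \<nu>) v)
         else if \<nu> ! k = \<nu> ! (k - 1) - 1 then op (GenX (k + 1)) (op (GenE \<nu>) v) - op (GenX k) (op (GenE \<nu>) v)
         else op (GenE \<nu>) v)"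
    and klr_t_x: "k \<in> {1..<size \<beta>} \<Longrightarrow> l \<in> {1..size \<beta>} \<Longrightarrow> \<nu> \<in> permutations_of_multiset \<beta> \<Longrightarrow>
      op (GenT k) (op (GenX l) (op (GenE \<nu>) v)) = op (GenX (transpose k (k + 1) l)) (op (GenT k) (op (GenE \<nu>) v))"
    and klr_braid: "1 \<le> k \<Longrightarrow> k + 1 < size \<beta> \<Longrightarrow> \<nu> \<in> permutations_of_multiset \<beta> \<Longrightarrow>
      op (GenT (k + 1)) (op (GenT k) (op (GenT (k + 1)) (op (GenE \<nu>) v))) =
      op (GenT k) (op (GenT (k + 1)) (op (GenT k) (op (GenE \<nu>) v)))"
proof (goal_cases)
  note ops = assms [unfolded klr_ops_def Let_def]
  note o2 = conjunct2 [OF ops]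
  note o4 = conjunct2 [OF conjunct2 [OF o2]]
  note o5 = conjunct2 [OF o4]
  note o8 = conjunct2 [OF conjunct2 [OF conjunct2 [OF o5]]]
  note o9 = conjunct2 [OF o8]
  note o10 = conjunct2 [OF o9]
  note o11 = conjunct2 [OF o10]
  {
    case 1
    then show ?case
      using bspec [OF bspec [OF conjunct1 [OF ops] 1(1)] 1(2)] by (simp only: if_False)
  next
    case 2
    with conjunct1 [OF o2] show ?case by blast
  next
    case 3
    with conjunct1 [OF o4] show ?case by blast
  next
    case 4
    with conjunct1 [OF o5] show ?case by blast
  next
    case 5
    then show ?case by (rule bspec [OF bspec [OF conjunct1 [OF o8]]])
  next
    case 6
    then show ?case by (rule mp [OF bspec [OF bspec [OF conjunct1 [OF o9]]]])
  next
    case 7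
    then show ?case by (rule bspec [OF bspec [OF conjunct1 [OF o10]]])
  next
    case 8
    then show ?case by (rule bspec [OF bspec [OF bspec [OF conjunct1 [OF o11]]]])
  next
    case 9
    with conjunct2 [OF o11] show ?case by blast
  }
qed

section \<open>Images of a generating vector\<close>

text \<open>Vectors of a module that behave like the generator of a convolution product of \<open>L(c)\<close> with
  a one-dimensional module, with \<open>c\<close> the first letter of \<open>\<nu>\<close>: the letter \<open>c\<close> starts on the left of the
  remaining word, or on the right of it if \<open>rv\<close> holds.\<close>

locale chain_target =
  fixes \<nu> :: "int list" and X :: "('k::field_char_0, 'v::ab_group_add) gmod" and rv :: bool and y0 :: 'v
    and n :: nat and pos g :: "nat \<Rightarrow> nat"
  defines "n \<equiv> length \<nu>" and "pos \<equiv> (\<lambda>k. if rv then n - 1 - k else k)"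
    and "g \<equiv> (\<lambda>k. if rv then n - k else k)"
  assumes path: "path \<nu>" and two: "2 \<le> n" and X: "is_gmod (mset \<nu>) X"
    and y0_deg: "y0 \<in> mdeg X 0" and y0_e: "mE X (insert_word \<nu> (pos 0)) y0 = y0"
    and y0_x: "\<And>l. mX X l y0 = 0"
    and y0_t: "\<And>l. l \<noteq> g 1 \<Longrightarrow> mT X l y0 = 0"
begin

sublocale free_action "mscale X" "mgen X" "mcar X"
  by (rule gmod_free_action [OF X])

text \<open>y k is the image of y0 after c has been carried k places. It corresponds to the basis
  vector \<open>pos k\<close>, because for \<open>rv\<close> the journey starts at the right
  end.\<close>

definition y :: "nat \<Rightarrow> 'v" where
  "y = rec_nat y0 (\<lambda>k z. mT X (g (Suc k)) z)"

lemma y_simps: "y 0 = y0" "y (Suc k) = mT X (g (Suc k)) (y k)"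
  by (simp_all add: y_def)

lemma deg_sub: "v \<in> mdeg X d \<Longrightarrow> v \<in> mcar X"
  using gmod_decomp [OF X] by (auto simp: direct_sum_decomp_def)

lemma y_closed: "y k \<in> mcar X"
  by (induction k) (auto simp: y_simps deg_sub [OF y0_deg] op_closed)

lemma ops: "v \<in> mcar X \<Longrightarrow> klr_ops (mset \<nu>) (mgen X) v"
  by (rule gmod_klr_ops [OF X count_distinct_le [OF path_distinct [OF path]]])

lemma pos_less: "k < n \<Longrightarrow> pos k < n"
  using two by (auto simp: pos_def)

lemma g_range: "0 < k \<Longrightarrow> k < n \<Longrightarrow> g k \<in> {1..<n}"
  by (auto simp: g_def)

lemma word_perm: "k < n \<Longrightarrow> insert_word \<nu> (pos k) \<in> permutations_of_multiset (mset \<nu>)"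
  using pos_less [of k] by (simp add: permutations_of_multiset_def mset_insert_word n_def)

lemma word_step: "Suc k < n \<Longrightarrow> swap_at (g (Suc k)) (insert_word \<nu> (pos k)) = insert_word \<nu> (pos (Suc k))"
proof (cases rv)
  case True
  assume "Suc k < n"
  then have "pos k = Suc (pos (Suc k))" "g (Suc k) = pos k" "pos k < n"
    using True by (auto simp: pos_def g_def)
  then show ?thesis using swap_at_insert_word(2) [of "pos (Suc k)" \<nu>] by (simp add: n_def)
next
  case False
  assume "Suc k < n"
  then show ?thesis using False swap_at_insert_word(1) [of k \<nu>] by (simp add: pos_def g_def n_def)
qed

lemma y_e: "k < n \<Longrightarrow> mE X (insert_word \<nu> (pos k)) (y k) = y k"
proof (induction k)
  case (Suc k)
  then have "mE X (insert_word \<nu> (pos (Suc k))) (y (Suc k)) = mT X (g (Suc k)) (mE X (insert_word \<nu> (pos k)) (y k))"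
    using klr_t_e [OF ops [OF y_closed], of "g (Suc k)" "insert_word \<nu> (pos k)" k] word_perm [of k] g_range [of "Suc k"]
    by (simp add: y_simps word_step n_def)
  with Suc show ?case by (simp add: y_simps)
qed (simp add: y_simps y0_e)

lemma y_x: "k < n \<Longrightarrow> mX X l (y k) = 0"
proof (induction k arbitrary: l)
  case (Suc k)
  show ?case
  proof (cases "l \<in> {1..n}")
    case True
    let ?j = "g (Suc k)"
    have j: "?j \<in> {1..<n}" using Suc(2) by (intro g_range) auto
    then have l': "transpose ?j (?j + 1) l \<in> {1..n}" using True by (auto simp: transpose_def)
    have "mX X (transpose ?j (?j + 1) (transpose ?j (?j + 1) l)) (mT X ?j (mE X (insert_word \<nu> (pos k)) (y k)))
        = mT X ?j (mX X (transpose ?j (?j + 1) l) (mE X (insert_word \<nu> (pos k)) (y k)))"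
      using j l' Suc(2) word_perm [of k] by (intro klr_t_x [OF ops [OF y_closed], symmetric]) (auto simp: n_def)
    then show ?thesis using Suc y_e [of k] by (simp add: y_simps op_zero)
  next
    case False
    then show ?thesis by (intro klr_x_out [OF ops [OF y_closed]]) (simp add: n_def)
  qed
qed (simp add: y_simps y0_x)

lemma braid:
  assumes "a \<in> {1..<n}" "b \<in> {1..<n}" "\<bar>int a - int b\<bar> = 1" "k < n"
  shows "mT X a (mT X b (mT X a (y k))) = mT X b (mT X a (mT X b (y k)))"
proof -
  have *: "mT X (j + 1) (mT X j (mT X (j + 1) (y k))) = mT X j (mT X (j + 1) (mT X j (y k)))"
    if "1 \<le> j" "j + 1 < n" for j
    using klr_braid [OF ops [OF y_closed], of j "insert_word \<nu> (pos k)" k] that word_perm [OF assms(4)] y_e [OF assms(4)]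
    by (simp add: n_def)
  have "a = b + 1 \<or> b = a + 1" using assms(3) by linarith
  then show ?thesis using * [of b] * [of a] assms(1,2) by auto
qed

text \<open>The extra \<tau> either commutes past the last factor of y k, or repeats the factor
  before it. In the second case the braid relation brings the last factor directly to an earlier
  vector, which it kills by induction.\<close>

lemma y_t_far:
  "k < n \<Longrightarrow> 0 < l \<Longrightarrow> l < n \<Longrightarrow> l \<noteq> k \<Longrightarrow> l \<noteq> Suc k \<Longrightarrow> mT X (g l) (y k) = 0"
proof (induction k arbitrary: l rule: less_induct)
  case (less k)
  show ?case
  proof (cases k)
    case 0
    have "g l \<noteq> g 1" using less(3-6) 0 by (auto simp: g_def split: if_splits)
    then show ?thesis using 0 y0_t by (simp add: y_simps)
  next
    case (Suc k0)
    show ?thesis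
    proof (cases "l = k0")
      case True
      then obtain k1 where k1: "k0 = Suc k1" using less(3) by (cases k0) auto
      have "mT X (g l) (y k) = mT X (g k0) (mT X (g k) (mT X (g k0) (y k1)))"
        by (simp add: True Suc k1 y_simps)
      also have "\<dots> = mT X (g k) (mT X (g k0) (mT X (g k) (y k1)))"
        using less(2) Suc k1 g_range [of k0] g_range [of k] by (intro braid) (auto simp: g_def)
      also have "mT X (g k) (y k1) = 0"
        using less(2) Suc k1 by (intro less.IH) auto
      finally show ?thesis by (simp add: op_zero)
    next
      case False
      have "mT X (g l) (y k) = mT X (g l) (mT X (g k) (y k0))" by (simp add: Suc y_simps)
      also have "\<dots> = mT X (g k) (mT X (g l) (y k0))"
        using less(2-6) Suc False g_range [of l] g_range [of k]
        by (intro klr_t_far [OF ops [OF y_closed]]) (auto simp: g_def n_def)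
      also have "mT X (g l) (y k0) = 0"
        using less(2-6) Suc False by (intro less.IH) auto
      finally show ?thesis by (simp add: op_zero)
    qed
  qed
qed

lemma adjacent:
  assumes "Suc k < n"
  shows "\<bar>insert_word \<nu> (pos k) ! g (Suc k) - insert_word \<nu> (pos k) ! (g (Suc k) - 1)\<bar> = 1
    \<longleftrightarrow> pos k = 0 \<or> pos (Suc k) = 0"
  using adjacent_insert_word [OF path, of "pos k" "g (Suc k)"] assms pos_less [of k] g_range [of "Suc k"]
  by (auto simp: n_def pos_def g_def)

text \<open>All x kill y k, so the quadratic relation gives 0 across letters that differ by one and
  the identity otherwise.\<close>

lemma y_t_back:
  assumes "Suc k < n"
  shows "mT X (g (Suc k)) (y (Suc k)) = (if pos k = 0 \<or> pos (Suc k) = 0 then 0 else y k)"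
proof -
  let ?j = "g (Suc k)" and ?w = "insert_word \<nu> (pos k)"
  have k: "k < n" using assms by simp
  have "mT X ?j (y (Suc k)) = mT X ?j (mT X ?j (mE X ?w (y k)))"
    by (simp add: y_simps y_e [OF k])
  also have "\<dots> = (if ?w ! ?j = ?w ! (?j - 1) + 1 then mX X ?j (mE X ?w (y k)) - mX X (?j + 1) (mE X ?w (y k))
         else if ?w ! ?j = ?w ! (?j - 1) - 1 then mX X (?j + 1) (mE X ?w (y k)) - mX X ?j (mE X ?w (y k))
         else mE X ?w (y k))"
    using g_range [of "Suc k"] assms by (intro klr_t_square [OF ops [OF y_closed]] word_perm k) (auto simp: n_def)
  also have "\<dots> = (if \<bar>?w ! ?j - ?w ! (?j - 1)\<bar> = 1 then 0 else y k)"
    by (auto simp: y_e [OF k] y_x [OF k])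
  finally show ?thesis by (simp only: adjacent [OF assms])
qed

text \<open>c passes its neighbour once: at the first step if it starts on the left, at the last
  step if it starts on the right.\<close>

lemma y_deg:
  "k < n \<Longrightarrow> y k \<in> mdeg X (if rv then of_bool (pos k = 0) else of_bool (pos k \<noteq> 0))"
proof (induction k)
  case 0
  then show ?case using y0_deg two by (simp add: y_simps pos_def)
next
  case (Suc k)
  let ?j = "g (Suc k)" and ?w = "insert_word \<nu> (pos k)"
  let ?d = "if rv then of_bool (pos k = 0) else of_bool (pos k \<noteq> 0) :: int"
  have k: "k < n" "pos k < length \<nu>" using Suc(2) pos_less [of k] by (auto simp: n_def)
  have j: "?j \<in> {1..<size (mset \<nu>)}" using g_range [of "Suc k"] Suc(2) by (simp add: n_def)
  have "y k \<in> mdeg X ?d" using Suc by simp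
  then have "mT X ?j (mE X ?w (y k)) \<in> mdeg X (?d - pairing (alpha (?w ! (?j - 1))) (alpha (?w ! ?j)))"
    using X word_perm [OF k(1)] j unfolding is_gmod_def by blast
  moreover have "?w ! (?j - 1) \<noteq> ?w ! ?j"
  proof -
    have "distinct ?w" using path_distinct [OF path] mset_insert_word [OF k(2)]
      by (metis mset_eq_imp_distinct_iff)
    then show ?thesis using j by (auto simp: nth_eq_iff_index_eq length_insert_word [OF k(2)])
  qed
  then have "pairing (alpha (?w ! (?j - 1))) (alpha (?w ! ?j)) = - of_bool (pos k = 0 \<or> pos (Suc k) = 0)"
    using adjacent [OF Suc(2)] by (auto simp: pairing_alpha lookup_alpha abs_minus_commute)
  moreover have "?d + of_bool (pos k = 0 \<or> pos (Suc k) = 0)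
      = (if rv then of_bool (pos (Suc k) = 0) else of_bool (pos (Suc k) \<noteq> 0))"
    using Suc(2) by (auto simp: pos_def)
  ultimately show ?case by (simp add: y_simps y_e [OF k(1)])
qed

lemma pos_pos: "k < n \<Longrightarrow> pos (pos k) = k"
  by (auto simp: pos_def)

text \<open>The vectors y obey every rule of the chain whose flags are set by the side from which c
  starts; this is the existence half of the universal property.\<close>

lemma chain_images:
  assumes "k < n"
  shows "mgen X h (y (pos k)) = (case chain_op \<nu> (\<not> rv) rv h k of None \<Rightarrow> 0 | Some k' \<Rightarrow> y (pos k'))"
proof -
  have pk: "pos k < n" using assms by (rule pos_less)
  show ?thesis
  proof (cases h)
    case (GenE \<mu>)
    have "mE X \<mu> (y (pos k)) = 0" if "\<mu> \<noteq> insert_word \<nu> k"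
    proof (cases "\<mu> \<in> permutations_of_multiset (mset \<nu>)")
      case True
      then show ?thesis
        using klr_e_other [OF ops [OF y_closed] True word_perm [OF pk], of "pos k"] y_e [OF pk] that
        by (simp add: pos_pos [OF assms])
    qed (rule klr_e_out [OF ops [OF y_closed]])
    then show ?thesis using GenE y_e [OF pk] by (simp add: pos_pos [OF assms])
  next
    case (GenX j)
    then show ?thesis using y_x [OF pk] by simp
  next
    case (GenT j)
    have "mT X j (y (pos k)) = 0" if "j \<notin> {1..<n}"
      using that by (intro klr_t_out [OF ops [OF y_closed]]) (simp add: n_def)
    moreover have "mT X j (y (pos k)) = (case chain_op \<nu> (\<not> rv) rv (GenT j) k of None \<Rightarrow> 0 | Some k' \<Rightarrow> y (pos k'))"
      if j: "j \<in> {1..<n}"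
    proof (cases rv)
      case False
      then have p: "pos i = i" "g i = i" for i by (simp_all add: pos_def g_def)
      consider "j = Suc k" | "j = k" | "j \<noteq> k" "j \<noteq> Suc k" by blast
      then show ?thesis
      proof cases
        case 1
        with False j show ?thesis using y_simps(2) [of k] by (simp add: p n_def)
      next
        case 2
        with j obtain i where "k = Suc i" by (cases k) auto
        with 2 False j show ?thesis using y_t_back [of i] by (auto simp: p n_def)
      next
        case 3
        with j assms show ?thesis using y_t_far [of k j] by (simp add: p)
      qed
    next
      case True
      then have p: "pos i = n - 1 - i" "g i = n - i" for i by (simp_all add: pos_def g_def)
      consider "j = Suc k" | "j = k" | "j \<noteq> k" "j \<noteq> Suc k" by blast
      then show ?thesis
      proof cases
        case 1
        then have e: "pos k = Suc (pos j)" "g (pos k) = j" "Suc (pos j) < n" using assms j by (auto simp: p)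
        have "mT X j (y (pos k)) = (if pos (pos j) = 0 \<or> pos (pos k) = 0 then 0 else y (pos j))"
          using y_t_back [OF e(3)] e by simp
        with 1 True j assms show ?thesis by (auto simp: pos_pos n_def)
      next
        case 2
        then have "Suc (pos k) = pos (k - 1)" "g (Suc (pos k)) = j" using assms j by (auto simp: p)
        with 2 True j assms show ?thesis using y_simps(2) [of "pos k"] by (auto simp: n_def)
      next
        case 3
        have "g (n - j) = j" using j by (auto simp: p)
        with 3 j assms show ?thesis using y_t_far [of "pos k" "n - j"] by (auto simp: p)
      qed
    qed
    moreover have "chain_op \<nu> (\<not> rv) rv (GenT j) k = None" if "j \<notin> {1..<n}"
      using that assms by (auto simp: n_def)
    ultimately show ?thesis using GenT by (cases "j \<in> {1..<n}") auto
  qed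
qed

end

section \<open>Exact sequences and convolution products of chain modules\<close>

lemma lin_on_lext:
  assumes "vector_space s" "lin_on pm_scale s {f. keys f \<subseteq> A} h" "keys v \<subseteq> A"
  shows "h v = lext s (\<lambda>k. h (Poly_Mapping.single k 1)) v"
proof -
  interpret vector_space s by fact
  have zero: "h 0 = 0"
    using assms(2) unfolding lin_on_def by (metis (mono_tags, lifting) add_0 add_cancel_right_left keys_zero mem_Collect_eq empty_subsetI)
  have "h (\<Sum>k\<in>K. Poly_Mapping.single k (lookup v k))
      = (\<Sum>k\<in>K. s (lookup v k) (h (Poly_Mapping.single k 1)))" if "finite K" "K \<subseteq> A" for K
    using that
  proof (induction K rule: finite_induct)
    case (insert k K)
    have "(\<Sum>k\<in>K. Poly_Mapping.single k (lookup v k)) \<in> {f. keys f \<subseteq> A}"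
      by (rule pm.subspace_sum [OF subspace_keys]) (use insert.prems in auto)
    then have "keys (\<Sum>k\<in>K. Poly_Mapping.single k (lookup v k)) \<subseteq> A" by simp
    moreover have "h (Poly_Mapping.single k (lookup v k)) = s (lookup v k) (h (Poly_Mapping.single k 1))"
      using assms(2) insert.prems unfolding lin_on_def
      by (metis (mono_tags, lifting) insert_subset keys_single mem_Collect_eq mult.right_neutral pm_scale_single singletonD subsetI zero_neq_one)
    moreover have "keys (Poly_Mapping.single k (lookup v k)) \<subseteq> A" using insert.prems by simp
    ultimately show ?case
      using assms(2) insert unfolding lin_on_def by simp
  qed (simp add: zero)
  from this [OF finite_keys assms(3)] show ?thesis by (simp add: pm_sum_single lext_def)
qed

definition restrict_pm :: "nat set \<Rightarrow> (nat \<Rightarrow>\<^sub>0 'k::field) \<Rightarrow> (nat \<Rightarrow>\<^sub>0 'k)" where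
  "restrict_pm S = lext pm_scale (\<lambda>k. if k \<in> S then Poly_Mapping.single k 1 else 0)"

lemma lookup_restrict_pm: "lookup (restrict_pm S v) k = (if k \<in> S then lookup v k else 0)"
proof -
  have "lookup (restrict_pm S v) k = (\<Sum>l\<in>keys v. if l = k then (if k \<in> S then lookup v k else 0) else 0)"
    unfolding restrict_pm_def lext_def lookup_sum
    by (rule sum.cong) (auto simp: lookup_single when_def)
  then show ?thesis by (auto simp: sum.delta in_keys_iff)
qed

lemma restrict_pm_id: "keys v \<subseteq> S \<Longrightarrow> restrict_pm S v = v"
  by (rule poly_mapping_eqI) (auto simp: lookup_restrict_pm in_keys_iff)

text \<open>A' is closed under the partial maps and spans a submodule. The quotient has basis A'',
  with the partial maps cut off where they leave it.\<close>

lemma bmod_ses: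
  fixes \<delta> :: "nat \<Rightarrow> int"
  assumes M: "is_gmod \<beta> (bmod ot (A' \<union> A'') \<delta> :: 'k::field_char_0 rmod)"
    and M'': "is_gmod \<beta> (bmod ot'' A'' \<delta>'' :: 'k rmod)"
    and disj: "A' \<inter> A'' = {}"
    and sub: "\<And>g k. k \<in> A' \<Longrightarrow> ot' g k = ot g k"
    and closed: "\<And>g k k'. k \<in> A' \<Longrightarrow> ot g k = Some k' \<Longrightarrow> k' \<in> A'"
    and \<delta>': "\<And>k. k \<in> A' \<Longrightarrow> \<delta>' k = \<delta> k" and \<delta>'': "\<And>k. k \<in> A'' \<Longrightarrow> \<delta>'' k = \<delta> k"
    and quot: "\<And>g k. k \<in> A'' \<Longrightarrow> ot'' g k = Option.bind (ot g k) (\<lambda>k'. if k' \<in> A'' then Some k' else None)"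
  shows "is_ses (bmod ot' A' \<delta>') (bmod ot (A' \<union> A'') \<delta> :: 'k rmod) (bmod ot'' A'' \<delta>'')"
proof -
  let ?M = "bmod ot (A' \<union> A'') \<delta> :: 'k rmod" and ?M'' = "bmod ot'' A'' \<delta>'' :: 'k rmod"
    and ?M' = "bmod ot' A' \<delta>' :: 'k rmod"
  have f: "gmod_hom ?M' ?M (lext (mscale ?M) (\<lambda>k. if k \<in> A' then Poly_Mapping.single k 1 else 0))"
  proof (rule bmod_hom [OF M])
    show "(if k \<in> A' then Poly_Mapping.single k 1 else 0) \<in> mdeg ?M (\<delta>' k)" if "k \<in> A'" for k
      using that \<delta>' by simp
    show "mgen ?M g (if k \<in> A' then Poly_Mapping.single k 1 else 0)
        = (case ot' g k of None \<Rightarrow> 0 | Some k' \<Rightarrow> if k' \<in> A' then Poly_Mapping.single k' 1 else 0)"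
      if "k \<in> A'" for g k
      using that sub [OF that, of g] closed [OF that, of g] by (auto split: option.split)
  qed
  have g: "gmod_hom ?M ?M'' (lext (mscale ?M'') (\<lambda>k. if k \<in> A'' then Poly_Mapping.single k 1 else 0))"
  proof (rule bmod_hom [OF M''])
    show "(if k \<in> A'' then Poly_Mapping.single k 1 else 0) \<in> mdeg ?M'' (\<delta> k)" if "k \<in> A' \<union> A''" for k
      using that \<delta>'' by simp
    show "mgen ?M'' g (if k \<in> A'' then Poly_Mapping.single k 1 else 0)
        = (case ot g k of None \<Rightarrow> 0 | Some k' \<Rightarrow> if k' \<in> A'' then Poly_Mapping.single k' 1 else 0)"
      if "k \<in> A' \<union> A''" for g k
    proof (cases "k \<in> A''")
      case True
      then show ?thesis using quot [OF True, of g] by (auto split: option.split)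
    next
      case False
      with that have "k \<in> A'" by blast
      from closed [OF this, of g] disj have "ot g k = Some k' \<Longrightarrow> k' \<notin> A''" for k' by blast
      then show ?thesis using False by (auto split: option.split)
    qed
  qed
  have f_id: "restrict_pm A' v = v" if "v \<in> mcar ?M'" for v using that by (simp add: restrict_pm_id)
  show ?thesis
    unfolding is_ses_def
  proof (intro exI conjI)
    show "gmod_hom ?M' ?M (restrict_pm A')" "gmod_hom ?M ?M'' (restrict_pm A'')"
      using f g by (simp_all add: restrict_pm_def)
    show "inj_on (restrict_pm A') (mcar ?M')" by (rule inj_onI) (simp add: f_id)
    show "restrict_pm A'' ` mcar ?M = mcar ?M''"
    proof
      show "restrict_pm A'' ` mcar ?M \<subseteq> mcar ?M''"
        by (auto simp: in_keys_iff lookup_restrict_pm split: if_splits)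
      show "mcar ?M'' \<subseteq> restrict_pm A'' ` mcar ?M"
      proof
        fix v assume v: "v \<in> mcar ?M''"
        then show "v \<in> restrict_pm A'' ` mcar ?M"
          by (intro image_eqI [of _ _ v]) (auto simp: restrict_pm_id)
      qed
    qed
    have "restrict_pm A' ` mcar ?M' = mcar ?M'" by (simp only: image_cong [OF refl f_id] image_ident)
    also have "\<dots> = {v \<in> mcar ?M. restrict_pm A'' v = 0}"
    proof (intro set_eqI)
      fix v :: "nat \<Rightarrow>\<^sub>0 'k"
      have "restrict_pm A'' v = 0 \<longleftrightarrow> keys v \<inter> A'' = {}"
        by (auto simp: poly_mapping_eq_iff fun_eq_iff lookup_restrict_pm in_keys_iff)
      then show "v \<in> mcar ?M' \<longleftrightarrow> v \<in> {v \<in> mcar ?M. restrict_pm A'' v = 0}"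
        using disj by auto
    qed
    finally show "restrict_pm A' ` mcar ?M' = {v \<in> mcar ?M. restrict_pm A'' v = 0}" .
  qed
qed

lemma qshift_bmod: "qshift (bmod ot A \<delta>) = bmod ot A (\<lambda>k. \<delta> k + 1)"
  by (simp add: qshift_def bmod_def fun_eq_iff eq_diff_eq)

text \<open>For \<open>\<nu> = c W\<close> the modules below are \<open>L(\<nu>)\<close>, the convolution products \<open>L(c) \<circ> L(W)\<close> and \<open>L(W) \<circ> L(c)\<close>
  (if \<open>rv\<close> holds), and the module \<open>K\<close> of the two exact sequences.\<close>

definition line_mod :: "int list \<Rightarrow> 'k::field_char_0 rmod" where
  "line_mod \<nu> = bmod (chain_op \<nu> False False) {0} (\<lambda>_. 0)"

definition conv_mod :: "bool \<Rightarrow> int list \<Rightarrow> 'k::field_char_0 rmod" where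
  "conv_mod rv \<nu> = bmod (chain_op \<nu> (\<not> rv) rv) {..<length \<nu>}
     (\<lambda>k. if rv then of_bool (k = 0) else of_bool (k \<noteq> 0))"

definition rest_mod :: "int list \<Rightarrow> 'k::field_char_0 rmod" where
  "rest_mod \<nu> = bmod (chain_op \<nu> False False) {1..<length \<nu>} (\<lambda>_. 0)"

lemma line_is_gmod: "path \<nu> \<Longrightarrow> \<nu> \<noteq> [] \<Longrightarrow> is_gmod (mset \<nu>) (line_mod \<nu> :: 'k::field_char_0 rmod)"
  unfolding line_mod_def by (rule chain_is_gmod) auto

lemma conv_is_gmod: "path \<nu> \<Longrightarrow> is_gmod (mset \<nu>) (conv_mod rv \<nu> :: 'k::field_char_0 rmod)"
  unfolding conv_mod_def by (rule chain_is_gmod) (auto split: if_splits)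

lemma rest_is_gmod: "path \<nu> \<Longrightarrow> is_gmod (mset \<nu>) (rest_mod \<nu> :: 'k::field_char_0 rmod)"
  unfolding rest_mod_def by (rule chain_is_gmod) (auto split: if_splits)

lemma qshift_line_is_gmod:
  "path \<nu> \<Longrightarrow> \<nu> \<noteq> [] \<Longrightarrow> is_gmod (mset \<nu>) (qshift (line_mod \<nu> :: 'k::field_char_0 rmod))"
  unfolding line_mod_def qshift_bmod by (rule chain_is_gmod) auto

lemma qshift_rest_is_gmod:
  "path \<nu> \<Longrightarrow> is_gmod (mset \<nu>) (qshift (rest_mod \<nu> :: 'k::field_char_0 rmod))"
  unfolding rest_mod_def qshift_bmod by (rule chain_is_gmod) (auto split: if_splits)

lemma lessThan_split: "2 \<le> n \<Longrightarrow> {..<n} = {1..<n} \<union> {0::nat}"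
  by auto

lemma chain_op_positive:
  "0 < k \<Longrightarrow> chain_op \<nu> U D g k = chain_op \<nu> U' D g k"
  "0 < k \<Longrightarrow> chain_op \<nu> U False g k = Some k' \<Longrightarrow> 0 < k'"
  by (cases g; auto split: if_splits)+

lemma chain_op_less: "k < length \<nu> \<Longrightarrow> chain_op \<nu> U D g k = Some k' \<Longrightarrow> k' < length \<nu>"
  by (cases g) (auto split: if_splits)

text \<open>c can leave position 0 but not return, so the vectors k > 0 form a submodule; it sits in
  degree 1, whence the shift.\<close>

lemma ses_conv_left:
  assumes "path \<nu>" "2 \<le> length \<nu>"
  shows "is_ses (qshift (rest_mod \<nu>)) (conv_mod False \<nu>) (line_mod \<nu> :: 'k::field_char_0 rmod)"
  unfolding rest_mod_def conv_mod_def line_mod_def qshift_bmod lessThan_split [OF assms(2)]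
proof (rule bmod_ses)
  note [simp del] = chain_op.simps(3)
  show "is_gmod (mset \<nu>) (bmod (chain_op \<nu> (\<not> False) False) ({1..<length \<nu>} \<union> {0})
      (\<lambda>k. if False then of_bool (k = 0) else of_bool (k \<noteq> 0)) :: 'k rmod)"
    using conv_is_gmod [OF assms(1), of False] unfolding conv_mod_def lessThan_split [OF assms(2)] .
  show "is_gmod (mset \<nu>) (bmod (chain_op \<nu> False False) {0} (\<lambda>_. 0) :: 'k rmod)"
    using line_is_gmod [OF assms(1)] assms(2) unfolding line_mod_def by force
  show "chain_op \<nu> False False g k = chain_op \<nu> (\<not> False) False g k" if "k \<in> {1..<length \<nu>}" for g k
    using that by (intro chain_op_positive(1)) simp
  show "k' \<in> {1..<length \<nu>}"
    if "k \<in> {1..<length \<nu>}" "chain_op \<nu> (\<not> False) False g k = Some k'" for g k k'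
    using that(1) chain_op_less [OF _ that(2)] chain_op_positive(2) [of k \<nu> True g k'] that(2) by simp
  show "chain_op \<nu> False False g k
      = Option.bind (chain_op \<nu> (\<not> False) False g k) (\<lambda>k'. if k' \<in> {0} then Some k' else None)"
    if "k \<in> {0}" for g k
    using that by (cases g) (auto simp: chain_op.simps(3))
qed auto

text \<open>Here position 0 can be reached but not left, so the word \<nu> spans the submodule, in
  degree 1. The same K is the quotient, this time without a shift.\<close>

lemma ses_conv_right:
  assumes "path \<nu>" "2 \<le> length \<nu>"
  shows "is_ses (qshift (line_mod \<nu>)) (conv_mod True \<nu>) (rest_mod \<nu> :: 'k::field_char_0 rmod)"
  unfolding rest_mod_def conv_mod_def line_mod_def qshift_bmod lessThan_split [OF assms(2)] Un_commute [of _ "{0}"]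
proof (rule bmod_ses)
  note [simp del] = chain_op.simps(3)
  show "is_gmod (mset \<nu>) (bmod (chain_op \<nu> (\<not> True) True) ({0} \<union> {1..<length \<nu>})
      (\<lambda>k. if True then of_bool (k = 0) else of_bool (k \<noteq> 0)) :: 'k rmod)"
    using conv_is_gmod [OF assms(1), of True]
    unfolding conv_mod_def lessThan_split [OF assms(2)] Un_commute [of _ "{0}"] .
  show "is_gmod (mset \<nu>) (bmod (chain_op \<nu> False False) {1..<length \<nu>} (\<lambda>_. 0) :: 'k rmod)"
    using rest_is_gmod [OF assms(1)] unfolding rest_mod_def .
  show "chain_op \<nu> False False g k = chain_op \<nu> (\<not> True) True g k" if "k \<in> {0}" for g k
    using that by (cases g) (auto simp: chain_op.simps(3))
  show "k' \<in> {0}" if "k \<in> {0}" "chain_op \<nu> (\<not> True) True g k = Some k'" for g k k'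
    using that by (cases g) (auto simp: chain_op.simps(3) split: if_splits)
  show "chain_op \<nu> False False g k = Option.bind (chain_op \<nu> (\<not> True) True g k)
      (\<lambda>k'. if k' \<in> {1..<length \<nu>} then Some k' else None)" if "k \<in> {1..<length \<nu>}" for g k
    using that by (cases g) (auto simp: chain_op.simps(3))
qed auto

section \<open>Convolution products of one-dimensional modules\<close>

lemma line_mod_simps:
  "mcar (line_mod \<nu>) = {f. keys f \<subseteq> {0}}" "mscale (line_mod \<nu>) = pm_scale"
  "mdeg (line_mod \<nu>) d = {f. keys f \<subseteq> (if d = 0 then {0} else {})}"
  by (auto simp: line_mod_def)

lemma keys_subset_singleton: "keys f \<subseteq> {i} \<longleftrightarrow> f = Poly_Mapping.single i (lookup f i)"
proof
  assume "keys f \<subseteq> {i}"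
  then show "f = Poly_Mapping.single i (lookup f i)"
    by (intro poly_mapping_eqI) (auto simp: lookup_single when_def in_keys_iff)
qed (metis keys_single empty_subsetI order_refl)

lemma pm_scale_one [simp]: "pm_scale c 1 = Poly_Mapping.single 0 c"
  using pm_scale_single [of c 0 1] by simp

lemma line_mod_gen:
  assumes "keys m \<subseteq> {0}" "\<nu> \<noteq> []"
  shows "mE (line_mod \<nu>) \<mu> m = (if \<mu> = \<nu> then m else 0)"
    and "mX (line_mod \<nu>) j m = 0" "mT (line_mod \<nu>) j m = 0"
proof -
  obtain a where m: "m = Poly_Mapping.single 0 a"
    by (rule that [OF iffD1 [OF keys_subset_singleton assms(1)]])
  show "mE (line_mod \<nu>) \<mu> m = (if \<mu> = \<nu> then m else 0)" "mX (line_mod \<nu>) j m = 0" "mT (line_mod \<nu>) j m = 0"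
    unfolding m by (simp_all add: line_mod_def insert_word_0 [OF assms(2)])
qed

text \<open>A map out of a product of two lines is its value at the generating pair. The algebra
  acting on the two factors contains every x and every \<tau> except the one at index
  \<open>length \<mu>1\<close>, which mixes the two words.\<close>

lemma line_conv_map:
  fixes X :: "'k::field_char_0 rmod"
  assumes X: "is_gmod (mset \<mu>1 + mset \<mu>2) X" and distinct: "distinct (\<mu>1 @ \<mu>2)" "\<mu>1 \<noteq> []" "\<mu>2 \<noteq> []"
    and \<psi>: "conv_map (mset \<mu>1) (mset \<mu>2) (line_mod \<mu>1) (line_mod \<mu>2) X \<psi>"
  defines "b \<equiv> Poly_Mapping.single 0 1"
  shows "\<psi> b b \<in> mdeg X 0" "mE X (\<mu>1 @ \<mu>2) (\<psi> b b) = \<psi> b b" "mX X l (\<psi> b b) = 0"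
    "l \<noteq> length \<mu>1 \<Longrightarrow> mT X l (\<psi> b b) = 0"
    "keys m \<subseteq> {0} \<Longrightarrow> keys n \<subseteq> {0} \<Longrightarrow> \<psi> m n = mscale X (lookup m 0 * lookup n 0) (\<psi> b b)"
proof -
  interpret free_action "mscale X" "mgen X" "mcar X" by (rule gmod_free_action [OF X])
  have b: "keys b \<subseteq> {0}" "b \<in> mcar (line_mod \<mu>)" "b \<in> mdeg (line_mod \<mu>) 0" for \<mu>
    by (simp_all add: b_def line_mod_simps)
  have lin1: "lin_on pm_scale (mscale X) {f. keys f \<subseteq> {0}} (\<psi> m)"
    and lin2: "lin_on pm_scale (mscale X) {f. keys f \<subseteq> {0}} (\<lambda>m. \<psi> m n)" if "keys m \<subseteq> {0}" "keys n \<subseteq> {0}" for m n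
    using \<psi> that by (auto simp: conv_map_def line_mod_simps)
  have car: "\<psi> b b \<in> mcar X" using \<psi> b by (auto simp: conv_map_def)
  show "\<psi> b b \<in> mdeg X 0"
    using \<psi> b(3) unfolding conv_map_def by (metis add_0)
  have zero: "\<psi> 0 b = 0" "\<psi> b 0 = 0"
    using lin_on_lext [OF vector_space_axioms lin1 [OF b(1) b(1)], of 0]
      lin_on_lext [OF vector_space_axioms lin2 [OF b(1) b(1)], of 0] by simp_all
  show val: "\<psi> m n = mscale X (lookup m 0 * lookup n 0) (\<psi> b b)" if m: "keys m \<subseteq> {0}" and n: "keys n \<subseteq> {0}" for m n
  proof -
    have sub: "lext (mscale X) y f = mscale X (lookup f 0) (y 0)" if "keys f \<subseteq> {0}" for y f
      using lext_superset [of "{0}" f y] that by simp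
    have "\<psi> m n = mscale X (lookup n 0) (\<psi> m b)"
      using lin_on_lext [OF vector_space_axioms lin1 [OF m n] n] by (simp add: sub [OF n] b_def)
    also have "\<psi> m b = mscale X (lookup m 0) (\<psi> b b)"
      using lin_on_lext [OF vector_space_axioms lin2 [OF m b(1)] m] by (simp add: sub [OF m] b_def)
    finally show ?thesis by (simp add: mult.commute)
  qed
  have rules: "\<forall>\<nu>\<in>permutations_of_multiset (mset \<mu>1). \<forall>\<mu>\<in>permutations_of_multiset (mset \<mu>2).
           \<psi> (mE (line_mod \<mu>1) \<nu> b) (mE (line_mod \<mu>2) \<mu> b) = mE X (\<nu> @ \<mu>) (\<psi> b b)"
    "\<forall>k\<in>{1..size (mset \<mu>1)}. \<psi> (mX (line_mod \<mu>1) k b) b = mX X k (\<psi> b b)"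
    "\<forall>k\<in>{1..size (mset \<mu>2)}. \<psi> b (mX (line_mod \<mu>2) k b) = mX X (size (mset \<mu>1) + k) (\<psi> b b)"
    "\<forall>k\<in>{1..<size (mset \<mu>1)}. \<psi> (mT (line_mod \<mu>1) k b) b = mT X k (\<psi> b b)"
    "\<forall>k\<in>{1..<size (mset \<mu>2)}. \<psi> b (mT (line_mod \<mu>2) k b) = mT X (size (mset \<mu>1) + k) (\<psi> b b)"
    using \<psi> b(2) unfolding conv_map_def by blast+
  show "mE X (\<mu>1 @ \<mu>2) (\<psi> b b) = \<psi> b b"
    using rules(1) [THEN bspec, of \<mu>1, THEN bspec, of \<mu>2]
    by (simp add: line_mod_gen [OF b(1)] distinct permutations_of_multiset_def)
  have ops: "klr_ops (mset \<mu>1 + mset \<mu>2) (mgen X) (\<psi> b b)"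
    using gmod_klr_ops [OF X _ car] count_distinct_le [OF distinct(1)] by simp
  show "mX X l (\<psi> b b) = 0"
  proof -
    consider "l \<in> {1..length \<mu>1}" | k where "l = length \<mu>1 + k" "k \<in> {1..length \<mu>2}"
      | "l \<notin> {1..length \<mu>1 + length \<mu>2}"
    proof -
      assume a: "l \<in> {1..length \<mu>1} \<Longrightarrow> thesis" "\<And>k. l = length \<mu>1 + k \<Longrightarrow> k \<in> {1..length \<mu>2} \<Longrightarrow> thesis"
        "l \<notin> {1..length \<mu>1 + length \<mu>2} \<Longrightarrow> thesis"
      show thesis
      proof (cases "length \<mu>1 < l \<and> l \<le> length \<mu>1 + length \<mu>2")
        case True
        then show thesis by (intro a(2) [of "l - length \<mu>1"]) auto
      next
        case False
        then show thesis using a(1,3) by (cases "1 \<le> l") auto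
      qed
    qed
    then show ?thesis
    proof cases
      case 1
      then show ?thesis using rules(2) by (simp add: line_mod_gen [OF b(1)] distinct zero)
    next
      case 2
      then show ?thesis using rules(3) by (simp add: line_mod_gen [OF b(1)] distinct zero)
    next
      case 3
      then show ?thesis by (intro klr_x_out [OF ops]) simp
    qed
  qed
  show "mT X l (\<psi> b b) = 0" if l: "l \<noteq> length \<mu>1"
  proof -
    consider "l \<in> {1..<length \<mu>1}" | k where "l = length \<mu>1 + k" "k \<in> {1..<length \<mu>2}"
      | "l \<notin> {1..<length \<mu>1 + length \<mu>2}"
    proof -
      assume a: "l \<in> {1..<length \<mu>1} \<Longrightarrow> thesis" "\<And>k. l = length \<mu>1 + k \<Longrightarrow> k \<in> {1..<length \<mu>2} \<Longrightarrow> thesis"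
        "l \<notin> {1..<length \<mu>1 + length \<mu>2} \<Longrightarrow> thesis"
      show thesis
      proof (cases "length \<mu>1 < l \<and> l < length \<mu>1 + length \<mu>2")
        case True
        then show thesis by (intro a(2) [of "l - length \<mu>1"]) auto
      next
        case False
        then show thesis using a(1,3) l by (cases "1 \<le> l") auto
      qed
    qed
    then show ?thesis
    proof cases
      case 1
      then show ?thesis using rules(4) by (simp add: line_mod_gen [OF b(1)] distinct zero)
    next
      case 2
      then show ?thesis using rules(5) by (simp add: line_mod_gen [OF b(1)] distinct zero)
    next
      case 3
      then show ?thesis by (intro klr_t_out [OF ops]) simp
    qed
  qed
qed

text \<open>For one-dimensional factors the universal property splits in two:
  \<open>universal\<close> supplies a map for every admissible image of the generator, and
  \<open>generated\<close>, reachability from the index i by the \<tau>, makes it unique.\<close>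

lemma bmod_convolution:
  fixes A :: "nat set" and \<delta> :: "nat \<Rightarrow> int"
  assumes P: "is_gmod (mset \<mu>1 + mset \<mu>2) (bmod ot A \<delta> :: 'k::field_char_0 rmod)"
    and distinct: "distinct (\<mu>1 @ \<mu>2)" "\<mu>1 \<noteq> []" "\<mu>2 \<noteq> []"
    and i: "i \<in> A" "\<delta> i = 0"
    and e: "\<And>\<nu>. ot (GenE \<nu>) i = (if \<nu> = \<mu>1 @ \<mu>2 then Some i else None)"
    and x: "\<And>l. ot (GenX l) i = None"
    and t: "\<And>l. l \<noteq> length \<mu>1 \<Longrightarrow> ot (GenT l) i = None"
    and generated: "\<And>S. i \<in> S \<Longrightarrow> (\<And>j k k'. k \<in> S \<Longrightarrow> k \<in> A \<Longrightarrow> ot (GenT j) k = Some k' \<Longrightarrow> k' \<in> S) \<Longrightarrow> A \<subseteq> S"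
    and universal: "\<And>X y0. is_gmod (mset \<mu>1 + mset \<mu>2) (X :: 'k rmod) \<Longrightarrow> y0 \<in> mdeg X 0 \<Longrightarrow>
      mE X (\<mu>1 @ \<mu>2) y0 = y0 \<Longrightarrow> (\<And>l. mX X l y0 = 0) \<Longrightarrow> (\<And>l. l \<noteq> length \<mu>1 \<Longrightarrow> mT X l y0 = 0) \<Longrightarrow>
      \<exists>y. y i = y0 \<and> (\<forall>k\<in>A. y k \<in> mdeg X (\<delta> k)) \<and>
        (\<forall>k\<in>A. \<forall>h. mgen X h (y k) = (case ot h k of None \<Rightarrow> 0 | Some k' \<Rightarrow> y k'))"
  shows "is_convolution (mset \<mu>1) (mset \<mu>2) (line_mod \<mu>1) (line_mod \<mu>2) (bmod ot A \<delta> :: 'k rmod)"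
proof -
  let ?P = "bmod ot A \<delta> :: 'k rmod"
  let ?b = "Poly_Mapping.single 0 1 :: nat \<Rightarrow>\<^sub>0 'k"
  define \<phi> where "\<phi> m n = Poly_Mapping.single i (lookup m 0 * lookup n 0)" for m n :: "nat \<Rightarrow>\<^sub>0 'k"
  have \<phi>0 [simp]: "\<phi> 0 n = 0" "\<phi> m 0 = 0" for m n by (simp_all add: \<phi>_def)
  have conv: "conv_map (mset \<mu>1) (mset \<mu>2) (line_mod \<mu>1) (line_mod \<mu>2) ?P \<phi>"
    unfolding conv_map_def
  proof (intro conjI ballI allI)
    show "\<phi> m n \<in> mcar ?P" for m n using i by (simp add: \<phi>_def)
    show "lin_on (mscale (line_mod \<mu>2)) (mscale ?P) (mcar (line_mod \<mu>2)) (\<phi> m)" for m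
      by (simp add: lin_on_def \<phi>_def line_mod_simps lookup_add algebra_simps single_add)
    show "lin_on (mscale (line_mod \<mu>1)) (mscale ?P) (mcar (line_mod \<mu>1)) (\<lambda>m. \<phi> m n)" for n
      by (simp add: lin_on_def \<phi>_def line_mod_simps lookup_add algebra_simps single_add)
    show "\<phi> m n \<in> mdeg ?P (c + d)" if "m \<in> mdeg (line_mod \<mu>1) c" "n \<in> mdeg (line_mod \<mu>2) d" for c d m n
    proof (cases "c = 0 \<and> d = 0")
      case True
      then show ?thesis using i by (simp add: \<phi>_def)
    next
      case False
      then have "m = 0 \<or> n = 0" using that by (auto simp: line_mod_simps split: if_splits)
      then show ?thesis by auto
    qed
    fix m n :: "nat \<Rightarrow>\<^sub>0 'k"
    assume mn: "m \<in> mcar (line_mod \<mu>1 :: 'k rmod)" "n \<in> mcar (line_mod \<mu>2 :: 'k rmod)"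
    then have mn': "keys m \<subseteq> {0}" "keys n \<subseteq> {0}" by (simp_all add: line_mod_simps)
    note gen = line_mod_gen [OF mn'(1) distinct(2)] line_mod_gen [OF mn'(2) distinct(3)]
    show "\<phi> (mE (line_mod \<mu>1) \<nu> m) (mE (line_mod \<mu>2) \<mu> n) = mE ?P (\<nu> @ \<mu>) (\<phi> m n)"
      if "\<nu> \<in> permutations_of_multiset (mset \<mu>1)" for \<nu> \<mu>
    proof -
      have "length \<nu> = length \<mu>1" using that by (auto simp: permutations_of_multiset_def dest: mset_eq_length)
      then show ?thesis by (simp add: gen) (simp add: \<phi>_def e)
    qed
    show "\<phi> (mX (line_mod \<mu>1) k m) n = mX ?P k (\<phi> m n)"
      "\<phi> m (mX (line_mod \<mu>2) k n) = mX ?P (size (mset \<mu>1) + k) (\<phi> m n)" for k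
      by (simp_all add: gen) (simp_all add: \<phi>_def x)
    show "\<phi> (mT (line_mod \<mu>1) k m) n = mT ?P k (\<phi> m n)" if "k \<in> {1..<size (mset \<mu>1)}" for k
      using that by (simp add: gen) (simp add: \<phi>_def t)
    show "\<phi> m (mT (line_mod \<mu>2) k n) = mT ?P (size (mset \<mu>1) + k) (\<phi> m n)" if "k \<in> {1..<size (mset \<mu>2)}" for k
      using that by (simp add: gen) (simp add: \<phi>_def t)
  qed
  have "\<exists>h. gmod_hom ?P X h \<and>
         (\<forall>m\<in>mcar (line_mod \<mu>1). \<forall>n\<in>mcar (line_mod \<mu>2). h (\<phi> m n) = \<psi> m n) \<and>
         (\<forall>h'. gmod_hom ?P X h' \<and>
               (\<forall>m\<in>mcar (line_mod \<mu>1). \<forall>n\<in>mcar (line_mod \<mu>2). h' (\<phi> m n) = \<psi> m n) \<longrightarrow>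
               (\<forall>v\<in>mcar ?P. h' v = h v))"
    if "is_gmod (mset \<mu>1 + mset \<mu>2) X \<and> conv_map (mset \<mu>1) (mset \<mu>2) (line_mod \<mu>1) (line_mod \<mu>2) X \<psi>"
    for X :: "'k rmod" and \<psi>
  proof -
  from that have X: "is_gmod (mset \<mu>1 + mset \<mu>2) X"
    and \<psi>: "conv_map (mset \<mu>1) (mset \<mu>2) (line_mod \<mu>1) (line_mod \<mu>2) X \<psi>" by simp_all
  interpret X: free_action "mscale X" "mgen X" "mcar X" by (rule gmod_free_action [OF X])
  note \<psi>' = line_conv_map [OF X distinct \<psi>]
  obtain y where y: "y i = \<psi> ?b ?b" "\<And>k. k \<in> A \<Longrightarrow> y k \<in> mdeg X (\<delta> k)"
    "\<And>k h. k \<in> A \<Longrightarrow> mgen X h (y k) = (case ot h k of None \<Rightarrow> 0 | Some k' \<Rightarrow> y k')"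
    using universal [OF X \<psi>'(1-4)] by blast
  show ?thesis
  proof (intro exI conjI ballI allI impI)
    show "gmod_hom ?P X (lext (mscale X) y)" by (rule bmod_hom [OF X y(2,3)])
    show "lext (mscale X) y (\<phi> m n) = \<psi> m n"
      if "m \<in> mcar (line_mod \<mu>1)" "n \<in> mcar (line_mod \<mu>2)" for m n
      using that \<psi>'(5) [of m n] by (simp add: \<phi>_def y(1) line_mod_simps)
    fix h' v
    assume "gmod_hom ?P X h' \<and>
       (\<forall>m\<in>mcar (line_mod \<mu>1). \<forall>n\<in>mcar (line_mod \<mu>2). h' (\<phi> m n) = \<psi> m n)"
    then have hom: "gmod_hom ?P X h'" and h': "h' (\<phi> ?b ?b) = \<psi> ?b ?b"
      by (simp_all add: line_mod_simps)
    assume v: "v \<in> mcar ?P"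
    \<comment> \<open>The indices at which h' agrees with y include i and are closed under the
      \<tau>, so they exhaust A.\<close>
    have "A \<subseteq> {k. h' (Poly_Mapping.single k 1) = y k}"
    proof (rule generated)
      show "i \<in> {k. h' (Poly_Mapping.single k 1) = y k}" using h' by (simp add: \<phi>_def y(1))
      fix j k k'
      assume k: "k \<in> {k. h' (Poly_Mapping.single k 1) = y k}" "k \<in> A" "ot (GenT j) k = Some k'"
      have "\<forall>g. \<forall>v\<in>mcar ?P. h' (mgen ?P g v) = mgen X g (h' v)"
        using hom unfolding gmod_hom_def by blast
      moreover have "Poly_Mapping.single k 1 \<in> mcar ?P" using k(2) by simp
      ultimately have "h' (mT ?P j (Poly_Mapping.single k 1)) = mT X j (h' (Poly_Mapping.single k 1))"
        by blast
      then show "k' \<in> {k. h' (Poly_Mapping.single k 1) = y k}"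
        using k y(3) [OF k(2), of "GenT j"] by simp
    qed
    then have eq: "mscale X (lookup v k) (h' (Poly_Mapping.single k 1)) = mscale X (lookup v k) (y k)"
      if "k \<in> keys v" for k using v that by auto
    have "h' v = lext (mscale X) (\<lambda>k. h' (Poly_Mapping.single k 1)) v"
      using hom v by (intro lin_on_lext [OF X.vector_space_axioms]) (auto simp: gmod_hom_def)
    also have "\<dots> = lext (mscale X) y v"
      unfolding lext_def by (rule sum.cong [OF refl eq])
    finally show "h' v = lext (mscale X) y v" .
  qed
qed
  with conv P show ?thesis unfolding is_convolution_def by blast
qed

lemma conv_mod_generated:
  assumes "2 \<le> length \<nu>" "(if rv then length \<nu> - 1 else 0) \<in> S"
    and step: "\<And>j k k'. k \<in> S \<Longrightarrow> k \<in> {..<length \<nu>} \<Longrightarrow> chain_op \<nu> (\<not> rv) rv (GenT j) k = Some k' \<Longrightarrow> k' \<in> S"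
  shows "{..<length \<nu>} \<subseteq> S"
proof -
  have up: "k \<in> S" if "\<not> rv" "k < length \<nu>" for k
    using that(2)
  proof (induction k)
    case (Suc k)
    then show ?case using step [of k "Suc k" "Suc k"] that(1) by simp
  qed (use assms(2) that(1) in simp)
  have down: "length \<nu> - Suc k \<in> S" if rv "k < length \<nu>" for k
    using that(2)
  proof (induction k)
    case (Suc k)
    then show ?case using step [of "length \<nu> - Suc k" "length \<nu> - Suc k" "length \<nu> - Suc (Suc k)"] that(1) by simp
  qed (use assms(2) that(1) in simp)
  show ?thesis
  proof
    fix k assume "k \<in> {..<length \<nu>}"
    then show "k \<in> S" using up [of k] down [of "length \<nu> - Suc k"] by (cases rv) auto
  qed
qed

lemma conv_mod_is_convolution:
  assumes "path \<nu>" "2 \<le> length \<nu>"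
    and "\<mu>1 = (if rv then tl \<nu> else [hd \<nu>])" "\<mu>2 = (if rv then [hd \<nu>] else tl \<nu>)"
  shows "is_convolution (mset \<mu>1) (mset \<mu>2) (line_mod \<mu>1) (line_mod \<mu>2) (conv_mod rv \<nu> :: 'k::field_char_0 rmod)"
proof -
  define n where "n = length \<nu>"
  obtain c W where \<nu>: "\<nu> = c # W" "W \<noteq> []" using assms(2) by (cases \<nu>; cases "tl \<nu>") auto
  define i where "i = (if rv then n - 1 else 0)"
  have mset: "mset \<mu>1 + mset \<mu>2 = mset \<nu>" using assms(3,4) \<nu> by auto
  have word: "insert_word \<nu> i = \<mu>1 @ \<mu>2"
    using \<nu> by (auto simp: assms(3,4) insert_word_def i_def n_def)
  show ?thesis
    unfolding conv_mod_def
  proof (rule bmod_convolution)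
    show "is_gmod (mset \<mu>1 + mset \<mu>2) (bmod (chain_op \<nu> (\<not> rv) rv) {..<length \<nu>}
        (\<lambda>k. if rv then of_bool (k = 0) else of_bool (k \<noteq> 0)) :: 'k rmod)"
      using conv_is_gmod [OF assms(1), of rv] by (simp only: mset conv_mod_def)
    show "distinct (\<mu>1 @ \<mu>2)"
      using path_distinct [OF assms(1)] mset by (metis mset_append mset_eq_imp_distinct_iff)
    show "\<mu>1 \<noteq> []" "\<mu>2 \<noteq> []" using \<nu> by (auto simp: assms(3,4))
    show "i \<in> {..<length \<nu>}" "(if rv then of_bool (i = 0) else of_bool (i \<noteq> 0)) = (0::int)"
      using assms(2) by (auto simp: i_def n_def)
    show "chain_op \<nu> (\<not> rv) rv (GenE \<mu>) i = (if \<mu> = \<mu>1 @ \<mu>2 then Some i else None)" for \<mu>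
      by (simp add: word)
    show "chain_op \<nu> (\<not> rv) rv (GenX l) i = None" for l by simp
    show "chain_op \<nu> (\<not> rv) rv (GenT l) i = None" if "l \<noteq> length \<mu>1" for l
      using that \<nu> by (auto simp: i_def n_def assms(3))
    show "{..<length \<nu>} \<subseteq> S" if "i \<in> S"
      "\<And>j k k'. k \<in> S \<Longrightarrow> k \<in> {..<length \<nu>} \<Longrightarrow> chain_op \<nu> (\<not> rv) rv (GenT j) k = Some k' \<Longrightarrow> k' \<in> S" for S
      using conv_mod_generated [OF assms(2), of rv S] that by (simp only: i_def n_def)
    fix X :: "'k rmod" and y0
    assume X: "is_gmod (mset \<mu>1 + mset \<mu>2) X" "y0 \<in> mdeg X 0" "mE X (\<mu>1 @ \<mu>2) y0 = y0"
      "\<And>l. mX X l y0 = 0" "\<And>l. l \<noteq> length \<mu>1 \<Longrightarrow> mT X l y0 = 0"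
    have g1: "length \<mu>1 = (if rv then length \<nu> - 1 else 1)" by (simp add: assms(3))
    interpret chain_target \<nu> X rv y0 n "\<lambda>k. if rv then n - 1 - k else k" "\<lambda>k. if rv then n - k else k"
    proof (unfold_locales, goal_cases)
      case 1 show ?case using assms(1) .
    next
      case 2 show ?case using assms(2) by (simp add: n_def)
    next
      case 3 show ?case using X(1) by (simp only: mset)
    next
      case 4 show ?case by (rule X(2))
    next
      case 5 show ?case using X(3) by (simp only: word [symmetric] i_def n_def minus_nat.diff_0)
    next
      case 6 show ?case by (rule X(4))
    next
      case 7 then show ?case using X(5) g1 by (simp add: n_def)
    qed (simp_all add: n_def fun_eq_iff)
    let ?y = "\<lambda>k. y (if rv then n - 1 - k else k)"
    show "\<exists>y. y i = y0 \<and>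
       (\<forall>k\<in>{..<length \<nu>}. y k \<in> mdeg X (if rv then of_bool (k = 0) else of_bool (k \<noteq> 0))) \<and>
       (\<forall>k\<in>{..<length \<nu>}. \<forall>h. mgen X h (y k) = (case chain_op \<nu> (\<not> rv) rv h k of None \<Rightarrow> 0 | Some k' \<Rightarrow> y k'))"
    proof (intro exI [of _ ?y] conjI ballI allI)
      have "(if rv then n - 1 - i else i) = 0" by (simp add: i_def)
      then show "?y i = y0" by (simp only: y_simps(1))
      fix k assume "k \<in> {..<length \<nu>}"
      then have k: "k < n" by (simp add: n_def)
      show "?y k \<in> mdeg X (if rv then of_bool (k = 0) else of_bool (k \<noteq> 0))"
        using y_deg [OF pos_less [OF k]] by (simp only: pos_pos [OF k])
      show "mgen X h (?y k) = (case chain_op \<nu> (\<not> rv) rv h k of None \<Rightarrow> 0 | Some k' \<Rightarrow> ?y k')" for h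
        by (rule chain_images [OF k])
    qed
  qed
qed

section \<open>Products of characters\<close>

lemma qq_power: "qq ^ n = Fraction_Field.Fract (monom 1 n) 1"
proof (induction n)
  case 0
  then show ?case by (simp add: One_fract_def)
next
  case (Suc n)
  have "[:0, 1:] * monom 1 n = (monom 1 (Suc n) :: rat poly)"
    by (simp add: monom_Suc)
  with Suc show ?case by (simp add: qq_def)
qed

lemma qq_power_eq_1: "qq ^ n = 1 \<longleftrightarrow> n = 0"
proof
  assume "qq ^ n = 1"
  then have "monom (1::rat) n = 1" by (simp add: qq_power One_fract_def eq_fract)
  then have "Polynomial.degree (monom (1::rat) n) = Polynomial.degree (1 :: rat poly)" by (rule arg_cong)
  then show "n = 0" by (simp add: degree_monom_eq)
qed simp

lemma qq_nonzero [simp]: "qq \<noteq> 0"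
  by (simp add: qq_def Zero_fract_def eq_fract)

lemma qq_powi_eq_1: "qq powi k = 1 \<longleftrightarrow> k = 0"
proof -
  have "qq powi k = 1 \<longleftrightarrow> qq ^ nat \<bar>k\<bar> = 1"
    by (cases "k \<ge> 0") (auto simp: power_int_def power_inverse inverse_eq_1_iff)
  then show ?thesis by (simp add: qq_power_eq_1)
qed

text \<open>The numerators differ by (q^a - q^b) (1 + q^(-a-b)). Since q is not a root of unity, the
  first factor vanishes only for a = b. The second never does: q^(-a-b) = -1 gives 1 on squaring, so
  a + b = 0 and 1 = -1.\<close>

lemma qint_inj: "qint a = qint b \<Longrightarrow> a = b"
proof -
  assume "qint a = qint b"
  moreover have "qq - inverse qq \<noteq> 0"
  proof
    assume "qq - inverse qq = 0"
    then have "qq * qq = 1" by (metis eq_iff_diff_eq_0 qq_nonzero right_inverse)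
    then show False using qq_power_eq_1 [of 2] by (simp add: power2_eq_square)
  qed
  ultimately have eq: "qq powi a - qq powi (- a) = qq powi b - qq powi (- b)"
    by (simp add: qint_def)
  have "(qq powi a - qq powi b) * (1 + qq powi (- a - b))
      = (qq powi a - qq powi (- a)) - (qq powi b - qq powi (- b))"
    by (simp add: algebra_simps flip: power_int_add)
  then have "qq powi a = qq powi b \<or> 1 + qq powi (- a - b) = 0"
    using eq by simp
  then show "a = b"
  proof
    assume "qq powi a = qq powi b"
    then have "qq powi (a - b) = 1" by (simp add: power_int_diff)
    then show ?thesis by (simp add: qq_powi_eq_1)
  next
    assume "1 + qq powi (- a - b) = 0"
    then have m1: "qq powi (- a - b) = - 1" by (simp add: add_eq_0_iff)
    have "qq powi ((- a - b) + (- a - b)) = qq powi (- a - b) * qq powi (- a - b)"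
      by (rule power_int_add) simp
    then have "(- a - b) + (- a - b) = 0" by (simp add: m1 flip: qq_powi_eq_1)
    then have "- a - b = 0" by simp
    with m1 have "(1::qfield) = - 1" by simp
    then show ?thesis by simp
  qed
qed

lemma letters_zero [simp]: "letters 0 = []"
  by (simp add: zero_fword_def)

section \<open>Quantum shuffle coefficients\<close>

definition word_dual :: "int list \<Rightarrow> uq_free \<Rightarrow> qfield" where
  "word_dual w x = lookup x (FW w)"

lemma e_dual_word_dual: "e_dual i = word_dual [i]"
  by (simp add: fun_eq_iff e_dual_def word_dual_def)

definition coprod_coeff :: "int list \<Rightarrow> int list \<Rightarrow> int list \<Rightarrow> qfield" where
  "coprod_coeff w u v = lookup (coprod_word w) (FW u, FW v)"

lemma coprod_coeff_Nil: "coprod_coeff [] u v = of_bool (u = [] \<and> v = [])"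
  by (auto simp: coprod_coeff_def lookup_single when_def zero_fword_def)

text \<open>The first letter i goes to the left or to the right tensor leg. On the right leg it has
  to pass the whole left word u, which costs q to the power -(\<alpha>_i, wt u).\<close>

lemma coprod_coeff_Cons:
  "coprod_coeff (i # w) u v =
    (if u \<noteq> [] \<and> hd u = i then coprod_coeff w (tl u) v else 0)
    + (if v \<noteq> [] \<and> hd v = i then qq powi (- pairing (alpha i) (qwt (mset u))) * coprod_coeff w u (tl v) else 0)"
proof -
  let ?B = "coprod_word w"
  let ?A = "Poly_Mapping.single (FW [i], 0) 1 + Poly_Mapping.single (0, FW [i]) 1 :: uq_tensor"
  have neq: "(FW [i], 0) \<noteq> (0, FW [i])" by (simp add: zero_fword_def)
  have A: "lookup ?A z = of_bool (z = (FW [i], 0)) + of_bool (z = (0, FW [i]))" for z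
    by (simp add: lookup_add lookup_single when_def)
  have keysA: "keys ?A = {(FW [i], 0), (0, FW [i])}"
    using neq by (auto simp: in_keys_iff A)
  define t where "t x1 x2 y1 y2 = lookup (Poly_Mapping.single (x1 + y1, x2 + y2)
       (qq powi (- pairing (qwt (mset (letters x2))) (qwt (mset (letters y1))))
        * lookup ?A (x1, x2) * lookup ?B (y1, y2))) (FW u, FW v)" for x1 x2 y1 y2
  have "coprod_coeff (i # w) u v = (\<Sum>(x1, x2)\<in>keys ?A. \<Sum>(y1, y2)\<in>keys ?B. t x1 x2 y1 y2)"
    by (simp add: coprod_coeff_def twisted_mult_def lookup_sum case_prod_unfold t_def)
  also have "\<dots> = (\<Sum>(y1, y2)\<in>keys ?B. t (FW [i]) 0 y1 y2) + (\<Sum>(y1, y2)\<in>keys ?B. t 0 (FW [i]) y1 y2)"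
    unfolding keysA using neq by simp
  also have "(\<Sum>(y1, y2)\<in>keys ?B. t (FW [i]) 0 y1 y2)
      = (if u \<noteq> [] \<and> hd u = i then coprod_coeff w (tl u) v else 0)"
  proof -
    have "(\<Sum>(y1, y2)\<in>keys ?B. t (FW [i]) 0 y1 y2)
        = (\<Sum>y\<in>keys ?B. if y = (FW (tl u), FW v) then if u \<noteq> [] \<and> hd u = i then coprod_coeff w (tl u) v else 0 else 0)"
    proof (rule sum.cong [OF refl], clarify)
      fix y1 y2 :: "int fword"
      have "(FW [i] + y1, 0 + y2) = (FW u, FW v) \<longleftrightarrow> (y1, y2) = (FW (tl u), FW v) \<and> u \<noteq> [] \<and> hd u = i"
        by (cases y1; cases u) (auto simp: plus_fword_def)
      then show "t (FW [i]) 0 y1 y2 = (if (y1, y2) = (FW (tl u), FW v)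
          then if u \<noteq> [] \<and> hd u = i then coprod_coeff w (tl u) v else 0 else 0)"
        using neq by (simp add: t_def lookup_single when_def A coprod_coeff_def)
          (simp add: zero_fword_def pairing_zero_left)
    qed
    also have "\<dots> = (if u \<noteq> [] \<and> hd u = i then coprod_coeff w (tl u) v else 0)"
      by (simp add: sum.delta) (auto simp: coprod_coeff_def in_keys_iff)
    finally show ?thesis .
  qed
  also have "(\<Sum>(y1, y2)\<in>keys ?B. t 0 (FW [i]) y1 y2)
      = (if v \<noteq> [] \<and> hd v = i then qq powi (- pairing (alpha i) (qwt (mset u))) * coprod_coeff w u (tl v) else 0)"
  proof -
    let ?r = "if v \<noteq> [] \<and> hd v = i then qq powi (- pairing (alpha i) (qwt (mset u))) * coprod_coeff w u (tl v) else 0"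
    have "(\<Sum>(y1, y2)\<in>keys ?B. t 0 (FW [i]) y1 y2) = (\<Sum>y\<in>keys ?B. if y = (FW u, FW (tl v)) then ?r else 0)"
    proof (rule sum.cong [OF refl], clarify)
      fix y1 y2 :: "int fword"
      have "(0 + y1, FW [i] + y2) = (FW u, FW v) \<longleftrightarrow> (y1, y2) = (FW u, FW (tl v)) \<and> v \<noteq> [] \<and> hd v = i"
        by (cases y2; cases v) (auto simp: plus_fword_def)
      then show "t 0 (FW [i]) y1 y2 = (if (y1, y2) = (FW u, FW (tl v)) then ?r else 0)"
        using neq [symmetric] by (simp add: t_def lookup_single when_def A coprod_coeff_def)
    qed
    also have "\<dots> = ?r"
      by (simp add: sum.delta) (auto simp: coprod_coeff_def in_keys_iff)
    finally show ?thesis .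
  qed
  finally show ?thesis .
qed

lemma coprod_coeff_left: "coprod_coeff w u [] = of_bool (w = u)"
proof (induction w arbitrary: u)
  case (Cons i w)
  then show ?case by (cases u) (auto simp: coprod_coeff_Cons)
qed (auto simp: coprod_coeff_Nil)

lemma coprod_coeff_right: "coprod_coeff w [] v = of_bool (w = v)"
proof (induction w arbitrary: v)
  case (Cons i w)
  then show ?case by (cases v) (auto simp: coprod_coeff_Cons pairing_alpha)
qed (auto simp: coprod_coeff_Nil)

lemma lookup_qwt_mset: "lookup (qwt (mset w)) i = (\<Sum>j\<leftarrow>w. lookup (alpha j) i)"
  by (induction w) (auto simp: lookup_add)

text \<open>In the \<open>q\<close>-commutator all shuffles but \<open>W i\<close> cancel.\<close>

lemma coprod_coeff_commutator:
  assumes "W \<noteq> []" "\<bar>last W - i\<bar> = 1" "\<And>j. j \<in> set (butlast W) \<Longrightarrow> \<bar>j - i\<bar> > 1"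
  shows "coprod_coeff w W [i] - qq * coprod_coeff w [i] W = (1 - qq * qq) * of_bool (w = W @ [i])"
  using assms
proof (induction w arbitrary: W)
  case Nil
  then show ?case by (simp add: coprod_coeff_Nil)
next
  case (Cons k w)
  obtain j U where W: "W = j # U" using Cons.prems(1) by (cases W) auto
  have ij: "i \<noteq> j" using Cons.prems(2) Cons.prems(3) [of j] by (cases "U = []") (auto simp: W)
  \<comment> \<open>Only the last letter of W is adjacent to i, so moving i past all of W gives the
    factor q.\<close>
  have "lookup (qwt (mset W)) i = -1"
  proof -
    have "(\<Sum>j\<leftarrow>butlast W. lookup (alpha j) i) = (\<Sum>j\<leftarrow>butlast W. 0)"
      using Cons.prems(3) by (intro arg_cong [of _ _ sum_list] map_cong) (force simp: lookup_alpha)+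
    moreover have "(\<Sum>j\<leftarrow>W. lookup (alpha j) i) = (\<Sum>j\<leftarrow>butlast W @ [last W]. lookup (alpha j) i)"
      by (simp only: append_butlast_last_id [OF Cons.prems(1)])
    moreover have "lookup (alpha (last W)) i = -1"
      using Cons.prems(2) by (auto simp: lookup_alpha abs_minus_commute)
    ultimately show ?thesis
      by (simp add: lookup_qwt_mset del: append_butlast_last_id)
  qed
  then have F: "coprod_coeff (k # w) W [i] = (if k = j then coprod_coeff w U [i] else 0)
      + (if k = i then qq * of_bool (w = W) else 0)"
    by (auto simp: coprod_coeff_Cons W coprod_coeff_left pairing_alpha)
  have G: "coprod_coeff (k # w) [i] W = (if k = i then of_bool (w = W) else 0)
      + (if k = j then qq powi (- lookup (alpha i) j) * coprod_coeff w [i] U else 0)"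
    by (auto simp: coprod_coeff_Cons W coprod_coeff_right pairing_alpha)
  \<comment> \<open>The terms with k = i cancel. Those with k = j recurse on U, with trivial factor
    since j is not adjacent to i, until U is empty; there the factor q of the adjacent letter
    produces 1 - q^2.\<close>
  show ?case
  proof (cases "U = []")
    case True
    then have "\<bar>j - i\<bar> = 1" using Cons.prems(2) by (simp add: W)
    then show ?thesis
      unfolding F G using True ij
      by (auto simp: W lookup_alpha coprod_coeff_left coprod_coeff_right algebra_simps)
  next
    case False
    have "coprod_coeff w U [i] - qq * coprod_coeff w [i] U = (1 - qq * qq) * of_bool (w = U @ [i])"
      using Cons.prems False by (intro Cons.IH) (auto simp: W)
    moreover have "lookup (alpha i) j = 0"
      using Cons.prems(3) [of j] ij False by (auto simp: W lookup_alpha)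
    ultimately show ?thesis
      unfolding F G using ij by (auto simp: W algebra_simps)
  qed
qed

text \<open>The second factor of a product is evaluated on the left tensor leg, so u and v change
  places. This is the source of the reversed word in the character.\<close>

lemma Aqn_mult_word_dual:
  "Aqn_mult (word_dual v) (word_dual u) x = (\<Sum>w\<in>keys x. lookup x w * coprod_coeff (letters w) u v)"
  unfolding Aqn_mult_def
proof (rule sum.cong [OF refl])
  fix w
  let ?C = "coprod_word (letters w)"
  have "(\<Sum>(a, b)\<in>keys ?C. lookup ?C (a, b) * word_dual u (word (letters a)) * word_dual v (word (letters b)))
      = (\<Sum>y\<in>keys ?C. if y = (FW u, FW v) then coprod_coeff (letters w) u v else 0)"
  proof (rule sum.cong [OF refl], clarify)
    fix a b :: "int fword"
    show "lookup ?C (a, b) * word_dual u (word (letters a)) * word_dual v (word (letters b))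
        = (if (a, b) = (FW u, FW v) then coprod_coeff (letters w) u v else 0)"
      by (cases a; cases b) (auto simp: word_dual_def word_def lookup_single when_def coprod_coeff_def)
  qed
  also have "\<dots> = coprod_coeff (letters w) u v"
    by (simp add: sum.delta) (auto simp: coprod_coeff_def in_keys_iff)
  finally show "lookup x w * (\<Sum>(a, b)\<in>keys ?C. lookup ?C (a, b) * word_dual u (word (letters a)) * word_dual v (word (letters b)))
      = lookup x w * coprod_coeff (letters w) u v" by simp
qed

section \<open>Characters of one-dimensional modules\<close>

text \<open>\<open>ch\<close> is additive only on \<open>groth_free\<close>, so each combination
  that occurs is placed there before the relation is used.\<close>

lemma ch_ses:
  assumes "is_ch ch" "is_gmod \<beta> M'" "is_gmod \<beta> M" "is_gmod \<beta> M''" "is_ses M' M M''"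
  shows "ch (gcls M) = ch (gcls M') + ch (gcls M'')"
proof -
  have free: "gcls N \<in> groth_free" if "is_gmod \<beta> N" for N
    unfolding groth_free_def using that by (intro group_closure.base) blast
  have add: "ch (y + z) = ch y + ch z" if "y \<in> groth_free" "z \<in> groth_free" for y z
    using assms(1) that by (simp add: is_ch_def)
  let ?z = "gcls M - gcls M' - gcls M''"
  have "?z \<in> groth_free" unfolding groth_free_def
    using free [OF assms(2)] free [OF assms(3)] free [OF assms(4)]
    by (intro group_closure.diff) (simp_all add: groth_free_def)
  moreover have "?z \<in> groth_relations"
    unfolding groth_relations_def using assms(2-5) by (intro group_closure.base) blast
  ultimately have z: "?z \<in> groth_free" "ch ?z = 0" using assms(1) by (auto simp: is_ch_def)
  have sum: "gcls M' + gcls M'' \<in> groth_free"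
    using free [OF assms(2)] free [OF assms(4)] by (simp add: groth_free_def group_closure_add)
  have "gcls M = ?z + (gcls M' + gcls M'')" by simp
  then have "ch (gcls M) = ch ?z + ch (gcls M' + gcls M'')" using add [OF z(1) sum] by simp
  then show ?thesis using z(2) add [OF free [OF assms(2)] free [OF assms(4)]] by simp
qed

lemma line_mod_iso:
  assumes "\<nu> \<noteq> []"
  shows "line_mod \<nu> \<cong>\<^sub>g (one_dim \<nu> :: ('k::field_char_0, 'k) gmod)"
  unfolding gmod_iso_def
proof (intro exI conjI)
  let ?f = "\<lambda>m. lookup m 0 :: 'k"
  show "gmod_hom (line_mod \<nu>) (one_dim \<nu>) ?f"
    unfolding gmod_hom_def
  proof (intro conjI allI ballI)
    show "lin_on (mscale (line_mod \<nu>)) (mscale (one_dim \<nu>)) (mcar (line_mod \<nu>)) ?f"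
      by (simp add: lin_on_def line_mod_simps one_dim_def lookup_add)
    show "?f (mgen (line_mod \<nu>) g m) = mgen (one_dim \<nu>) g (?f m)" if "m \<in> mcar (line_mod \<nu>)" for g m
      using that line_mod_gen [of m \<nu>] assms by (cases g) (auto simp: line_mod_simps(1) one_dim_def)
    show "?f ` mdeg (line_mod \<nu>) d \<subseteq> mdeg (one_dim \<nu>) d" for d
      by (auto simp: line_mod_simps one_dim_def)
  qed (simp add: one_dim_def)
  show "bij_betw ?f (mcar (line_mod \<nu>)) (mcar (one_dim \<nu>))"
  proof (rule bij_betw_byWitness [where f' = "Poly_Mapping.single 0"])
    show "\<forall>m\<in>mcar (line_mod \<nu>). Poly_Mapping.single 0 (?f m) = m"
      by (simp add: line_mod_simps keys_subset_singleton)
  qed (auto simp: line_mod_simps one_dim_def split: if_splits)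
qed

lemma ch_line_mod:
  fixes ch :: "('k::field_char_0 rmod \<Rightarrow>\<^sub>0 int) \<Rightarrow> uq_free \<Rightarrow> qfield"
  assumes ch: "is_ch ch" and "path \<nu>" "\<nu> \<noteq> []"
  shows "ch (gcls (line_mod \<nu>)) = word_dual (rev \<nu>)"
  using assms(2,3)
proof (induction \<nu>)
  case (Cons c W)
  have shift: "ch (gcls (qshift M)) x = qq * ch (gcls M) x" if "is_gmod \<beta> M" for \<beta> M x
    using ch that by (simp add: is_ch_def)
  have base: "ch (gcls (line_mod [i])) = word_dual [i]" for i
  proof -
    have "is_gmod {#i#} (line_mod [i] :: 'k rmod)"
      using line_is_gmod [of "[i]"] by (simp add: path_def)
    then show ?thesis
      using ch line_mod_iso [of "[i]"] by (auto simp: is_ch_def L1_def e_dual_word_dual)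
  qed
  show ?case
  proof (cases "W = []")
    case True
    then show ?thesis using base by simp
  next
    case False
    let ?\<nu> = "c # W"
    have path: "path ?\<nu>" "path W" using Cons.prems(1) path_tl [of ?\<nu>] by simp_all
    have two: "2 \<le> length ?\<nu>" using False by (cases W) auto
    have IH: "ch (gcls (line_mod W)) = word_dual (rev W)" by (rule Cons.IH [OF path(2) False])
    have singleton: "path [c]" by (simp add: path_def)
    have conv: "ch (gcls (conv_mod rv ?\<nu>)) = (if rv then Aqn_mult (word_dual (rev W)) (word_dual [c])
        else Aqn_mult (word_dual [c]) (word_dual (rev W)))" for rv
    proof -
      have W: "is_gmod (mset W) (line_mod W :: 'k rmod)" and c: "is_gmod (mset [c]) (line_mod [c] :: 'k rmod)"
        using line_is_gmod [OF path(2) False] line_is_gmod [OF singleton] by simp_all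
      have mult: "ch (gcls P) = Aqn_mult (ch (gcls M)) (ch (gcls N))"
        if "is_gmod \<beta> M" "is_gmod \<gamma> N" "is_convolution \<beta> \<gamma> M N P" for \<beta> \<gamma> and M N P :: "'k rmod"
      proof -
        have "\<forall>\<beta> \<gamma> M N P. is_gmod \<beta> M \<and> is_gmod \<gamma> N \<and> is_convolution \<beta> \<gamma> M N P \<longrightarrow>
            ch (gcls P) = Aqn_mult (ch (gcls M)) (ch (gcls N))"
          using ch unfolding is_ch_def by (elim conjE)
        with that show ?thesis by blast
      qed
      show ?thesis
      proof (cases rv)
        case True
        have "is_convolution (mset W) (mset [c]) (line_mod W) (line_mod [c]) (conv_mod True ?\<nu> :: 'k rmod)"
          by (rule conv_mod_is_convolution [OF path(1) two]) simp_all
        from mult [OF W c this] show ?thesis using True IH base [of c] by simp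
      next
        case False
        have "is_convolution (mset [c]) (mset W) (line_mod [c]) (line_mod W) (conv_mod False ?\<nu> :: 'k rmod)"
          by (rule conv_mod_is_convolution [OF path(1) two]) simp_all
        from mult [OF c W this] show ?thesis using False IH base [of c] by simp
      qed
    qed
    have left: "ch (gcls (conv_mod False ?\<nu>)) = ch (gcls (qshift (rest_mod ?\<nu>))) + ch (gcls (line_mod ?\<nu>))"
      by (rule ch_ses [OF ch qshift_rest_is_gmod [OF path(1)] conv_is_gmod [OF path(1)]
            line_is_gmod [OF path(1)] ses_conv_left [OF path(1) two]]) simp
    have right: "ch (gcls (conv_mod True ?\<nu>)) = ch (gcls (qshift (line_mod ?\<nu>))) + ch (gcls (rest_mod ?\<nu>))"
      by (rule ch_ses [OF ch qshift_line_is_gmod [OF path(1)] conv_is_gmod [OF path(1)]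
            rest_is_gmod [OF path(1)] ses_conv_right [OF path(1) two]]) simp
    \<comment> \<open>The word W enters reversed, so its last letter is the neighbour of c, and all
      other letters are at distance at least 2 from c.\<close>
    have comm: "coprod_coeff w (rev W) [c] - qq * coprod_coeff w [c] (rev W) = (1 - qq * qq) * of_bool (w = rev ?\<nu>)" for w
    proof -
      have adj: "\<bar>W ! k - c\<bar> = int (Suc k)" if "k < length W" for k
        using pathD [OF path(1), of "Suc k" 0] that by simp
      have "\<bar>j - c\<bar> > 1" if "j \<in> set (butlast (rev W))" for j
      proof -
        have "j \<in> set (tl W)" using that by (simp add: butlast_rev)
        then obtain k where "k < length (tl W)" "j = tl W ! k" by (auto simp: in_set_conv_nth)
        then show ?thesis using adj [of "Suc k"] by (simp add: nth_tl)
      qed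
      moreover have "\<bar>last (rev W) - c\<bar> = 1"
        using adj [of 0] False by (simp add: last_rev hd_conv_nth)
      ultimately show ?thesis using coprod_coeff_commutator [of "rev W" c w] False by simp
    qed
    show ?thesis
    proof
      fix x
      \<comment> \<open>The unknown class of K has coefficient q in the first sequence and 1 in the
        second, so it drops out of this combination.\<close>
      have "(1 - qq * qq) * ch (gcls (line_mod ?\<nu>)) x
          = ch (gcls (conv_mod False ?\<nu>)) x - qq * ch (gcls (conv_mod True ?\<nu>)) x"
        unfolding left right using shift [OF rest_is_gmod [OF path(1)]] shift [OF line_is_gmod [OF path(1)]]
        by (simp add: algebra_simps)
      also have "\<dots> = (\<Sum>w\<in>keys x. lookup x w * (coprod_coeff (letters w) (rev W) [c] - qq * coprod_coeff (letters w) [c] (rev W)))"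
        by (simp add: conv Aqn_mult_word_dual right_diff_distrib sum_subtractf sum_distrib_left mult.left_commute)
      also have "\<dots> = (\<Sum>w\<in>keys x. if w = FW (rev ?\<nu>) then (1 - qq * qq) * lookup x w else 0)"
      proof (rule sum.cong [OF refl])
        fix w :: "int fword"
        have "letters w = rev ?\<nu> \<longleftrightarrow> w = FW (rev ?\<nu>)" by (cases w) auto
        then show "lookup x w * (coprod_coeff (letters w) (rev W) [c] - qq * coprod_coeff (letters w) [c] (rev W))
            = (if w = FW (rev ?\<nu>) then (1 - qq * qq) * lookup x w else 0)"
          unfolding comm by simp
      qed
      also have "\<dots> = (1 - qq * qq) * word_dual (rev ?\<nu>) x"
        by (simp add: sum.delta word_dual_def in_keys_iff)
      finally show "ch (gcls (line_mod ?\<nu>)) x = word_dual (rev ?\<nu>) x"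
        using qq_power_eq_1 [of 2] by (simp add: power2_eq_square)
    qed
  qed
qed simp

section \<open>Dimension counts in exact sequences\<close>

context vector_space_pair
begin

text \<open>Dimension theory uses maps that are linear on the whole type, whereas module
  homomorphisms are controlled on the carrier only.\<close>

lemma lin_on_extend:
  assumes "vs1.subspace U" "lin_on s1 s2 U f"
  obtains F where "Vector_Spaces.linear s1 s2 F" "\<And>v. v \<in> U \<Longrightarrow> F v = f v"
proof -
  obtain B where B: "B \<subseteq> U" "vs1.independent B" "U \<subseteq> vs1.span B" by (rule vs1.basis_exists)
  let ?F = "construct B f"
  have lin: "Vector_Spaces.linear s1 s2 ?F" by (rule linear_construct [OF B(2)])
  have f0: "f 0 = 0"
    using assms vs1.subspace_0 [OF assms(1)] unfolding lin_on_def
    by (metis vs1.scale_zero_left vs2.scale_zero_left)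
  have "v \<in> {v \<in> U. ?F v = f v}" if "v \<in> U" for v
  proof -
    have "vs1.span B \<subseteq> {v \<in> U. ?F v = f v}"
    proof (rule vs1.span_minimal)
      show "B \<subseteq> {v \<in> U. ?F v = f v}" using B construct_basis [OF B(2)] by auto
      show "vs1.subspace {v \<in> U. ?F v = f v}"
        using assms linear_add [OF lin] linear_scale [OF lin] linear_0 [OF lin] f0
        by (simp add: vs1.subspace_def lin_on_def)
    qed
    with that B(3) show ?thesis by blast
  qed
  with lin show thesis by (intro that [of ?F]) auto
qed

lemma dim_injective_image:
  assumes "Vector_Spaces.linear s1 s2 F" "vs1.subspace U" "inj_on F U"
  shows "vs2.dim (F ` U) = vs1.dim U"
proof -
  obtain B where B: "B \<subseteq> U" "vs1.independent B" "U \<subseteq> vs1.span B" "card B = vs1.dim U"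
    by (rule vs1.basis_exists)
  have span: "vs1.span B = U" using B assms(2) by (simp add: vs1.span_minimal subset_antisym)
  have "vs2.independent (F ` B)"
    using assms B span by (intro linear_independent_injective_image) auto
  moreover have "F ` U \<subseteq> vs2.span (F ` B)" by (simp add: linear_span_image [OF assms(1)] span)
  ultimately have "card (F ` B) = vs2.dim (F ` U)"
    using B(1) by (intro vs2.basis_card_eq_dim) auto
  moreover have "card (F ` B) = card B"
    using assms(3) B(1) by (intro card_image) (rule inj_on_subset)
  ultimately show ?thesis using B(4) by simp
qed

text \<open>Rank and nullity for a subspace inside a finite span, the ambient space being possibly
  infinite-dimensional. A basis A of the kernel is extended to a basis B of U, and G is injective on
  the span of B - A.\<close>

lemma dim_kernel_image:
  assumes "Vector_Spaces.linear s1 s2 G" "vs1.subspace U" "finite S" "U \<subseteq> vs1.span S"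
  shows "vs1.dim U = vs1.dim {v \<in> U. G v = 0} + vs2.dim (G ` U)"
proof -
  let ?K = "{v \<in> U. G v = 0}"
  have subK: "vs1.subspace ?K"
    using assms(2) linear_add [OF assms(1)] linear_scale [OF assms(1)] linear_0 [OF assms(1)]
    by (simp add: vs1.subspace_def)
  obtain A where A: "A \<subseteq> ?K" "vs1.independent A" "?K \<subseteq> vs1.span A" "card A = vs1.dim ?K"
    by (rule vs1.basis_exists)
  have spanA: "vs1.span A = ?K" using A subK by (simp add: vs1.span_minimal subset_antisym)
  obtain B where B: "A \<subseteq> B" "B \<subseteq> U" "vs1.independent B" "U \<subseteq> vs1.span B"
    using A(1,2) vs1.maximal_independent_subset_extend [of A U] by blast
  have fin: "finite B" using vs1.independent_span_bound [OF assms(3) B(3)] B(2) assms(4) by blast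
  have spanB: "vs1.span B = U" using B assms(2) by (simp add: vs1.span_minimal subset_antisym)
  let ?C = "B - A"
  have indC: "vs1.independent ?C" using B(3) by (rule vs1.independent_mono) blast
  \<comment> \<open>A vector common to the two spans has its coordinates in B supported both on A
    and on B - A.\<close>
  have trivial: "x = 0" if "x \<in> vs1.span A" "x \<in> vs1.span ?C" for x
  proof -
    have "vs1.representation B x = vs1.representation A x" "vs1.representation B x = vs1.representation ?C x"
      using that B(1,3) by (auto intro!: vs1.representation_extend)
    then have "vs1.representation B x b = 0" for b
      using vs1.representation_ne_zero [of A x b] vs1.representation_ne_zero [of ?C x b] by auto
    moreover have "x \<in> vs1.span B" using that(1) B(1) vs1.span_mono by blast
    ultimately show ?thesis using vs1.sum_nonzero_representation_eq [OF B(3), of x] by simp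
  qed
  have inj: "inj_on G (vs1.span ?C)"
  proof (subst linear_inj_on_iff_eq_0 [OF assms(1) vs1.subspace_span], intro ballI impI)
    fix x assume x: "x \<in> vs1.span ?C" "G x = 0"
    then have "x \<in> ?K" using spanB vs1.span_mono [of ?C B] by blast
    with x(1) spanA show "x = 0" by (intro trivial) auto
  qed
  have "vs2.independent (G ` ?C)"
    by (rule linear_independent_injective_image [OF assms(1) indC inj])
  moreover have "G ` U \<subseteq> vs2.span (G ` ?C)"
  proof -
    have "G ` U = vs2.span (G ` B)" by (simp add: linear_span_image [OF assms(1)] spanB)
    also have "\<dots> \<subseteq> vs2.span (insert 0 (G ` ?C))" using A(1) by (intro vs2.span_mono) auto
    finally show ?thesis by simp
  qed
  moreover have "G ` ?C \<subseteq> G ` U" using B(2) by blast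
  ultimately have "card (G ` ?C) = vs2.dim (G ` U)" by (intro vs2.basis_card_eq_dim)
  moreover have "card (G ` ?C) = card ?C"
    using inj by (intro card_image inj_on_subset [OF inj] vs1.span_superset)
  moreover have "card B = card A + card ?C"
    using fin B(1) by (metis card_Diff_subset card_mono finite_subset le_add_diff_inverse)
  moreover have "card B = vs1.dim U" using B by (intro vs1.basis_card_eq_dim)
  ultimately show ?thesis using A(4) by simp
qed

end

lemma gmod_car_subspace: "is_gmod \<beta> M \<Longrightarrow> module.subspace (mscale M) (mcar M)"
  using free_action.subspace_U [OF gmod_free_action] .

text \<open>Formulated for subspaces, so that it serves both for entire modules and for their
  e(\<nu>) parts.\<close>

lemma exact_dim:
  fixes M' M M'' :: "('k::field_char_0, 'v::ab_group_add) gmod"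
  assumes M: "is_gmod \<beta>' M'" "is_gmod \<beta> M" "is_gmod \<beta>'' M''"
    and sub: "module.subspace (mscale M') U'" "module.subspace (mscale M) U"
    and "U' \<subseteq> mcar M'" "U \<subseteq> mcar M"
    and f: "lin_on (mscale M') (mscale M) (mcar M') f" "inj_on f (mcar M')" "f ` U' = {v \<in> U. g v = 0}"
    and g: "lin_on (mscale M) (mscale M'') (mcar M) g" "g ` U = U''"
  shows "vector_space.dim (mscale M) U = vector_space.dim (mscale M') U' + vector_space.dim (mscale M'') U''"
proof -
  interpret a: vector_space_pair "mscale M'" "mscale M"
    by (rule vector_space_pair.intro [OF gmod_vector_space [OF M(1)] gmod_vector_space [OF M(2)]])
  interpret b: vector_space_pair "mscale M" "mscale M''"
    by (rule vector_space_pair.intro [OF gmod_vector_space [OF M(2)] gmod_vector_space [OF M(3)]])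
  obtain S where S: "finite S" "mcar M = a.vs2.span S" using gmod_span [OF M(2)] by blast
  have "lin_on (mscale M') (mscale M) U' f" "lin_on (mscale M) (mscale M'') U g"
    using f(1) g(1) assms(6,7) by (auto simp: lin_on_def subset_iff)
  then obtain F G where F: "Vector_Spaces.linear (mscale M') (mscale M) F" "\<And>v. v \<in> U' \<Longrightarrow> F v = f v"
    and G: "Vector_Spaces.linear (mscale M) (mscale M'') G" "\<And>v. v \<in> U \<Longrightarrow> G v = g v"
    using a.lin_on_extend [OF sub(1)] b.lin_on_extend [OF sub(2)] by metis
  have "inj_on F U'" using inj_on_subset [OF f(2) assms(6)] F(2) by (simp add: inj_on_def)
  then have "a.vs2.dim (F ` U') = a.vs1.dim U'" by (rule a.dim_injective_image [OF F(1) sub(1)])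
  moreover have "F ` U' = {v \<in> U. G v = 0}"
  proof -
    have "F ` U' = f ` U'" by (rule image_cong [OF refl F(2)])
    also have "\<dots> = {v \<in> U. G v = 0}" unfolding f(3) using G(2) by force
    finally show ?thesis .
  qed
  moreover have "G ` U = U''" unfolding g(2) [symmetric] by (rule image_cong [OF refl G(2)])
  ultimately show ?thesis
    using b.dim_kernel_image [OF G(1) sub(2) S(1)] assms(7) S(2) by simp
qed

definition e_space :: "int list \<Rightarrow> ('k, 'v::ab_group_add) gmod \<Rightarrow> 'v set" where
  "e_space \<nu> M = {v \<in> mcar M. mE M \<nu> v = v}"

lemma e_space_subspace:
  assumes "is_gmod \<beta> M"
  shows "module.subspace (mscale M) (e_space \<nu> M)"
proof -
  interpret free_action "mscale M" "mgen M" "mcar M" by (rule gmod_free_action [OF assms])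
  show ?thesis
    using subspace_U by (auto simp: subspace_def e_space_def op_add op_scale op_zero)
qed

text \<open>e(\<nu>) is an idempotent that commutes with f and g, so passing to its image preserves
  exactness.\<close>

lemma ses_dim:
  fixes M' M M'' :: "('k::field_char_0, 'v::ab_group_add) gmod"
  assumes M: "is_gmod \<beta> M'" "is_gmod \<beta> M" "is_gmod \<beta> M''" and "is_ses M' M M''"
  shows "vector_space.dim (mscale M) (mcar M)
      = vector_space.dim (mscale M') (mcar M') + vector_space.dim (mscale M'') (mcar M'')"
    and "vector_space.dim (mscale M) (e_space \<nu> M)
      = vector_space.dim (mscale M') (e_space \<nu> M') + vector_space.dim (mscale M'') (e_space \<nu> M'')"
proof -
  obtain f g where fg: "gmod_hom M' M f" "gmod_hom M M'' g" "inj_on f (mcar M')" "g ` mcar M = mcar M''"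
      "f ` mcar M' = {v \<in> mcar M. g v = 0}"
    using assms(4) by (auto simp: is_ses_def)
  have lin: "lin_on (mscale M') (mscale M) (mcar M') f" "lin_on (mscale M) (mscale M'') (mcar M) g"
    and f_gen: "\<And>v h. v \<in> mcar M' \<Longrightarrow> f (mgen M' h v) = mgen M h (f v)"
    and g_gen: "\<And>v h. v \<in> mcar M \<Longrightarrow> g (mgen M h v) = mgen M'' h (g v)"
    using fg(1,2) by (auto simp: gmod_hom_def)
  show "vector_space.dim (mscale M) (mcar M)
      = vector_space.dim (mscale M') (mcar M') + vector_space.dim (mscale M'') (mcar M'')"
    by (rule exact_dim [OF M gmod_car_subspace [OF M(1)] gmod_car_subspace [OF M(2)] _ _ lin(1) fg(3,5) lin(2) fg(4)]) auto
  have "f ` e_space \<nu> M' = {v \<in> e_space \<nu> M. g v = 0}"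
  proof (intro set_eqI iffI)
    fix v assume "v \<in> f ` e_space \<nu> M'"
    then obtain v' where v': "v = f v'" "v' \<in> mcar M'" "mE M' \<nu> v' = v'" by (auto simp: e_space_def)
    then have "v \<in> {v \<in> mcar M. g v = 0}" using fg(5) by blast
    with v' f_gen [of v' "GenE \<nu>"] show "v \<in> {v \<in> e_space \<nu> M. g v = 0}" by (simp add: e_space_def)
  next
    fix v assume v: "v \<in> {v \<in> e_space \<nu> M. g v = 0}"
    then have "v \<in> f ` mcar M'" using fg(5) by (auto simp: e_space_def)
    then obtain v' where v': "v = f v'" "v' \<in> mcar M'" by blast
    then have "f (mE M' \<nu> v') = f v'" using v f_gen [of v' "GenE \<nu>"] by (simp add: e_space_def)
    then have "mE M' \<nu> v' = v'"
      using fg(3) v'(2) gmod_gen_closed [OF M(1) v'(2)] by (auto dest: inj_onD)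
    with v' show "v \<in> f ` e_space \<nu> M'" by (auto simp: e_space_def)
  qed
  moreover have "g ` e_space \<nu> M = e_space \<nu> M''"
  proof (intro set_eqI iffI)
    fix w assume "w \<in> g ` e_space \<nu> M"
    then obtain v where v: "w = g v" "v \<in> mcar M" "mE M \<nu> v = v" by (auto simp: e_space_def)
    then show "w \<in> e_space \<nu> M''" using fg(4) g_gen [of v "GenE \<nu>"] by (auto simp: e_space_def)
  next
    fix w assume w: "w \<in> e_space \<nu> M''"
    then have "w \<in> g ` mcar M" using fg(4) by (simp add: e_space_def)
    then obtain v where v: "w = g v" "v \<in> mcar M" by blast
    \<comment> \<open>The chosen preimage v is replaced by e(\<nu>) v, which still maps to w because
      e(\<nu>) fixes w.\<close>
    have "mE M \<nu> v \<in> e_space \<nu> M"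
      using gmod_e_idem [OF M(2) v(2)] gmod_gen_closed [OF M(2) v(2)] by (simp add: e_space_def)
    moreover have "w = g (mE M \<nu> v)" using w v g_gen [of v "GenE \<nu>"] by (simp add: e_space_def)
    ultimately show "w \<in> g ` e_space \<nu> M" by blast
  qed
  ultimately show "vector_space.dim (mscale M) (e_space \<nu> M)
      = vector_space.dim (mscale M') (e_space \<nu> M') + vector_space.dim (mscale M'') (e_space \<nu> M'')"
    by (intro exact_dim [OF M e_space_subspace [OF M(1)] e_space_subspace [OF M(2)] _ _ lin(1) fg(3) _ lin(2)])
      (auto simp: e_space_def)
qed

text \<open>An additive d extends to a homomorphism \<Phi> on the free abelian group, which vanishes
  on the relations of short exact sequences.\<close>

lemma groth_invariant:
  fixes d :: "'k::field_char_0 rmod \<Rightarrow> nat"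
  assumes additive: "\<And>\<beta> M' M M''. is_gmod \<beta> M' \<Longrightarrow> is_gmod \<beta> M \<Longrightarrow> is_gmod \<beta> M'' \<Longrightarrow> is_ses M' M M'' \<Longrightarrow>
      d M = d M' + d M''"
    and rel: "gcls M - gcls N \<in> groth_relations"
  shows "d M = d N"
proof -
  define \<Phi> where "\<Phi> z = (\<Sum>X\<in>keys z. lookup z X * int (d X))" for z :: "'k rmod \<Rightarrow>\<^sub>0 int"
  have superset: "\<Phi> z = (\<Sum>X\<in>A. lookup z X * int (d X))" if "finite A" "keys z \<subseteq> A" for z A
    unfolding \<Phi>_def by (rule sum.mono_neutral_left) (use that in \<open>auto simp: in_keys_iff\<close>)
  have diff: "\<Phi> (y - z) = \<Phi> y - \<Phi> z" for y z
  proof -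
    have "keys (y - z) \<subseteq> keys y \<union> keys z" by (auto simp: in_keys_iff lookup_minus)
    then show ?thesis
      using superset [of "keys y \<union> keys z"]
      by (simp add: lookup_minus left_diff_distrib sum_subtractf)
  qed
  have cls: "\<Phi> (gcls X) = int (d X)" for X by (simp add: \<Phi>_def gcls_def)
  have "\<Phi> z = 0" if "z \<in> groth_relations" for z
    using that unfolding groth_relations_def
  proof induction
    case (base z)
    then consider "z = 0" | M' M M'' \<beta> where "z = gcls M - gcls M' - gcls M''" "is_gmod \<beta> M'" "is_gmod \<beta> M"
      "is_gmod \<beta> M''" "is_ses M' M M''" by blast
    then show ?case
    proof cases
      case 1
      then show ?thesis by (simp add: \<Phi>_def)
    next
      case 2
      then show ?thesis using additive [OF 2(2-5)] by (simp add: diff cls)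
    qed
  qed (simp add: diff)
  from this [OF rel] show ?thesis by (simp add: diff cls)
qed

section \<open>Recognising a one-dimensional module\<close>

lemma dim_one:
  assumes "vector_space s" "module.subspace s U" "vector_space.dim s U = 1"
  obtains v where "v \<noteq> 0" "U = range (\<lambda>c. s c v)"
proof -
  interpret vector_space s by fact
  obtain B where B: "B \<subseteq> U" "independent B" "U \<subseteq> span B" "card B = dim U" by (rule basis_exists)
  then obtain v where v: "B = {v}" using assms(3) by (metis card_1_singletonE)
  have "U = span B" using B assms(2) by (simp add: span_minimal subset_antisym)
  then show thesis using that [of v] B(2) v by (simp add: span_singleton)
qed

lemma dim_nonzero:
  assumes "vector_space s" "vector_space.dim s U \<noteq> 0"
  obtains w where "w \<in> U" "w \<noteq> 0"
proof -
  interpret vector_space s by fact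
  have "\<not> U \<subseteq> {0}"
  proof
    assume "U \<subseteq> {0}"
    then have "U \<subseteq> span {}" by simp
    then have "dim U \<le> card ({} :: 'b set)" by (rule dim_le_card) simp
    then show False using assms(2) by simp
  qed
  then show thesis using that by blast
qed

text \<open>The e(\<nu>) part is the whole line. x_k would raise the degree by 2 and \<tau>_k would
  land in the part of a different word, so both vanish; self-duality puts the line in degree
  0.\<close>

lemma one_dim_recognition:
  fixes M :: "('k::field_char_0, 'v::ab_group_add) gmod"
  assumes M: "is_gmod \<beta> M" and "self_dual M" and "path \<nu>"
    and dim: "vector_space.dim (mscale M) (mcar M) = 1" "vector_space.dim (mscale M) (e_space \<nu> M) = 1"
  shows "M \<cong>\<^sub>g (one_dim \<nu> :: ('k, 'k) gmod)"
proof -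
  interpret free_action "mscale M" "mgen M" "mcar M" by (rule gmod_free_action [OF M])
  obtain v where v: "v \<noteq> 0" "mcar M = range (\<lambda>c. mscale M c v)"
    by (rule dim_one [OF vector_space_axioms subspace_U dim(1)])
  have v_car: "v \<in> mcar M" using v(2) by (metis rangeI scale_one)
  have multiple: "\<exists>c. w = mscale M c v" if "w \<in> mcar M" for w using that v(2) by blast
  obtain w where w: "w \<in> e_space \<nu> M" "w \<noteq> 0"
    using dim_nonzero [OF vector_space_axioms, of "e_space \<nu> M"] dim(2) by auto
  then obtain c where c: "w = mscale M c v" "c \<noteq> 0" using multiple [of w] by (auto simp: e_space_def)
  have "mscale M c (mE M \<nu> v) = mscale M c v"
    using w(1) c(1) op_scale [OF v_car] by (simp add: e_space_def)
  then have ev: "mE M \<nu> v = v" using c(2) by simp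
  \<comment> \<open>\<beta> is arbitrary at first; a nonzero vector fixed by e(\<nu>) forces \<nu>
    to be a word of \<beta>.\<close>
  have \<beta>: "\<beta> = mset \<nu>" using gmod_e_outside [OF M v_car, of \<nu>] ev v(1) by auto
  have ops: "klr_ops \<beta> (mgen M) w" if "w \<in> mcar M" for w
    using gmod_klr_ops [OF M _ that] count_distinct_le [OF path_distinct [OF \<open>path \<nu>\<close>]] by (simp add: \<beta>)
  have \<nu>I: "\<nu> \<in> permutations_of_multiset \<beta>" by (simp add: \<beta> permutations_of_multiset_def)
  have other: "mE M \<mu> v = 0" if "\<mu> \<noteq> \<nu>" for \<mu>
    using klr_e_other [OF ops [OF v_car] _ \<nu>I that] klr_e_out [OF ops [OF v_car], of \<mu>] ev by metis
  have zero_deg: "0 \<in> mdeg M d" for d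
    using subspace_0 [OF gmod_deg_subspace [OF M]] .
  obtain d where d: "v \<in> mdeg M d"
  proof -
    obtain h where h: "\<And>i. h i \<in> mdeg M i" "v = (\<Sum>i | h i \<noteq> 0. h i)"
      using gmod_decomp [OF M] v_car unfolding direct_sum_decomp_def by metis
    obtain i where i: "h i \<noteq> 0"
    proof (rule ccontr)
      assume "\<not> thesis"
      with that have "{i. h i \<noteq> 0} = {}" by blast
      with h(2) v(1) show False by simp
    qed
    have "h i \<in> mcar M" using h(1) gmod_decomp [OF M] by (auto simp: direct_sum_decomp_def)
    then obtain c where c: "h i = mscale M c v" using multiple by blast
    with i have "mscale M (inverse c) (h i) = v" by auto
    moreover have "mscale M (inverse c) (h i) \<in> mdeg M i"
      by (rule subspace_scale [OF gmod_deg_subspace [OF M] h(1)])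
    ultimately show thesis using that by simp
  qed
  have scale_deg: "mscale M c v \<in> mdeg M d" for c
    by (rule subspace_scale [OF gmod_deg_subspace [OF M] d])
  have xv: "mX M k v = 0" for k
  proof (cases "k \<in> {1..size \<beta>}")
    case True
    have "mX M k (mE M \<nu> v) \<in> mdeg M (d + pairing (alpha (\<nu> ! (k - 1))) (alpha (\<nu> ! (k - 1))))"
      using M d \<nu>I True unfolding is_gmod_def by blast
    then have "mX M k v \<in> mdeg M (d + 2)" by (simp add: ev pairing_alpha lookup_alpha)
    moreover have "mX M k v \<in> mdeg M d"
      using multiple [OF op_closed [OF v_car, of "GenX k"]] scale_deg by auto
    ultimately show ?thesis
      using homogeneous_unique [OF gmod_decomp [OF M], of _ d "d + 2"] zero_deg by simp
  qed (rule klr_x_out [OF ops [OF v_car]])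
  have tv: "mT M k v = 0" for k
  proof (cases "k \<in> {1..<size \<beta>}")
    case True
    obtain c where c: "mT M k v = mscale M c v" using multiple [OF op_closed [OF v_car]] by blast
    have "\<nu> ! (k - 1) \<noteq> \<nu> ! k"
      using True path_distinct [OF \<open>path \<nu>\<close>] by (auto simp: \<beta> nth_eq_iff_index_eq)
    moreover have "swap_at k \<nu> ! k = \<nu> ! (k - 1)"
      using True by (simp add: swap_at_def \<beta>)
    ultimately have "swap_at k \<nu> \<noteq> \<nu>" by metis
    have "mT M k v = mT M k (mE M \<nu> v)" by (simp add: ev)
    also have "\<dots> = mE M (swap_at k \<nu>) (mT M k v)" by (rule klr_t_e [OF ops [OF v_car] True \<nu>I])
    also have "\<dots> = 0"
      using other [OF \<open>swap_at k \<nu> \<noteq> \<nu>\<close>] by (simp add: c op_scale [OF v_car])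
    finally show ?thesis .
  qed (rule klr_t_out [OF ops [OF v_car]])
  \<comment> \<open>The dual of a line in degree d lives in degree - d, so for nonzero d a
    homomorphism preserving degrees would send v to 0.\<close>
  have "d = 0"
  proof (rule ccontr)
    assume "d \<noteq> 0"
    obtain h where h: "gmod_hom M (dual_gmod M) h" "bij_betw h (mcar M) (mcar (dual_gmod M))"
      using \<open>self_dual M\<close> by (auto simp: self_dual_def gmod_iso_def)
    have hv: "h v \<in> mdeg (dual_gmod M) d" using h(1) d unfolding gmod_hom_def by blast
    then have lin: "lin_on (mscale M) (*) (mcar M) (h v)" and out: "\<And>x. x \<notin> mcar M \<Longrightarrow> h v x = 0"
      and deg: "\<forall>d'. d' \<noteq> - d \<longrightarrow> (\<forall>x\<in>mdeg M d'. h v x = 0)"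
      by (simp_all add: dual_gmod_def Let_def)
    have "d \<noteq> - d" using \<open>d \<noteq> 0\<close> by simp
    with deg d have "h v v = 0" by blast
    have "h v x = 0" for x
    proof (cases "x \<in> mcar M")
      case True
      then obtain c where "x = mscale M c v" using multiple by blast
      then show ?thesis using lin v_car \<open>h v v = 0\<close> by (simp add: lin_on_def)
    qed (rule out)
    then have "h v = 0" by (simp add: fun_eq_iff)
    moreover have "h 0 = 0"
    proof -
      have "h (mscale M 0 v) = mscale (dual_gmod M) 0 (h v)"
        using h(1) v_car unfolding gmod_hom_def lin_on_def by blast
      then show ?thesis by (simp add: dual_gmod_def Let_def fun_eq_iff)
    qed
    ultimately have "h v = h 0" by simp
    then have "v = 0"
      by (rule inj_onD [OF bij_betw_imp_inj_on [OF h(2)] _ v_car subspace_0 [OF subspace_U]])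
    with v(1) show False ..
  qed
  define f where "f w = (SOME c. w = mscale M c v)" for w
  have f: "f (mscale M c v) = c" for c
    unfolding f_def by (rule some_equality) (use v(1) in auto)
  have gens: "mgen M g v = mscale M (if g = GenE \<nu> then 1 else 0) v" for g
    using ev other xv tv by (cases g) auto
  show ?thesis
    unfolding gmod_iso_def
  proof (intro exI conjI)
    show "gmod_hom M (one_dim \<nu>) f"
      unfolding gmod_hom_def
    proof (intro conjI allI ballI)
      show "lin_on (mscale M) (mscale (one_dim \<nu>)) (mcar M) f"
        unfolding lin_on_def v(2) by (auto simp: one_dim_def f simp flip: scale_left_distrib)
      show "f (mgen M g w) = mgen (one_dim \<nu>) g (f w)" if w: "w \<in> mcar M" for g w
      proof -
        obtain a where a: "w = mscale M a v" using multiple [OF w] by blast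
        have "f (mgen M g w) = a * (if g = GenE \<nu> then 1 else 0)"
          using f [of "a * (if g = GenE \<nu> then 1 else 0)"] by (simp add: a op_scale [OF v_car] gens)
        then show ?thesis by (simp add: one_dim_def a f)
      qed
      show "f ` mdeg M e \<subseteq> mdeg (one_dim \<nu>) e" for e
      proof (cases "e = 0")
        case False
        have "w = 0" if w: "w \<in> mdeg M e" for w
        proof -
          have "w \<in> mcar M" using w gmod_decomp [OF M] by (auto simp: direct_sum_decomp_def)
          then have "w \<in> mdeg M 0" using multiple scale_deg \<open>d = 0\<close> by blast
          from homogeneous_unique [OF gmod_decomp [OF M] w this False zero_deg] show ?thesis .
        qed
        moreover have "f 0 = 0" using f [of 0] by simp
        ultimately show ?thesis by (auto simp: one_dim_def)
      qed (simp add: one_dim_def)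
    qed (simp add: one_dim_def)
    show "bij_betw f (mcar M) (mcar (one_dim \<nu>))"
      by (rule bij_betw_byWitness [where f' = "\<lambda>c. mscale M c v"]) (auto simp: v(2) f one_dim_def)
  qed
qed

lemma line_mod_simple:
  assumes "\<nu> \<noteq> []"
  shows "gsimple (line_mod \<nu> :: 'k::field_char_0 rmod)"
  unfolding gsimple_def
proof (intro conjI allI impI)
  have "Poly_Mapping.single 0 (1::'k) \<in> mcar (line_mod \<nu>)" by (simp add: line_mod_simps)
  moreover have "Poly_Mapping.single 0 (1::'k) \<noteq> 0" by simp
  ultimately show "mcar (line_mod \<nu> :: 'k rmod) \<noteq> {0}" by blast
  fix S assume S: "gsubmodule (line_mod \<nu> :: 'k rmod) S"
  then have sub: "pm.subspace S" "S \<subseteq> {f. keys f \<subseteq> {0}}" by (simp_all add: gsubmodule_def line_mod_simps)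
  show "S = {0} \<or> S = mcar (line_mod \<nu> :: 'k rmod)"
  proof (cases "S \<subseteq> {0}")
    case True
    then show ?thesis using pm.subspace_0 [OF sub(1)] by blast
  next
    case False
    then obtain w where w: "w \<in> S" "w \<noteq> 0" by blast
    then obtain a where a: "w = Poly_Mapping.single 0 a"
      using sub(2) keys_subset_singleton [of w 0] by auto
    with w(2) have "a \<noteq> 0" by auto
    have "x \<in> S" if "keys x \<subseteq> {0}" for x
    proof -
      have "x = pm_scale (lookup x 0 / a) w"
        using that \<open>a \<noteq> 0\<close> by (simp add: a keys_subset_singleton)
      then show ?thesis using pm.subspace_scale [OF sub(1) w(1)] by metis
    qed
    then show ?thesis using sub(2) by (auto simp: line_mod_simps)
  qed
qed

text \<open>Multiplying the coordinates at 0 pairs the line with itself; each generator acts by a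
  scalar and so equals its transpose.\<close>

lemma line_mod_self_dual:
  assumes "\<nu> \<noteq> []"
  shows "self_dual (line_mod \<nu> :: 'k::field_char_0 rmod)"
proof -
  let ?L = "line_mod \<nu> :: 'k rmod"
  let ?b = "Poly_Mapping.single 0 (1::'k)"
  define h where "h m = (\<lambda>w. if w \<in> mcar ?L then lookup m 0 * lookup w 0 else 0)" for m :: "nat \<Rightarrow>\<^sub>0 'k"
  have car: "w \<in> mcar ?L \<longleftrightarrow> w = Poly_Mapping.single 0 (lookup w 0)" for w
    by (simp add: line_mod_simps keys_subset_singleton)
  have closed: "v + w \<in> mcar ?L" "pm_scale c v \<in> mcar ?L" if "v \<in> mcar ?L" "w \<in> mcar ?L" for v w c
    using that pm.subspace_add [OF subspace_keys] pm.subspace_scale [OF subspace_keys]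
    by (simp_all add: line_mod_simps(1))
  have D: "mcar (dual_gmod ?L) = {f. lin_on pm_scale (*) (mcar ?L) f \<and> (\<forall>v. v \<notin> mcar ?L \<longrightarrow> f v = 0)}"
    by (simp add: dual_gmod_def Let_def line_mod_simps(2))
  have hD: "h m \<in> mcar (dual_gmod ?L)" for m
    unfolding D using closed by (simp add: h_def lin_on_def lookup_add algebra_simps)
  have inverse: "h (Poly_Mapping.single 0 (f ?b)) = f" if f: "f \<in> mcar (dual_gmod ?L)" for f
  proof
    fix w
    show "h (Poly_Mapping.single 0 (f ?b)) w = f w"
    proof (cases "w \<in> mcar ?L")
      case True
      have b: "?b \<in> mcar ?L" by (simp add: line_mod_simps)
      have "w = pm_scale (lookup w 0) ?b" using True car [of w] by (simp del: single_one)
      then have "f w = lookup w 0 * f ?b"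
        using f b unfolding D lin_on_def by (metis (mono_tags, lifting) mem_Collect_eq)
      then show ?thesis using True by (simp add: h_def del: single_one)
    qed (use f in \<open>simp add: h_def D\<close>)
  qed
  have "gmod_hom ?L (dual_gmod ?L) h"
    unfolding gmod_hom_def
  proof (intro conjI allI ballI)
    show "h ` mcar ?L \<subseteq> mcar (dual_gmod ?L)" using hD by blast
    show "lin_on (mscale ?L) (mscale (dual_gmod ?L)) (mcar ?L) h"
      by (auto simp: lin_on_def h_def dual_gmod_def Let_def line_mod_simps(2) lookup_add fun_eq_iff algebra_simps)
    show "h (mgen ?L g m) = mgen (dual_gmod ?L) g (h m)" if "m \<in> mcar ?L" for g m
    proof
      fix w
      show "h (mgen ?L g m) w = mgen (dual_gmod ?L) g (h m) w"
      proof (cases "w \<in> mcar ?L")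
        case True
        have "0 \<in> mcar ?L" by (simp add: line_mod_simps)
        then show ?thesis
          using that True line_mod_gen [of m \<nu>] line_mod_gen [of w \<nu>] assms
          by (cases g) (auto simp: h_def dual_gmod_def Let_def line_mod_simps(1))
      next
        case False
        then show ?thesis by (simp add: h_def dual_gmod_def Let_def)
      qed
    qed
    show "h ` mdeg ?L d \<subseteq> mdeg (dual_gmod ?L) d" for d
    proof clarify
      fix m assume m: "m \<in> mdeg ?L d"
      have "h m v = 0" if "d' \<noteq> - d" "v \<in> mdeg ?L d'" for d' v
      proof -
        have "d \<noteq> 0 \<or> d' \<noteq> 0" using that(1) by auto
        then have "m = 0 \<or> v = 0" using m that(2) by (auto simp: line_mod_simps)
        then show ?thesis by (auto simp: h_def)
      qed
      then show "h m \<in> mdeg (dual_gmod ?L) d"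
        using hD [of m] by (simp add: dual_gmod_def Let_def)
    qed
  qed
  moreover have "bij_betw h (mcar ?L) (mcar (dual_gmod ?L))"
  proof (rule bij_betw_byWitness [where f' = "\<lambda>f. Poly_Mapping.single 0 (f ?b)"])
    have "h m ?b = lookup m 0" for m by (simp add: h_def line_mod_simps(1))
    then show "\<forall>m\<in>mcar ?L. Poly_Mapping.single 0 (h m ?b) = m" using car by metis
    show "\<forall>f\<in>mcar (dual_gmod ?L). h (Poly_Mapping.single 0 (f ?b)) = f" using inverse by blast
    show "h ` mcar ?L \<subseteq> mcar (dual_gmod ?L)" using hD by blast
    show "(\<lambda>f. Poly_Mapping.single 0 (f ?b)) ` mcar (dual_gmod ?L) \<subseteq> mcar ?L"
      by (auto simp: line_mod_simps(1) split: if_splits)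
  qed
  ultimately show ?thesis unfolding self_dual_def gmod_iso_def by blast
qed

lemma line_mod_dims:
  assumes "\<nu> \<noteq> []"
  shows "vector_space.dim (mscale (line_mod \<nu> :: 'k::field_char_0 rmod)) (mcar (line_mod \<nu> :: 'k rmod)) = 1"
    and "vector_space.dim (mscale (line_mod \<nu> :: 'k rmod)) (e_space \<nu> (line_mod \<nu> :: 'k rmod)) = 1"
proof -
  have "pm.independent {Poly_Mapping.single 0 (1::'k)}" by simp
  from pm.dim_span_eq_card_independent [OF this]
  have "pm.dim (pm.span ((\<lambda>k. Poly_Mapping.single k (1::'k)) ` {0})) = 1" by simp
  then have "pm.dim {f :: nat \<Rightarrow>\<^sub>0 'k. keys f \<subseteq> {0}} = 1" by (simp only: span_keys)
  moreover have "e_space \<nu> (line_mod \<nu> :: 'k rmod) = {f. keys f \<subseteq> {0}}"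
    using line_mod_gen(1) [OF _ assms] by (auto simp: e_space_def line_mod_simps(1))
  ultimately show "vector_space.dim (mscale (line_mod \<nu> :: 'k rmod)) (mcar (line_mod \<nu> :: 'k rmod)) = 1"
    "vector_space.dim (mscale (line_mod \<nu> :: 'k rmod)) (e_space \<nu> (line_mod \<nu> :: 'k rmod)) = 1"
    by (simp_all add: line_mod_simps)
qed

text \<open>Injectivity of \<open>ch\<close> makes the two classes equal in the Grothendieck group,
  where both dimensions are well defined.\<close>

lemma ch_eq_line_mod:
  fixes M :: "'k::field_char_0 rmod"
  assumes "is_ch ch" "path \<nu>" "\<nu> \<noteq> []" and M: "is_gmod \<beta> M" "self_dual M"
    and eq: "ch (gcls M) = ch (gcls (line_mod \<nu>))"
  shows "M \<cong>\<^sub>g (one_dim \<nu> :: ('k, 'k) gmod)"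
proof -
  let ?L = "line_mod \<nu> :: 'k rmod"
  have free: "gcls M \<in> groth_free" "gcls ?L \<in> groth_free"
    unfolding groth_free_def using M(1) line_is_gmod [OF assms(2,3)]
    by (auto intro!: group_closure.base)
  then have diff: "gcls M - gcls ?L \<in> groth_free"
    unfolding groth_free_def by (intro group_closure.diff)
  have add: "ch (y + z) = ch y + ch z" if "y \<in> groth_free" "z \<in> groth_free" for y z
    using assms(1) that by (simp add: is_ch_def)
  have "ch (gcls M - gcls ?L) = 0"
    using add [OF diff free(2)] eq by simp
  then have rel: "gcls M - gcls ?L \<in> groth_relations"
    using assms(1) diff by (auto simp: is_ch_def)
  have "vector_space.dim (mscale M) (mcar M) = 1" "vector_space.dim (mscale M) (e_space \<nu> M) = 1"
    using groth_invariant [where d = "\<lambda>M. vector_space.dim (mscale M) (mcar M)", OF ses_dim(1) rel]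
      groth_invariant [where d = "\<lambda>M. vector_space.dim (mscale M) (e_space \<nu> M)", OF ses_dim(2) rel]
    by (simp_all add: line_mod_dims [OF assms(3)])
  with M assms(2) show ?thesis by (intro one_dim_recognition)
qed

section \<open>Extremal vectors of minuscule modules\<close>

text \<open>In a minuscule module only first divided powers occur between extremal vectors, so this
  is the whole normalisation.\<close>

lemma qfact_one: "qfact (Suc 0) = 1"
proof -
  have "qint 1 \<noteq> qint 0" using qint_inj [of 1 0] by auto
  then have "qq - inverse qq \<noteq> 0" by (auto simp: qint_def)
  then show ?thesis by (simp add: qfact_def qint_def)
qed

locale minuscule_model =
  fixes j :: int and V :: "'u::ab_group_add uqmod" and u :: "weight \<Rightarrow> 'u" and B :: "'u \<Rightarrow> 'u \<Rightarrow> qfield"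
  assumes model: "is_hw_model (Lam j) V u B"
begin

abbreviation "orbit \<equiv> weyl_orbit (Lam j)"

lemma uqmod: "is_uqmod V"
  using model by (simp add: is_hw_model_def)

sublocale vector_space "uscale V"
  using uqmod by (simp add: is_uqmod_def)

lemma E_lin: "uE V i (v + w) = uE V i v + uE V i w" "uE V i (uscale V c v) = uscale V c (uE V i v)"
  and F_lin: "uF V i (v + w) = uF V i v + uF V i w" "uF V i (uscale V c v) = uscale V c (uF V i v)"
  using uqmod by (auto simp: is_uqmod_def lin_on_def)

lemma E_zero: "uE V i 0 = 0"
  using E_lin(2) [of i 0 0] by simp

lemma E_wt: "v \<in> uwt V \<mu> \<Longrightarrow> uE V i v \<in> uwt V (\<mu> + alpha i)"
  and F_wt: "v \<in> uwt V \<mu> \<Longrightarrow> uF V i v \<in> uwt V (\<mu> - alpha i)"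
  using uqmod by (auto simp: is_uqmod_def)

lemma EF: "v \<in> uwt V \<mu> \<Longrightarrow> uE V i (uF V i v) = uF V i (uE V i v) + uscale V (qint (lookup \<mu> i)) v"
proof -
  assume "v \<in> uwt V \<mu>"
  then have "uE V i (uF V i v) - uF V i (uE V i v) = uscale V (qint (pairing (alpha i) \<mu>)) v"
    using uqmod unfolding is_uqmod_def by metis
  then show ?thesis by (simp add: pairing_alpha algebra_simps)
qed

lemma B_right: "B v (w + x) = B v w + B v x" "B v (uscale V c w) = c * B v w"
  and B_sym: "B v w = B w v" and B_E: "B (uE V i v) w = B v (uF V i w)"
  and B_top: "B (u (Lam j)) (u (Lam j)) = 1"
  using model by (auto simp: is_hw_model_def lin_on_def)

lemma B_left: "B (v + w) x = B v x + B w x" "B (uscale V c v) x = c * B v x"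
  using B_right B_sym by metis+

lemma B_zero_left: "B 0 x = 0"
  using B_left(2) [of 0 0 x] by simp

lemma B_F: "B (uF V i v) w = B v (uE V i w)"
  using B_E B_sym by metis

text \<open>By adjunction e_i f_i - f_i e_i is symmetric for \<open>B\<close>. It acts on the two
  weight spaces by the quantum integers of the i-th coefficients, which differ for some i.\<close>

lemma B_orthogonal:
  assumes "v \<in> uwt V \<kappa>" "w \<in> uwt V \<zeta>" "\<kappa> \<noteq> \<zeta>"
  shows "B v w = 0"
proof -
  obtain i where i: "lookup \<kappa> i \<noteq> lookup \<zeta> i"
    using assms(3) by (auto simp: poly_mapping_eq_iff fun_eq_iff)
  have "B (uE V i (uF V i v)) w = B v (uE V i (uF V i w))" by (simp add: B_E B_F)
  moreover have "B (uF V i (uE V i v)) w = B v (uF V i (uE V i w))" by (simp add: B_E B_F)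
  ultimately have "qint (lookup \<kappa> i) * B v w = qint (lookup \<zeta> i) * B v w"
    by (simp add: EF [OF assms(1)] EF [OF assms(2)] B_left B_right)
  then show ?thesis using qint_inj i by auto
qed

lemma minuscule: "\<mu> \<in> orbit \<Longrightarrow> lookup \<mu> i \<in> {-1, 0, 1}"
proof -
  assume "\<mu> \<in> orbit"
  then obtain S where "maya S \<mu>" using maya_orbit by blast
  then have "lookup \<mu> i = of_bool (i \<in> S) - of_bool (i + 1 \<in> S)" unfolding maya_def by blast
  then show ?thesis by (simp add: of_bool_def)
qed

lemma extremal:
  assumes "\<mu> \<in> orbit"
  shows "lookup \<mu> i \<ge> 0 \<Longrightarrow> uE V i (u \<mu>) = 0"
    and "lookup \<mu> i = 1 \<Longrightarrow> u (srefl i \<mu>) = uF V i (u \<mu>)"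
    and "lookup \<mu> i \<le> 0 \<Longrightarrow> uF V i (u \<mu>) = 0"
    and "lookup \<mu> i = -1 \<Longrightarrow> u (srefl i \<mu>) = uE V i (u \<mu>)"
proof -
  have "let n = pairing (alpha i) \<mu> in
        (n \<ge> 0 \<longrightarrow> uE V i (u \<mu>) = 0 \<and>
           u (srefl i \<mu>) = uscale V (inverse (qfact (nat n))) ((uF V i ^^ nat n) (u \<mu>)))
      \<and> (n \<le> 0 \<longrightarrow> uF V i (u \<mu>) = 0 \<and>
           u (srefl i \<mu>) = uscale V (inverse (qfact (nat (- n)))) ((uE V i ^^ nat (- n)) (u \<mu>)))"
    using model assms unfolding is_hw_model_def by blast
  then show "lookup \<mu> i \<ge> 0 \<Longrightarrow> uE V i (u \<mu>) = 0"
    "lookup \<mu> i = 1 \<Longrightarrow> u (srefl i \<mu>) = uF V i (u \<mu>)"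
    "lookup \<mu> i \<le> 0 \<Longrightarrow> uF V i (u \<mu>) = 0"
    "lookup \<mu> i = -1 \<Longrightarrow> u (srefl i \<mu>) = uE V i (u \<mu>)"
    by (simp_all add: Let_def pairing_alpha qfact_one)
qed

lemma srefl_minuscule:
  "lookup \<mu> i = 0 \<Longrightarrow> srefl i \<mu> = \<mu>"
  "lookup \<mu> i = 1 \<Longrightarrow> srefl i \<mu> = \<mu> - alpha i"
  "lookup \<mu> i = -1 \<Longrightarrow> srefl i \<mu> = \<mu> + alpha i"
  by (rule poly_mapping_eqI; simp add: lookup_srefl lookup_add lookup_minus)+

text \<open>If the coefficient is -1, then f_i kills u_\<mu> and f_i e_i u_\<mu> = u_\<mu>, so
  adjunction carries the norm over to e_i u_\<mu>. The coefficient 1 is symmetric.\<close>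

lemma extremal_wt_norm:
  assumes "\<mu> \<in> orbit"
  shows "u \<mu> \<in> uwt V \<mu> \<and> B (u \<mu>) (u \<mu>) = 1"
  using assms
proof induction
  case base
  show ?case using model B_top by (simp add: is_hw_model_def)
next
  case (step \<mu> i)
  have "lookup \<mu> i = -1 \<or> lookup \<mu> i = 0 \<or> lookup \<mu> i = 1" using minuscule [OF step.hyps, of i] by auto
  then show ?case
  proof (elim disjE)
    assume l: "lookup \<mu> i = -1"
    have "uE V i (uF V i (u \<mu>)) = 0" using extremal(3) [OF step.hyps, of i] l by (simp add: E_zero)
    then have "uF V i (uE V i (u \<mu>)) = - uscale V (qint (-1)) (u \<mu>)"
      using EF [of "u \<mu>" \<mu> i] step.IH l by (simp add: eq_neg_iff_add_eq_0)
    moreover have "qint (-1) = -1"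
    proof -
      have "qint (-1) = - qint 1"
        by (simp only: qint_def minus_minus minus_divide_left minus_diff_eq)
      then show ?thesis using qfact_one by (simp add: qfact_def)
    qed
    ultimately have "uF V i (uE V i (u \<mu>)) = u \<mu>" by simp
    then have "B (uE V i (u \<mu>)) (uE V i (u \<mu>)) = 1" using step.IH by (simp add: B_E)
    then show ?thesis
      using step.IH E_wt [of "u \<mu>" \<mu> i] unfolding extremal(4) [OF step.hyps l]
      by (simp add: srefl_minuscule(3) [OF l])
  next
    assume l: "lookup \<mu> i = 0"
    then show ?thesis using step.IH by (simp add: srefl_minuscule(1))
  next
    assume l: "lookup \<mu> i = 1"
    have "uE V i (uF V i (u \<mu>)) = uscale V (qint 1) (u \<mu>)"
      using EF [of "u \<mu>" \<mu> i] step.IH l extremal(1) [OF step.hyps, of i] F_lin(2) [of i 0 0] by simp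
    moreover have "qint 1 = 1" using qfact_one by (simp add: qfact_def)
    ultimately have "B (uF V i (u \<mu>)) (uF V i (u \<mu>)) = 1" using step.IH by (simp add: B_F)
    then show ?thesis
      using step.IH F_wt [of "u \<mu>" \<mu> i] unfolding extremal(2) [OF step.hyps l]
      by (simp add: srefl_minuscule(2) [OF l])
  qed
qed

section \<open>Matrix coefficients between extremal vectors\<close>

lemma foldr_E_zero: "foldr (uE V) w 0 = 0"
  by (induction w) (auto simp: E_zero)

lemma foldr_E_wt: "v \<in> uwt V \<mu> \<Longrightarrow> foldr (uE V) w v \<in> uwt V (\<mu> + qwt (mset w))"
proof (induction w)
  case (Cons i w)
  then show ?case using E_wt [of "foldr (uE V) w v" "\<mu> + qwt (mset w)" i] by (simp add: ac_simps)
qed simp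

text \<open>Along a path only the first letter can act: it moves one element of the Maya diagram and thereby
  makes the next letter the only possible one.\<close>

lemma foldr_E_path:
  assumes "path \<nu>" "\<mu> \<in> orbit" "\<And>k. k < length \<nu> \<Longrightarrow> lookup \<mu> (\<nu> ! k) = (if k = 0 then -1 else 0)"
    and "mset w = mset \<nu>"
  shows "foldr (uE V) w (u \<mu>) = (if w = rev \<nu> then u (\<mu> + qwt (mset \<nu>)) else 0)"
  using assms
proof (induction \<nu> arbitrary: \<mu> w)
  case Nil
  then show ?case by simp
next
  case (Cons c \<nu>)
  obtain w' i where w: "w = w' @ [i]"
    using Cons.prems(4) by (cases w rule: rev_cases) auto
  show ?case
  proof (cases "i = c")
    case True
    have l: "lookup \<mu> c = -1" using Cons.prems(3) [of 0] by simp
    have E: "uE V c (u \<mu>) = u (\<mu> + alpha c)"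
      using extremal(4) [OF Cons.prems(2) l] srefl_minuscule(3) [OF l] by simp
    have "foldr (uE V) w' (u (\<mu> + alpha c)) = (if w' = rev \<nu> then u (\<mu> + alpha c + qwt (mset \<nu>)) else 0)"
    proof (rule Cons.IH)
      show "path \<nu>" using path_tl [OF Cons.prems(1)] by simp
      show "\<mu> + alpha c \<in> orbit"
        using weyl_orbit.step [OF Cons.prems(2), of c] srefl_minuscule(3) [OF l] by simp
      show "mset w' = mset \<nu>" using Cons.prems(4) by (simp add: w True)
      fix k assume k: "k < length \<nu>"
      \<comment> \<open>Adding \<alpha>_c lowers the coefficient at the next letter to -1 and leaves
        those further along at 0.\<close>
      have "\<bar>\<nu> ! k - c\<bar> = int k + 1" using pathD [OF Cons.prems(1), of "Suc k" 0] k by simp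
      then show "lookup (\<mu> + alpha c) (\<nu> ! k) = (if k = 0 then -1 else 0)"
        using Cons.prems(3) [of "Suc k"] k by (auto simp: lookup_add lookup_alpha)
    qed
    then show ?thesis by (simp add: w True E add.assoc)
  next
    case False
    have "i \<in> set (c # \<nu>)" using Cons.prems(4) by (metis w mset_eq_setD in_set_conv_decomp)
    then obtain k where "k < length \<nu>" "i = \<nu> ! k" using False by (auto simp: in_set_conv_nth)
    then have "lookup \<mu> i = 0" using Cons.prems(3) [of "Suc k"] by simp
    then have "uE V i (u \<mu>) = 0" by (intro extremal(1) [OF Cons.prems(2)]) simp
    then show ?thesis using False by (simp add: w foldr_E_zero)
  qed
qed

text \<open>Words with other letters than \<nu> end in a weight space orthogonal to u_\<zeta>. Among
  the rearrangements of \<nu> only one survives, and it produces u_\<zeta> itself, of norm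
  1.\<close>

lemma det_fun_path:
  assumes "path \<nu>" "\<mu> \<in> orbit" "\<And>k. k < length \<nu> \<Longrightarrow> lookup \<mu> (\<nu> ! k) = (if k = 0 then -1 else 0)"
    and "\<zeta> \<in> orbit" "\<zeta> = \<mu> + qwt (mset \<nu>)"
  shows "det_fun V u B \<mu> \<zeta> = word_dual (rev \<nu>)"
proof
  fix x
  have B_sum: "B (\<Sum>w\<in>K. h w) v = (\<Sum>w\<in>K. B (h w) v)" for K :: "int fword set" and h v
    by (induction K rule: infinite_finite_induct) (auto simp: B_left B_zero_left)
  have "B (foldr (uE V) (letters w) (u \<mu>)) (u \<zeta>) = of_bool (w = FW (rev \<nu>))" for w
  proof (cases "mset (letters w) = mset \<nu>")
    case True
    have "letters w = rev \<nu> \<longleftrightarrow> w = FW (rev \<nu>)" by (cases w) auto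
    then show ?thesis
      using foldr_E_path [OF assms(1-3) True] extremal_wt_norm [OF assms(4)]
      by (simp add: assms(5) [symmetric] B_zero_left)
  next
    case False
    then have "\<mu> + qwt (mset (letters w)) \<noteq> \<zeta>" using qwt_inj by (auto simp: assms(5))
    then have "B (foldr (uE V) (letters w) (u \<mu>)) (u \<zeta>) = 0"
      using extremal_wt_norm assms(2,4) by (intro B_orthogonal [OF foldr_E_wt]) auto
    moreover have "w \<noteq> FW (rev \<nu>)" using False by auto
    ultimately show ?thesis by simp
  qed
  then have "det_fun V u B \<mu> \<zeta> x = (\<Sum>w\<in>keys x. if w = FW (rev \<nu>) then lookup x w else 0)"
    unfolding det_fun_def free_act_def B_sum B_left by (intro sum.cong) auto
  then show "det_fun V u B \<mu> \<zeta> x = word_dual (rev \<nu>) x"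
    by (auto simp: sum.delta word_dual_def in_keys_iff)
qed

lemma det_module_path:
  fixes ch :: "('k::field_char_0 rmod \<Rightarrow>\<^sub>0 int) \<Rightarrow> uq_free \<Rightarrow> qfield"
  assumes "is_ch ch" "\<nu> \<noteq> []"
    and "path \<nu>" "\<mu> \<in> orbit" "\<And>k. k < length \<nu> \<Longrightarrow> lookup \<mu> (\<nu> ! k) = (if k = 0 then -1 else 0)"
    and "\<zeta> \<in> orbit" "\<zeta> = \<mu> + qwt (mset \<nu>)"
  shows "(\<exists>M. is_det_module ch V u B \<mu> \<zeta> M)
    \<and> (\<forall>M. is_det_module ch V u B \<mu> \<zeta> M \<longrightarrow> M \<cong>\<^sub>g (one_dim \<nu> :: ('k, 'k) gmod))"
proof -
  have eq: "det_fun V u B \<mu> \<zeta> = ch (gcls (line_mod \<nu>))"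
    using det_fun_path [OF assms(3-7)] ch_line_mod [OF assms(1,3,2)] by simp
  have "is_det_module ch V u B \<mu> \<zeta> (line_mod \<nu>)"
    using line_is_gmod [OF assms(3,2)] line_mod_simple [OF assms(2)] line_mod_self_dual [OF assms(2)]
    by (auto simp: is_det_module_def eq)
  moreover have "M \<cong>\<^sub>g (one_dim \<nu> :: ('k, 'k) gmod)" if "is_det_module ch V u B \<mu> \<zeta> M" for M
    using that ch_eq_line_mod [OF assms(1,3,2)] by (auto simp: is_det_module_def eq)
  ultimately show ?thesis by blast
qed

end

theorem corollary4p13:
  fixes ch :: "('k::field_char_0 rmod \<Rightarrow>\<^sub>0 int) \<Rightarrow> uq_free \<Rightarrow> qfield"
    and V :: "'u::ab_group_add uqmod"
    and u :: "weight \<Rightarrow> 'u"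
    and B :: "'u \<Rightarrow> 'u \<Rightarrow> qfield"
    and p l m :: nat
  assumes "is_ch ch"
    and "p \<ge> 1" and "cfun p = (l, m)"
    and "is_hw_model (Lam (jseq p)) V u B"
  shows "(\<exists>M. is_cuspidal_module ch V u B p M)
    \<and> (\<forall>M. is_cuspidal_module ch V u B p M \<longrightarrow>
        M \<cong>\<^sub>g (if even (l + m)
               then Lseg (jseq p - int l + int m + 1) (jseq p + int m)
               else Lrev (jseq p - int l + int m - 1) (jseq p - int l)))"
proof -
  define j where "j = jseq p"
  interpret minuscule_model j V u B
    using assms(4) by unfold_locales (simp add: j_def)
  define \<mu> \<zeta> where "\<mu> = wtilde_act (pplus p) (Lam j)" and "\<zeta> = wtilde_act p (Lam j)"
  have orbit: "\<mu> \<in> orbit" "\<zeta> \<in> orbit"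
    by (simp_all add: \<mu>_def \<zeta>_def wtilde_act_def foldr_srefl_orbit)
  have cusp: "is_cuspidal_module ch V u B p M \<longleftrightarrow> is_det_module ch V u B \<mu> \<zeta> M" for M
    by (simp add: is_cuspidal_module_def \<mu>_def \<zeta>_def j_def)
  from assms(3,2) show ?thesis
  proof (cases rule: cfun_block)
    case (ascending t r)
    have j: "j = int r - int t"
      using ascending by (simp only: j_def jseq_position) simp
    have S: "maya ({..- int t - 1} \<union> {2 - j..int t + 2}) \<mu>"
      unfolding \<mu>_def ascending(2) pplus_ascending [OF ascending(3)]
      using ascending(3) by (intro maya_descending) (auto simp: j of_nat_diff)
    have T: "maya ({..- int t - 1} \<union> {1 - j..int t + 1}) \<zeta>"
      unfolding \<zeta>_def ascending(2) using ascending(3) j by (intro maya_ascending)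
    have range: "- int t \<le> j" "j \<le> int t" using ascending(3) j by auto
    \<comment> \<open>From \<mu> to \<zeta> the interval 2 - j..t + 2 shifts down by one. Its lowest
      element has to move first to make room, so the letters act in increasing order from 1 -
      j.\<close>
    let ?\<nu> = "[1 - j..int t + 1]"
    have "(\<exists>M. is_det_module ch V u B \<mu> \<zeta> M)
      \<and> (\<forall>M. is_det_module ch V u B \<mu> \<zeta> M \<longrightarrow> M \<cong>\<^sub>g (one_dim ?\<nu> :: ('k, 'k) gmod))"
    proof (rule det_module_path [OF assms(1) _ path_upto(1) orbit(1) _ orbit(2)])
      show "?\<nu> \<noteq> []" using range by simp
      show "\<zeta> = \<mu> + qwt (mset ?\<nu>)"
        by (rule maya_add_root [OF S T]) (use range in \<open>auto simp: of_bool_def\<close>)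
      show "lookup \<mu> (?\<nu> ! k) = (if k = 0 then -1 else 0)" if "k < length ?\<nu>" for k
      proof -
        have "lookup \<mu> (?\<nu> ! k) = of_bool (?\<nu> ! k \<in> {..- int t - 1} \<union> {2 - j..int t + 2})
            - of_bool (?\<nu> ! k + 1 \<in> {..- int t - 1} \<union> {2 - j..int t + 2})"
          using S unfolding maya_def by blast
        then show ?thesis using that range by auto
      qed
    qed
    moreover have "Lseg (j - int l + int m + 1) (j + int m) = (one_dim ?\<nu> :: ('k, 'k) gmod)"
      using ascending(3-5) by (simp add: Lseg_def j of_nat_diff algebra_simps)
    ultimately show ?thesis
      using ascending(1) by (simp add: cusp flip: j_def)
  next
    case (descending t r)
    have j: "j = 3 * int t + 2 - int r"
      using descending by (simp only: j_def jseq_position) simp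
    have S: "maya ({..- int (Suc t) - 1} \<union> {1 - j..int (Suc t) + 1}) \<mu>"
      unfolding \<mu>_def descending(2) pplus_descending [OF descending(3,4)]
      using descending(3,4) by (intro maya_ascending) (auto simp: j of_nat_diff)
    have T: "maya ({..- int t - 1} \<union> {2 - j..int t + 2}) \<zeta>"
      unfolding \<zeta>_def descending(2) using descending(3,4) j by (intro maya_descending)
    have range: "- int t \<le> j" "j \<le> int t + 1" using descending(3,4) j by auto
    \<comment> \<open>Here the single element 1 - j descends through a gap to - t - 1, one place at
      a time. The letters act in decreasing order from - j, whence the reversed segment.\<close>
    let ?\<nu> = "rev [- int t - 1..- j]"
    have "(\<exists>M. is_det_module ch V u B \<mu> \<zeta> M)
      \<and> (\<forall>M. is_det_module ch V u B \<mu> \<zeta> M \<longrightarrow> M \<cong>\<^sub>g (one_dim ?\<nu> :: ('k, 'k) gmod))"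
    proof (rule det_module_path [OF assms(1) _ path_upto(2) orbit(1) _ orbit(2)])
      show "?\<nu> \<noteq> []" using range by simp
      have "\<zeta> = \<mu> + qwt (mset [- int t - 1..- j])"
        by (rule maya_add_root [OF S T]) (use range in \<open>auto simp: of_bool_def\<close>)
      then show "\<zeta> = \<mu> + qwt (mset ?\<nu>)" by simp
      show "lookup \<mu> (?\<nu> ! k) = (if k = 0 then -1 else 0)" if "k < length ?\<nu>" for k
      proof -
        have "?\<nu> ! k = - j - int k" using that range by (simp add: rev_nth of_nat_diff)
        moreover have "lookup \<mu> (?\<nu> ! k) = of_bool (?\<nu> ! k \<in> {..- int (Suc t) - 1} \<union> {1 - j..int (Suc t) + 1})
            - of_bool (?\<nu> ! k + 1 \<in> {..- int (Suc t) - 1} \<union> {1 - j..int (Suc t) + 1})"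
          using S unfolding maya_def by blast
        ultimately show ?thesis using that range by auto
      qed
    qed
    moreover have "Lrev (j - int l + int m - 1) (j - int l) = (one_dim ?\<nu> :: ('k, 'k) gmod)"
    proof -
      have "j - int l + int m - 1 = - j" "j - int l = - int t - 1"
        using descending(3-6) by (simp_all add: j of_nat_diff)
      then show ?thesis by (simp only: Lrev_def)
    qed
    ultimately show ?thesis
      using descending(1) by (simp add: cusp flip: j_def)
  qed
qed

end
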